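(* Let $p>1$ and let $f:\mathbb R\to\mathbb R$ be smooth with $f(0)=0$ and $|f'(s)|\lesssim|s|^{p-1}$ for $|s|<1$. There exist $\varepsilon_0>0$ and $\Lambda>0$ such that for every $0<\varepsilon\le\varepsilon_0$, every solution $(u_1,u_2)$ in $H^1\times L^2$ of $$\partial_t u_1=\partial_x u_2,\qquad \partial_t u_2=\partial_x\big(u_1-\partial_x^2u_1-f(u_1)\big),\qquad (t,x)\in\mathbb R\times\mathbb R,$$ with $\|(u_1,u_2)(\cdot,0)\|_{H^1\times L^2}<\varepsilon$, and every constant $\lambda_0\ge\Lambda$, the following holds. There exists an increasing sequence of times $t_n\uparrow\infty$ such that $$\int\operatorname{sech}^2\Big(\frac x{\lambda_0}\Big)\big(u_1^2+(\partial_xu_1)^2+u_2^2\big)(t_n,x)\,dx\longrightarrow0\quad\text{as }n\to+\infty .$$ Moreover, $$\int_2^\infty\int\operatorname{sech}^2\Big(\frac x{\lambda_0}\Big)\big((\partial_xu_1)^2+u_1^2+u_2^2\big)(t,x)\,dx\,dt\lesssim\lambda_0\,\varepsilon^2,$$ with an implicit constant independent of $\lambda_0$, $\varepsilon$ and the solution.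
   Context: Spatial integrals are over $\mathbb R$. Solutions are the real-valued energy-space solutions $(u_1,u_2)\in C(\mathbb R;H^1(\mathbb R)\times L^2(\mathbb R))$ provided by the standard well-posedness theory. Known fact: all sufficiently small $H^1\times L^2$ data give globally defined solutions, the energy $\frac12\int(u_2^2+(\partial_xu_1)^2+u_1^2)\,dx-\int F(u_1)\,dx$, with $F(s)=\int_0^sf(r)\,dr$, is conserved, and for small solutions it is equivalent to $\|(u_1,u_2)(t)\|_{H^1\times L^2}^2$ with constants independent of $t$. *)

theory Defs
  imports "HOL-Analysis.Analysis"
begin

definition smooth :: "(real \<Rightarrow> real) \<Rightarrow> bool" where
  "smooth g \<longleftrightarrow> (\<forall>n x. (deriv ^^ n) g differentiable (at x))"

definition test_function :: "(real \<Rightarrow> real) \<Rightarrow> bool" where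
  "test_function \<phi> \<longleftrightarrow> smooth \<phi> \<and> compact (closure {x. \<phi> x \<noteq> 0})"

definition sech :: "real \<Rightarrow> real" where
  "sech x = 1 / cosh x"

text \<open>Elements of the Lebesgue and Sobolev spaces are given by Borel representatives; every notion
  below is invariant under changing a representative on a null set.\<close>

definition L2 :: "(real \<Rightarrow> real) set" where
  "L2 = {g. g \<in> borel_measurable lborel \<and> integrable lborel (\<lambda>x. (g x)\<^sup>2)}"

definition has_weak_deriv :: "(real \<Rightarrow> real) \<Rightarrow> (real \<Rightarrow> real) \<Rightarrow> bool" where
  "has_weak_deriv g h \<longleftrightarrow> (\<forall>\<phi>. test_function \<phi> \<longrightarrow>
     (\<integral>x. g x * deriv \<phi> x \<partial>lborel) = - (\<integral>x. h x * \<phi> x \<partial>lborel))"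

definition H1 :: "(real \<Rightarrow> real) set" where
  "H1 = {g \<in> L2. \<exists>h\<in>L2. has_weak_deriv g h}"

text \<open>For \<^term>\<open>g \<in> H1\<close> the weak derivative is unique almost everywhere, so the choice of
  representative affects no integral.\<close>

definition wderiv :: "(real \<Rightarrow> real) \<Rightarrow> real \<Rightarrow> real" where
  "wderiv g = (SOME h. h \<in> L2 \<and> has_weak_deriv g h)"

definition energy_norm :: "(real \<Rightarrow> real) \<Rightarrow> (real \<Rightarrow> real) \<Rightarrow> real" where
  "energy_norm g h =
     sqrt ((\<integral>x. (g x)\<^sup>2 \<partial>lborel) + (\<integral>x. (wderiv g x)\<^sup>2 \<partial>lborel) + (\<integral>x. (h x)\<^sup>2 \<partial>lborel))"

definition energy_continuous ::
    "(real \<Rightarrow> real \<Rightarrow> real) \<Rightarrow> (real \<Rightarrow> real \<Rightarrow> real) \<Rightarrow> bool" where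
  "energy_continuous u\<^sub>1 u\<^sub>2 \<longleftrightarrow>
     (\<forall>t. u\<^sub>1 t \<in> H1 \<and> u\<^sub>2 t \<in> L2) \<and>
     (\<forall>s. ((\<lambda>t. energy_norm (\<lambda>x. u\<^sub>1 t x - u\<^sub>1 s x) (\<lambda>x. u\<^sub>2 t x - u\<^sub>2 s x)) \<longlongrightarrow> 0) (at s))"

text \<open>Global energy-space solutions of
  \<open>\<partial>\<^sub>t u\<^sub>1 = \<partial>\<^sub>x u\<^sub>2\<close> and \<open>\<partial>\<^sub>t u\<^sub>2 = \<partial>\<^sub>x (u\<^sub>1 - \<partial>\<^sub>x\<^sup>2 u\<^sub>1 - f u\<^sub>1)\<close>,
  in the distributional sense: all \<open>x\<close>-derivatives are moved to the test function, so the sign of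
  the pairing is \<open>-1\<close> for one derivative and for three. Since the right-hand sides
  depend continuously on time, pairing with test functions of \<open>x\<close> at every time is the same as
  pairing with test functions of \<open>(t, x)\<close>. Functions take the time as first argument.\<close>

definition energy_solution ::
    "(real \<Rightarrow> real) \<Rightarrow> (real \<Rightarrow> real \<Rightarrow> real) \<Rightarrow> (real \<Rightarrow> real \<Rightarrow> real) \<Rightarrow> bool" where
  "energy_solution f u\<^sub>1 u\<^sub>2 \<longleftrightarrow>
     energy_continuous u\<^sub>1 u\<^sub>2 \<and>
     (\<forall>\<phi> t. test_function \<phi> \<longrightarrow>
        ((\<lambda>\<tau>. \<integral>x. u\<^sub>1 \<tau> x * \<phi> x \<partial>lborel) has_real_derivative
           - (\<integral>x. u\<^sub>2 t x * deriv \<phi> x \<partial>lborel)) (at t) \<and>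
        ((\<lambda>\<tau>. \<integral>x. u\<^sub>2 \<tau> x * \<phi> x \<partial>lborel) has_real_derivative
           - ((\<integral>x. (u\<^sub>1 t x - f (u\<^sub>1 t x)) * deriv \<phi> x \<partial>lborel)
              - (\<integral>x. u\<^sub>1 t x * (deriv ^^ 3) \<phi> x \<partial>lborel))) (at t))"

definition local_energy ::
    "real \<Rightarrow> (real \<Rightarrow> real) \<Rightarrow> (real \<Rightarrow> real) \<Rightarrow> ennreal" where
  "local_energy lam g h =
     (\<integral>\<^sup>+x. ennreal ((sech (x / lam))\<^sup>2 * ((g x)\<^sup>2 + (wderiv g x)\<^sup>2 + (h x)\<^sup>2)) \<partial>lborel)"

end

theory Submission
  imports Defs "HOL-Computational_Algebra.Polynomial"
begin

text \<open>
  Write \<open>u\<^sub>1, u\<^sub>2\<close> for the solution and \<open>F\<close> for the antiderivative of \<open>f\<close> vanishing at \<open>0\<close>. Two formal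
  identities carry the proof. The energy density \<open>(u\<^sub>2\<^sup>2 + (\<partial>\<^sub>x u\<^sub>1)\<^sup>2 + u\<^sub>1\<^sup>2) / 2 - F u\<^sub>1\<close> satisfies a
  conservation law, and since \<open>f' 0 = 0\<close> the term \<open>F u\<^sub>1\<close> is a small multiple of \<open>u\<^sub>1\<^sup>2\<close> as long as \<open>u\<^sub>1\<close>
  is pointwise small; so small solutions stay small. For the weight \<open>\<phi> x = \<lambda> tanh (x / \<lambda>)\<close>,
  \<open>d/dt \<integral> \<phi> u\<^sub>1 u\<^sub>2 = - 1/2 \<integral> \<phi>' (u\<^sub>2\<^sup>2 + u\<^sub>1\<^sup>2 + 3 (\<partial>\<^sub>x u\<^sub>1)\<^sup>2) + 1/2 \<integral> \<phi>''' u\<^sub>1\<^sup>2 + \<integral> \<phi>' G u\<^sub>1\<close> with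
  \<open>G s = s f s - F s\<close>. Here \<open>\<phi>' = sech\<^sup>2 (x / \<lambda>)\<close>, and \<open>\<bar>\<phi>'''\<bar> \<le> 4 \<phi>' / \<lambda>\<^sup>2\<close>, so for large \<open>\<lambda>\<close> and
  small \<open>u\<^sub>1\<close> the last two terms are absorbed by the first. As \<open>\<bar>\<integral> \<phi> u\<^sub>1 u\<^sub>2\<bar>\<close> is at most \<open>\<lambda>\<close> times the
  squared energy norm at every time, integrating in time bounds the space-time integral by \<open>\<lambda> \<epsilon>\<^sup>2\<close>. The local
  energy is then integrable on a half-line and hence small along some sequence of times.

  Energy-space solutions are not regular enough for these computations, so both identities are proved
  for the mollified functions \<open>v = u\<^sub>1 * k\<close> and \<open>w = u\<^sub>2 * k\<close> with a test function \<open>k\<close> supported in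
  \<open>[-\<delta>, \<delta>]\<close>. By the distributional form of the equation, \<open>v\<^sub>t = w\<^sub>x\<close> and
  \<open>w\<^sub>t = (v - v\<^sub>x\<^sub>x - f u\<^sub>1 * k)\<^sub>x\<close> hold in the classical sense. The price is the residual
  \<open>(f v - f u\<^sub>1 * k)\<^sub>x\<close>. Its \<open>L\<^sup>1\<close> norm is \<open>O(\<delta>)\<close> (\<open>commutator_pointwise\<close>,
  \<open>integral_commutator_bound\<close>), because the first-order Taylor term of \<open>f\<close> cancels and \<open>u\<^sub>1\<close> is
  Hoelder continuous with exponent \<open>1/2\<close>. In the energy identity the residual is paired with \<open>w\<close>, which
  is bounded only by a multiple of \<open>\<delta>\<close> to the power \<open>-1/2\<close>; the product still tends to zero.

  The two computations are \<open>energy_inequality\<close> and \<open>virial_inequality\<close>; both rest on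
  \<open>integrated_conservation_law\<close>, which integrates a pointwise balance law over a space-time slab. The
  limit \<open>\<delta> \<rightarrow> 0\<close> uses that mollification converges in \<open>L\<^sup>2\<close> (\<open>conv_k_tendsto\<close>), at each fixed time, and
  Fatou's lemma in time. Smallness is propagated by a first-exit-time argument (\<open>stays_small\<close>).
\<close>

section \<open>Smooth functions\<close>

lemma smooth_imp_DERIV:
  assumes "smooth g"
  shows "(g has_real_derivative deriv g x) (at x)"
proof -
  have "(deriv ^^ 0) g differentiable (at x)" using assms unfolding smooth_def by blast
  thus ?thesis by (simp add: DERIV_deriv_iff_real_differentiable)
qed

lemma smooth_deriv: "smooth g \<Longrightarrow> smooth (deriv g)"
proof -
  assume "smooth g"
  hence "(deriv ^^ Suc n) g differentiable (at x)" for n x unfolding smooth_def by blast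
  thus ?thesis unfolding smooth_def by (simp add: funpow_swap1)
qed

lemma smooth_continuous_on: "smooth g \<Longrightarrow> continuous_on A g"
  by (rule DERIV_continuous_on[where D="deriv g"]) (rule DERIV_subset[OF smooth_imp_DERIV], auto)

lemma smooth_of_derivative_family:
  assumes "\<And>n x. (G n has_real_derivative G (Suc n) x) (at x)"
  shows "smooth (G 0)"
proof -
  have "(deriv ^^ n) (G 0) = G n" for n
  proof (induction n)
    case (Suc n)
    have "deriv (G n) = G (Suc n)" by (intro ext DERIV_imp_deriv assms)
    thus ?case using Suc by simp
  qed simp
  thus ?thesis unfolding smooth_def
    by (metis assms real_differentiable_def)
qed

lemma smooth_affine:
  assumes "smooth g"
  shows "smooth (\<lambda>y. c * g (a * y + b))"
    and "(deriv ^^ n) (\<lambda>y. c * g (a * y + b)) = (\<lambda>y. c * a ^ n * (deriv ^^ n) g (a * y + b))"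
proof -
  have d: "((deriv ^^ n) g has_real_derivative (deriv ^^ Suc n) g x) (at x)" for n x
    using assms unfolding smooth_def
    by (simp add: DERIV_deriv_iff_real_differentiable)
  have D: "((\<lambda>y. c * a ^ n * (deriv ^^ n) g (a * y + b)) has_real_derivative
        c * a ^ Suc n * (deriv ^^ Suc n) g (a * x + b)) (at x)" for n x
    by (rule DERIV_chain2[OF d, THEN DERIV_cmult, THEN DERIV_cong])
       (auto intro!: derivative_eq_intros)
  show "smooth (\<lambda>y. c * g (a * y + b))"
    using smooth_of_derivative_family[of "\<lambda>n y. c * a ^ n * (deriv ^^ n) g (a * y + b)", OF D] by simp
  show "(deriv ^^ n) (\<lambda>y. c * g (a * y + b)) = (\<lambda>y. c * a ^ n * (deriv ^^ n) g (a * y + b))"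
  proof (induction n)
    case (Suc n)
    have "deriv (\<lambda>y. c * a ^ n * (deriv ^^ n) g (a * y + b))
          = (\<lambda>x. c * a ^ Suc n * (deriv ^^ Suc n) g (a * x + b))"
      by (intro ext DERIV_imp_deriv[OF D])
    thus ?case using Suc by simp
  qed simp
qed

text \<open>Induction on the number of derivatives: the derivative of a product is a sum of two products, each
  of which has one derivative less to take.\<close>
lemma smooth_mult:
  assumes "smooth g" "smooth h"
  shows "smooth (\<lambda>x. g x * h x)"
proof -
  define P where "P n = (\<lambda>g::real\<Rightarrow>real. \<forall>k\<le>n. \<forall>x. (deriv ^^ k) g differentiable (at x))" for n :: nat
  have P0: "P 0 g \<longleftrightarrow> (\<forall>x. g differentiable (at x))" for g by (simp add: P_def)
  have PS: "P (Suc n) g \<longleftrightarrow> (\<forall>x. g differentiable (at x)) \<and> P n (deriv g)" for n g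
  proof -
    have "(\<forall>k\<le>Suc n. Q k) \<longleftrightarrow> Q 0 \<and> (\<forall>k\<le>n. Q (Suc k))" for Q :: "nat \<Rightarrow> bool"
      by (metis Suc_le_mono le0 not0_implies_Suc)
    from this[of "\<lambda>k. \<forall>x. (deriv ^^ k) g differentiable (at x)"]
    show ?thesis unfolding P_def by (simp add: funpow_swap1)
  qed
  have Padd: "P n (\<lambda>x. g x + h x)" if "P n g" "P n h" for n g h
    using that
  proof (induction n arbitrary: g h)
    case (Suc n)
    have "deriv (\<lambda>x. g x + h x) = (\<lambda>x. deriv g x + deriv h x)"
      using Suc.prems unfolding PS fun_eq_iff
      by (auto intro!: DERIV_imp_deriv DERIV_add simp: DERIV_deriv_iff_real_differentiable)
    thus ?case using Suc unfolding PS by auto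
  qed (auto simp: P0)
  have Pmono: "P n g" if "P (Suc n) g" for n g using that unfolding P_def by auto
  have Pmult: "P n (\<lambda>x. g x * h x)" if "P n g" "P n h" for n g h
    using that
  proof (induction n arbitrary: g h)
    case (Suc n)
    have "deriv (\<lambda>x. g x * h x) = (\<lambda>x. deriv g x * h x + deriv h x * g x)"
      using Suc.prems unfolding PS fun_eq_iff
      by (auto intro!: DERIV_imp_deriv DERIV_mult simp: DERIV_deriv_iff_real_differentiable)
    moreover have "P n (\<lambda>x. deriv g x * h x)" "P n (\<lambda>x. deriv h x * g x)"
      using Suc.IH[of "deriv g" h] Suc.IH[of "deriv h" g] Suc.prems Pmono PS by blast+
    ultimately show ?case using Suc.prems Padd unfolding PS by auto
  qed (auto simp: P0)
  have "smooth g \<longleftrightarrow> (\<forall>n. P n g)" for g unfolding smooth_def P_def by auto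
  thus ?thesis using assms Pmult by auto
qed

section \<open>Mollifiers\<close>

text \<open>The classical functions that are flat at \<open>0\<close>. Allowing a polynomial in \<open>1 / x\<close> as a factor makes the
  class closed under differentiation.\<close>
definition flat_exp :: "real poly \<Rightarrow> real \<Rightarrow> real" where
  "flat_exp p x = (if x > 0 then poly p (1 / x) * exp (- (1 / x)) else 0)"

lemma poly_times_exp_minus_tendsto_0:
  "((\<lambda>y::real. poly p y * exp (- y)) \<longlongrightarrow> 0) at_top"
proof -
  have "((\<lambda>y::real. \<Sum>i\<le>degree p. coeff p i * (y ^ i / exp y)) \<longlongrightarrow> (\<Sum>i\<le>degree p. coeff p i * 0)) at_top"
    by (intro tendsto_intros tendsto_power_div_exp_0)
  thus ?thesis
    by (simp add: poly_altdef sum_distrib_right exp_minus divide_inverse mult.assoc)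
qed

text \<open>At \<open>0\<close> the difference quotient is again of the form \<open>poly q (1 / x) * exp (- 1 / x)\<close>, which tends to
  \<open>0\<close> from the right.\<close>
lemma DERIV_flat_exp:
  "(flat_exp p has_real_derivative flat_exp ([:0, 0, 1:] * (p - pderiv p)) x) (at x)"
proof -
  consider "x > 0" | "x < 0" | "x = 0" by linarith
  thus ?thesis
  proof cases
    case 1
    have "((\<lambda>x. poly p (1 / x) * exp (- (1 / x))) has_real_derivative
        flat_exp ([:0, 0, 1:] * (p - pderiv p)) x) (at x)"
      using 1 unfolding flat_exp_def
      by (auto intro!: derivative_eq_intros poly_DERIV[THEN DERIV_chain2] simp: field_simps power2_eq_square)
    thus ?thesis
      by (rule has_field_derivative_transform_within_open[where S="{0<..}"])
         (use 1 in \<open>auto simp: flat_exp_def\<close>)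
  next
    case 2
    have "((\<lambda>x. 0) has_real_derivative flat_exp ([:0, 0, 1:] * (p - pderiv p)) x) (at x)"
      using 2 by (auto simp: flat_exp_def)
    thus ?thesis
      by (rule has_field_derivative_transform_within_open[where S="{..<0}"])
         (use 2 in \<open>auto simp: flat_exp_def\<close>)
  next
    case 3
    have R: "((\<lambda>h. flat_exp p h / h) \<longlongrightarrow> 0) (at_right 0)"
    proof -
      have "((\<lambda>h. poly ([:0,1:] * p) (inverse h) * exp (- inverse h)) \<longlongrightarrow> 0) (at_right (0::real))"
        by (rule filterlim_compose[OF poly_times_exp_minus_tendsto_0 filterlim_inverse_at_top_right])
      thus ?thesis
        by (rule Lim_transform_eventually)
           (auto simp: eventually_at_filter flat_exp_def divide_inverse)
    qed
    have L: "((\<lambda>h. flat_exp p h / h) \<longlongrightarrow> 0) (at_left 0)"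
      by (rule Lim_transform_eventually[OF tendsto_const])
         (auto simp: eventually_at_filter flat_exp_def)
    have "((\<lambda>h. flat_exp p h / h) \<longlongrightarrow> 0) (at 0)"
      using L R by (simp add: filterlim_split_at)
    thus ?thesis using 3 by (simp add: has_field_derivative_iff flat_exp_def)
  qed
qed

lemma smooth_flat_exp: "smooth (flat_exp p)"
  using smooth_of_derivative_family[of "\<lambda>n. flat_exp (((\<lambda>p. [:0, 0, 1:] * (p - pderiv p)) ^^ n) p)"]
    DERIV_flat_exp by simp

definition bump :: "real \<Rightarrow> real" where
  "bump x = flat_exp 1 (1 + x) * flat_exp 1 (1 - x)"

lemma smooth_bump: "smooth bump"
proof -
  have "smooth (\<lambda>x. flat_exp 1 (1 + x))" "smooth (\<lambda>x. flat_exp 1 (1 - x))"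
    using smooth_affine(1)[OF smooth_flat_exp[of 1], of 1 1 1] smooth_affine(1)[OF smooth_flat_exp[of 1], of
        1 "-1" 1]
    by (simp_all add: algebra_simps)
  thus ?thesis unfolding bump_def by (rule smooth_mult)
qed

lemma bump_nonneg: "bump x \<ge> 0"
  and bump_eq_0: "\<bar>x\<bar> \<ge> 1 \<Longrightarrow> bump x = 0"
  and bump_pos: "\<bar>x\<bar> < 1 \<Longrightarrow> bump x > 0"
  by (auto simp: bump_def flat_exp_def)

lemma continuous_bounded_on_interval:
  fixes g :: "real \<Rightarrow> real"
  assumes "continuous_on UNIV g"
  obtains K where "\<And>s. \<bar>s\<bar> \<le> M \<Longrightarrow> \<bar>g s\<bar> \<le> K"
proof -
  have "compact (g ` {-M..M})"
    by (intro compact_continuous_image continuous_on_subset[OF assms]) auto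
  hence "bounded (g ` {-M..M})" by (rule compact_imp_bounded)
  then obtain K where "\<forall>y\<in>g ` {-M..M}. norm y \<le> K" unfolding bounded_iff by (rule exE)
  thus ?thesis by (intro that[of K]) (auto simp: abs_le_iff)
qed

lemma test_functionI:
  assumes "smooth g" "\<And>x. \<bar>x\<bar> > r \<Longrightarrow> g x = 0"
  shows "test_function g"
proof -
  have "{x. g x \<noteq> 0} \<subseteq> {-r..r}" using assms(2) by (force simp: abs_le_iff)
  hence "closure {x. g x \<noteq> 0} \<subseteq> {-r..r}" by (rule closure_minimal) auto
  hence "compact (closure {x. g x \<noteq> 0})"
    by (meson bounded_closed_interval bounded_subset closed_closure compact_eq_bounded_closed)
  thus ?thesis using assms by (simp add: test_function_def)
qed

lemma test_function_support:
  assumes "test_function g"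
  obtains r where "r > 0" "\<And>x. \<bar>x\<bar> \<ge> r \<Longrightarrow> g x = 0"
proof -
  have "bounded {x. g x \<noteq> 0}"
    using assms bounded_subset[OF compact_imp_bounded closure_subset] unfolding test_function_def by blast
  then obtain r where r: "\<And>x. g x \<noteq> 0 \<Longrightarrow> \<bar>x\<bar> \<le> r" unfolding bounded_iff by auto
  show ?thesis by (rule that[of "\<bar>r\<bar> + 1"]) (use r in force)+
qed

lemma test_function_deriv:
  assumes "test_function g" shows "test_function (deriv g)"
proof -
  obtain r where r: "r > 0" "\<And>x. \<bar>x\<bar> \<ge> r \<Longrightarrow> g x = 0" using test_function_support[OF assms] by blast
  have "deriv g x = 0" if "\<bar>x\<bar> > r" for x
  proof (rule DERIV_imp_deriv)
    have "open {x. \<bar>x\<bar> > r}" by (intro open_Collect_less continuous_intros)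
    thus "(g has_real_derivative 0) (at x)"
      using that r(2) by (intro has_field_derivative_transform_within_open[OF DERIV_const, of "{x. \<bar>x\<bar> >
          r}"]) auto
  qed
  thus ?thesis using assms smooth_deriv by (intro test_functionI[of _ r]) (auto simp: test_function_def)
qed

lemma test_function_deriv_funpow: "test_function g \<Longrightarrow> test_function ((deriv ^^ n) g)"
  by (induction n) (auto intro: test_function_deriv)

lemma test_function_reflect:
  assumes "test_function g" shows "test_function (\<lambda>y. g (x - y))"
proof -
  obtain r where r: "r > 0" "\<And>x. \<bar>x\<bar> \<ge> r \<Longrightarrow> g x = 0" using test_function_support[OF assms] by blast
  show ?thesis
  proof (rule test_functionI[of _ "r + \<bar>x\<bar>"])
    show "smooth (\<lambda>y. g (x - y))"
      using smooth_affine(1)[of g 1 "-1" x] assms by (simp add: test_function_def algebra_simps)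
  qed (use r in auto)
qed

lemma deriv_reflect:
  assumes "test_function g"
  shows "(deriv ^^ n) (\<lambda>y. g (x - y)) = (\<lambda>y. (-1) ^ n * (deriv ^^ n) g (x - y))"
  using smooth_affine(2)[of g n 1 "-1" x] assms by (simp add: test_function_def algebra_simps)

lemma test_function_bounded:
  assumes "test_function g"
  obtains B where "B > 0" "\<And>x. \<bar>g x\<bar> \<le> B"
proof -
  obtain r where r: "r > 0" "\<And>x. \<bar>x\<bar> \<ge> r \<Longrightarrow> g x = 0" using test_function_support[OF assms] by blast
  obtain B where "\<And>x. \<bar>x\<bar> \<le> r \<Longrightarrow> \<bar>g x\<bar> \<le> B"
    using continuous_bounded_on_interval[of g r] assms smooth_continuous_on by (auto simp: test_function_def)
  hence "\<bar>g x\<bar> \<le> \<bar>B\<bar> + 1" for x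
    using r(2)[of x] by (cases "\<bar>x\<bar> \<le> r") force+
  thus ?thesis by (intro that[of "\<bar>B\<bar> + 1"]) auto
qed

lemma integrable_continuous_compact_support:
  fixes g :: "real \<Rightarrow> real"
  assumes "continuous_on UNIV g" "\<And>x. \<bar>x\<bar> > r \<Longrightarrow> g x = 0"
  shows "integrable lborel g"
proof -
  have "integrable lborel (\<lambda>x. indicator {-r..r} x *\<^sub>R g x)"
    using assms(1) continuous_on_subset by (intro borel_integrable_compact) auto
  moreover have "(\<lambda>x. indicator {-r..r} x *\<^sub>R g x) = g"
  proof
    fix x show "indicator {-r..r} x *\<^sub>R g x = g x"
      using assms(2)[of x] by (cases "x \<in> {-r..r}") force+
  qed
  ultimately show ?thesis by simp
qed

lemma test_function_continuous: "test_function g \<Longrightarrow> continuous_on A g"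
  by (simp add: test_function_def smooth_continuous_on)

lemma test_function_integrable: "test_function g \<Longrightarrow> integrable lborel g"
  by (metis integrable_continuous_compact_support less_imp_le test_function_continuous test_function_support)

text \<open>Rescaling one bump function gives approximate identities of every width; the powers of the width
  in the bounds are those forced by scaling.\<close>
definition mollifiers :: "(real \<Rightarrow> real \<Rightarrow> real) \<Rightarrow> real \<Rightarrow> real \<Rightarrow> bool" where
  "mollifiers k A B \<longleftrightarrow> A > 0 \<and> B > 0 \<and> (\<forall>\<delta>>0. test_function (k \<delta>) \<and> (\<forall>x. k \<delta> x \<ge> 0) \<and>
     (\<forall>x. \<bar>x\<bar> > \<delta> \<longrightarrow> k \<delta> x = 0) \<and> (\<integral>x. k \<delta> x \<partial>lborel) = 1 \<and>
     (\<integral>x. \<bar>deriv (k \<delta>) x\<bar> \<partial>lborel) \<le> A / \<delta> \<and> (\<integral>x. (k \<delta> x)\<^sup>2 \<partial>lborel) \<le> B / \<delta>)"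

lemma mollifiers_exist: "\<exists>k A B. mollifiers k A B"
proof -
  have tb: "test_function bump" by (rule test_functionI[of _ 1]) (auto simp: smooth_bump bump_eq_0)
  define I where "I = (\<integral>x. bump x \<partial>lborel)"
  have "I > 0"
  proof -
    have "I \<noteq> 0"
    proof
      assume "I = 0"
      hence "AE x in lborel. bump x = 0"
        unfolding I_def
        by (subst (asm) integral_nonneg_eq_0_iff_AE) (auto simp: test_function_integrable[OF tb] bump_nonneg)
      hence "AE x in lborel. x \<notin> {-1<..<1::real}"
        by eventually_elim (metis abs_less_iff bump_pos greaterThanLessThan_iff less_irrefl minus_less_iff)
      hence "emeasure lborel {-1<..<1::real} = 0"
        by (subst (asm) AE_iff_measurable[OF _ refl])
            (auto simp: greaterThanLessThan_def greaterThan_def lessThan_def Int_def)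
      moreover have "emeasure lborel {-1<..<1::real} = 2" by simp
      ultimately show False by simp
    qed
    moreover have "I \<ge> 0" unfolding I_def by (simp add: bump_nonneg)
    ultimately show ?thesis by simp
  qed
  define k where "k \<delta> x = 1 / (\<delta> * I) * bump (1 / \<delta> * x + 0)" for \<delta> x
  define A where "A = (\<integral>x. \<bar>deriv bump x\<bar> \<partial>lborel) / I + 1"
  define B where "B = (\<integral>x. (bump x)\<^sup>2 \<partial>lborel) / I\<^sup>2 + 1"
  have scale: "(\<integral>x. g x \<partial>lborel) = \<delta> * (\<integral>x. g (\<delta> * x) \<partial>lborel)" if "\<delta> > 0" for \<delta> and g :: "real \<Rightarrow> real"
    using lborel_integral_real_affine[of \<delta> g 0] that by simp
  have "A > 0" "B > 0" unfolding A_def B_def using \<open>I > 0\<close> by (auto intro!: add_nonneg_pos)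
  moreover have "test_function (k \<delta>) \<and> (\<forall>x. k \<delta> x \<ge> 0) \<and>
     (\<forall>x. \<bar>x\<bar> > \<delta> \<longrightarrow> k \<delta> x = 0) \<and> (\<integral>x. k \<delta> x \<partial>lborel) = 1 \<and>
     (\<integral>x. \<bar>deriv (k \<delta>) x\<bar> \<partial>lborel) \<le> A / \<delta> \<and> (\<integral>x. (k \<delta> x)\<^sup>2 \<partial>lborel) \<le> B / \<delta>" if "\<delta> > 0" for \<delta>
  proof (intro conjI allI impI)
    show z: "k \<delta> x = 0" if "\<bar>x\<bar> > \<delta>" for x
      using that \<open>\<delta> > 0\<close> unfolding k_def by (subst bump_eq_0) auto
    show "test_function (k \<delta>)"
      unfolding k_def[abs_def]
      by (rule test_functionI[of _ \<delta>, OF smooth_affine(1)[OF smooth_bump]]) (use z in \<open>simp add: k_def\<close>)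
    show "k \<delta> x \<ge> 0" for x unfolding k_def using \<open>\<delta> > 0\<close> \<open>I > 0\<close> by (simp add: bump_nonneg)
    show "(\<integral>x. k \<delta> x \<partial>lborel) = 1"
      using \<open>\<delta> > 0\<close> \<open>I > 0\<close> by (subst scale[OF that]) (simp add: k_def flip: I_def)
    have dk: "deriv (k \<delta>) = (\<lambda>x. 1 / (\<delta> * I) * (1 / \<delta>) * deriv bump (1 / \<delta> * x + 0))"
      using smooth_affine(2)[OF smooth_bump, of 1 "1 / (\<delta> * I)" "1 / \<delta>" 0] unfolding k_def[abs_def] by simp
    show "(\<integral>x. \<bar>deriv (k \<delta>) x\<bar> \<partial>lborel) \<le> A / \<delta>"
      using \<open>\<delta> > 0\<close> \<open>I > 0\<close> unfolding dk
      by (subst scale[OF that]) (simp add: abs_mult A_def field_simps)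
    show "(\<integral>x. (k \<delta> x)\<^sup>2 \<partial>lborel) \<le> B / \<delta>"
      using \<open>\<delta> > 0\<close> \<open>I > 0\<close> unfolding k_def
      by (subst scale[OF that]) (simp add: power_mult_distrib power_divide B_def field_simps power2_eq_square)
  qed
  ultimately have "mollifiers k A B" unfolding mollifiers_def by blast
  thus ?thesis by blast
qed

section \<open>Square-integrable functions\<close>

definition sqnorm :: "(real \<Rightarrow> real) \<Rightarrow> real" where
  "sqnorm g = (\<integral>x. (g x)\<^sup>2 \<partial>lborel)"

lemma sqnorm_nonneg [simp]: "sqnorm g \<ge> 0"
  by (simp add: sqnorm_def)

lemma L2D: "g \<in> L2 \<Longrightarrow> g \<in> borel_measurable borel" "g \<in> L2 \<Longrightarrow> integrable lborel (\<lambda>x. (g x)\<^sup>2)"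
  by (auto simp: L2_def)

lemma L2_dominated:
  assumes "g \<in> borel_measurable borel" "integrable lborel w" "AE x in lborel. (g x)\<^sup>2 \<le> w x"
  shows "g \<in> L2" "sqnorm g \<le> (\<integral>x. w x \<partial>lborel)"
proof -
  have [measurable]: "g \<in> borel_measurable borel" by fact
  have i: "integrable lborel (\<lambda>x. (g x)\<^sup>2)"
    by (rule Bochner_Integration.integrable_bound[OF assms(2)]) (use assms(3) in \<open>auto elim!: eventually_mono\<close>)
  show "g \<in> L2" using i by (simp add: L2_def)
  show "sqnorm g \<le> (\<integral>x. w x \<partial>lborel)"
    unfolding sqnorm_def by (rule integral_mono_AE[OF i assms(2,3)])
qed

lemma L2_cmult_bound:
  assumes "h \<in> borel_measurable borel" "g \<in> L2" "AE x in lborel. \<bar>h x\<bar> \<le> c * \<bar>g x\<bar>"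
  shows "h \<in> L2" "sqnorm h \<le> c\<^sup>2 * sqnorm g"
proof -
  have i: "integrable lborel (\<lambda>x. c\<^sup>2 * (g x)\<^sup>2)" using L2D(2)[OF assms(2)] by simp
  have le: "AE x in lborel. (h x)\<^sup>2 \<le> c\<^sup>2 * (g x)\<^sup>2"
    using assms(3)
  proof eventually_elim
    case (elim x)
    have "\<bar>h x\<bar>\<^sup>2 \<le> (c * \<bar>g x\<bar>)\<^sup>2" by (rule power_mono[OF elim]) simp
    thus ?case by (simp add: power_mult_distrib)
  qed
  show "h \<in> L2" by (rule L2_dominated(1)[OF assms(1) i le])
  show "sqnorm h \<le> c\<^sup>2 * sqnorm g"
    using L2_dominated(2)[OF assms(1) i le] by (simp add: sqnorm_def)
qed

lemma L2_integrable_mult: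
  assumes "g \<in> L2" "h \<in> L2"
  shows "integrable lborel (\<lambda>x. g x * h x)"
proof (rule Bochner_Integration.integrable_bound)
  show "integrable lborel (\<lambda>x. (g x)\<^sup>2 + (h x)\<^sup>2)" using assms[THEN L2D(2)] by simp
  have [measurable]: "g \<in> borel_measurable borel" "h \<in> borel_measurable borel" using assms[THEN L2D(1)] .
  show "(\<lambda>x. g x * h x) \<in> borel_measurable lborel" by simp
  have "\<bar>a * b\<bar> \<le> a\<^sup>2 + b\<^sup>2" for a b :: real
  proof -
    have "2 * (\<bar>a\<bar> * \<bar>b\<bar>) \<le> a\<^sup>2 + b\<^sup>2" "0 \<le> \<bar>a\<bar> * \<bar>b\<bar>"
      using sum_squares_bound[of "\<bar>a\<bar>" "\<bar>b\<bar>"] by auto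
    thus ?thesis unfolding abs_mult by linarith
  qed
  thus "AE x in lborel. norm (g x * h x) \<le> norm ((g x)\<^sup>2 + (h x)\<^sup>2)" by auto
qed

lemma integrable_indicator_Icc: "integrable lborel (indicator {a..b::real} :: real \<Rightarrow> real)"
  by (rule integrable_real_indicator) (simp_all add: emeasure_lborel_Icc_eq)

lemma indicator_Icc_L2: "indicator {a..b::real} \<in> L2"
  using integrable_indicator_Icc[of a b]
  by (auto simp: L2_def power2_eq_square simp flip: indicator_inter_arith)

lemma L2_abs: "g \<in> L2 \<Longrightarrow> (\<lambda>x. \<bar>g x\<bar>) \<in> L2"
  by (auto simp: L2_def)

lemma L2_cmult: "g \<in> L2 \<Longrightarrow> (\<lambda>x. c * g x) \<in> L2"
  by (auto simp: L2_def power_mult_distrib)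

lemma L2_add:
  assumes "g \<in> L2" "h \<in> L2" shows "(\<lambda>x. g x + h x) \<in> L2"
proof -
  have "integrable lborel (\<lambda>x. (g x)\<^sup>2 + (h x)\<^sup>2 + 2 * (g x * h x))"
    using assms[THEN L2D(2)] L2_integrable_mult[OF assms] by simp
  moreover have [measurable]: "g \<in> borel_measurable borel" "h \<in> borel_measurable borel"
    using assms[THEN L2D(1)] .
  ultimately show ?thesis by (simp add: L2_def power2_sum algebra_simps)
qed

lemma L2_diff: "g \<in> L2 \<Longrightarrow> h \<in> L2 \<Longrightarrow> (\<lambda>x. g x - h x) \<in> L2"
  using L2_add[of g "\<lambda>x. (-1) * h x"] L2_cmult[of h "-1"] by simp

text \<open>The quadratic form \<open>(a, b) \<mapsto> \<integral> (a g - b h)\<^sup>2\<close> is nonnegative, so its discriminant is not positive.\<close>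
lemma Cauchy_Schwarz_sq:
  assumes "g \<in> L2" "h \<in> L2"
  shows "(\<integral>x. g x * h x \<partial>lborel)\<^sup>2 \<le> sqnorm g * sqnorm h"
proof -
  define X where "X = (\<integral>x. g x * h x \<partial>lborel)"
  have q: "0 \<le> a\<^sup>2 * sqnorm g - 2 * a * b * X + b\<^sup>2 * sqnorm h" for a b
  proof -
    have "0 \<le> (\<integral>x. (a * g x - b * h x)\<^sup>2 \<partial>lborel)" by simp
    also have "\<dots> = (\<integral>x. (a\<^sup>2 * (g x)\<^sup>2 - 2 * a * b * (g x * h x)) + b\<^sup>2 * (h x)\<^sup>2 \<partial>lborel)"
      by (intro Bochner_Integration.integral_cong) (auto simp: power2_eq_square algebra_simps)
    also have "\<dots> = a\<^sup>2 * sqnorm g - 2 * a * b * X + b\<^sup>2 * sqnorm h"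
      unfolding sqnorm_def X_def
      using assms[THEN L2D(2)] L2_integrable_mult[OF assms] by simp
    finally show ?thesis .
  qed
  have "X\<^sup>2 \<le> sqnorm g * sqnorm h"
  proof (cases "sqnorm g = 0")
    case True
    have "X = 0"
    proof (rule ccontr)
      assume "X \<noteq> 0"
      thus False using q[of "(sqnorm h + 1) / (2 * X)" 1] True by simp
    qed
    thus ?thesis by simp
  next
    case False
    hence p: "sqnorm g > 0" using sqnorm_nonneg[of g] by linarith
    have "0 \<le> sqnorm g * (sqnorm g * sqnorm h - X\<^sup>2)"
      using q[of X "sqnorm g"] by (simp add: power2_eq_square algebra_simps)
    thus ?thesis using p by (simp add: zero_le_mult_iff)
  qed
  thus ?thesis by (simp add: X_def)
qed

lemma sqnorm_abs [simp]: "sqnorm (\<lambda>x. \<bar>g x\<bar>) = sqnorm g"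
  by (simp add: sqnorm_def)

lemma Cauchy_Schwarz:
  assumes "g \<in> L2" "h \<in> L2"
  shows "(\<integral>x. \<bar>g x * h x\<bar> \<partial>lborel) \<le> sqrt (sqnorm g) * sqrt (sqnorm h)"
    and "\<bar>\<integral>x. g x * h x \<partial>lborel\<bar> \<le> sqrt (sqnorm g) * sqrt (sqnorm h)"
proof -
  have "(\<integral>x. \<bar>g x\<bar> * \<bar>h x\<bar> \<partial>lborel)\<^sup>2 \<le> sqnorm g * sqnorm h"
    using Cauchy_Schwarz_sq[OF assms[THEN L2_abs]] by simp
  thus *: "(\<integral>x. \<bar>g x * h x\<bar> \<partial>lborel) \<le> sqrt (sqnorm g) * sqrt (sqnorm h)"
    by (simp add: real_le_rsqrt abs_mult flip: real_sqrt_mult)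
  have "\<bar>\<integral>x. g x * h x \<partial>lborel\<bar> \<le> (\<integral>x. \<bar>g x * h x\<bar> \<partial>lborel)"
    by (rule integral_abs_bound)
  thus "\<bar>\<integral>x. g x * h x \<partial>lborel\<bar> \<le> sqrt (sqnorm g) * sqrt (sqnorm h)"
    using * by linarith
qed

lemma sqnorm_add_le:
  assumes "g \<in> L2" "h \<in> L2"
  shows "sqrt (sqnorm (\<lambda>x. g x + h x)) \<le> sqrt (sqnorm g) + sqrt (sqnorm h)"
proof (rule real_le_lsqrt)
  have "sqnorm (\<lambda>x. g x + h x) = (\<integral>x. ((g x)\<^sup>2 + (h x)\<^sup>2) + 2 * (g x * h x) \<partial>lborel)"
    unfolding sqnorm_def by (intro Bochner_Integration.integral_cong) (auto simp: power2_sum)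
  also have "\<dots> = sqnorm g + sqnorm h + 2 * (\<integral>x. g x * h x \<partial>lborel)"
    using assms[THEN L2D(2)] L2_integrable_mult[OF assms] by (simp add: sqnorm_def)
  also have "\<dots> \<le> sqnorm g + sqnorm h + 2 * (sqrt (sqnorm g) * sqrt (sqnorm h))"
    using Cauchy_Schwarz(2)[OF assms] by linarith
  also have "\<dots> = (sqrt (sqnorm g) + sqrt (sqnorm h))\<^sup>2"
    by (simp add: power2_sum)
  finally show "sqnorm (\<lambda>x. g x + h x) \<le> (sqrt (sqnorm g) + sqrt (sqnorm h))\<^sup>2" .
qed auto

lemma sqnorm_diff_commute: "sqnorm (\<lambda>x. g x - h x) = sqnorm (\<lambda>x. h x - g x)"
  by (simp add: sqnorm_def power2_commute)

lemma sqrt_sqnorm_diff: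
  assumes "g \<in> L2" "h \<in> L2"
  shows "\<bar>sqrt (sqnorm g) - sqrt (sqnorm h)\<bar> \<le> sqrt (sqnorm (\<lambda>x. g x - h x))"
  using sqnorm_add_le[OF L2_diff[OF assms] assms(2)]
    sqnorm_add_le[OF L2_diff[OF assms(2,1)] assms(1)] sqnorm_diff_commute[of g h]
  by simp

lemma tendsto_sqnorm:
  assumes "\<forall>\<^sub>F i in F. g i \<in> L2" "h \<in> L2" "((\<lambda>i. sqnorm (\<lambda>x. g i x - h x)) \<longlongrightarrow> 0) F"
  shows "((\<lambda>i. sqnorm (g i)) \<longlongrightarrow> sqnorm h) F"
proof -
  have "((\<lambda>i. sqrt (sqnorm (\<lambda>x. g i x - h x))) \<longlongrightarrow> 0) F"
    using tendsto_real_sqrt[OF assms(3)] by simp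
  hence "((\<lambda>i. sqrt (sqnorm (g i)) - sqrt (sqnorm h)) \<longlongrightarrow> 0) F"
    by (rule Lim_null_comparison[rotated])
       (use assms(1) in eventually_elim, use assms(2) sqrt_sqnorm_diff in auto)
  hence "((\<lambda>i. sqrt (sqnorm (g i))) \<longlongrightarrow> sqrt (sqnorm h)) F"
    by (simp add: LIM_zero_iff)
  hence "((\<lambda>i. (sqrt (sqnorm (g i)))\<^sup>2) \<longlongrightarrow> (sqrt (sqnorm h))\<^sup>2) F"
    by (rule tendsto_power)
  thus ?thesis by simp
qed

lemma integral_reflect_shift:
  fixes g :: "real \<Rightarrow> real"
  shows "(\<integral>y. g (x - y) \<partial>lborel) = (\<integral>y. g y \<partial>lborel)"
    and "integrable lborel (\<lambda>y. g (x - y)) \<longleftrightarrow> integrable lborel g"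
    and "(\<integral>y. g (y - x) \<partial>lborel) = (\<integral>y. g y \<partial>lborel)"
    and "integrable lborel (\<lambda>y. g (y - x)) \<longleftrightarrow> integrable lborel g"
  using lborel_integral_real_affine[of "-1" g x] lborel_integrable_real_affine_iff[of "-1" g x]
    lborel_integral_real_affine[of 1 g "-x"] lborel_integrable_real_affine_iff[of 1 g "-x"]
  by auto

text \<open>Multiplication by a function bounded by \<open>1\<close> is a contraction of \<open>L\<^sup>2\<close>, so this reduces to the
  convergence of unweighted norms.\<close>
lemma tendsto_weighted_sqnorm:
  assumes g: "\<forall>\<^sub>F i in F. g i \<in> L2" and h: "h \<in> L2" and lim: "((\<lambda>i. sqnorm (\<lambda>x. g i x - h x)) \<longlongrightarrow> 0) F"
    and \<psi>: "continuous_on UNIV \<psi>" "\<And>x. \<bar>\<psi> x\<bar> \<le> 1"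
  shows "((\<lambda>i. \<integral>x. (\<psi> x)\<^sup>2 * (g i x)\<^sup>2 \<partial>lborel) \<longlongrightarrow> (\<integral>x. (\<psi> x)\<^sup>2 * (h x)\<^sup>2 \<partial>lborel)) F"
proof -
  have [measurable]: "\<psi> \<in> borel_measurable borel" using \<psi>(1) by (rule borel_measurable_continuous_onI)
  have w: "(\<lambda>x. \<psi> x * z x) \<in> L2" "sqnorm (\<lambda>x. \<psi> x * z x) \<le> sqnorm z" if z: "z \<in> L2" for z
  proof -
    have [measurable]: "z \<in> borel_measurable borel" using L2D(1)[OF z] .
    have "\<bar>\<psi> x * z x\<bar> \<le> 1 * \<bar>z x\<bar>" for x unfolding abs_mult by (rule mult_right_mono[OF \<psi>(2)]) simp
    thus "(\<lambda>x. \<psi> x * z x) \<in> L2" "sqnorm (\<lambda>x. \<psi> x * z x) \<le> sqnorm z"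
      using L2_cmult_bound[OF _ z, of "\<lambda>x. \<psi> x * z x" 1] by auto
  qed
  have "((\<lambda>i. sqnorm (\<lambda>x. \<psi> x * g i x)) \<longlongrightarrow> sqnorm (\<lambda>x. \<psi> x * h x)) F"
  proof (rule tendsto_sqnorm)
    show "\<forall>\<^sub>F i in F. (\<lambda>x. \<psi> x * g i x) \<in> L2" using g by eventually_elim (rule w(1))
    show "(\<lambda>x. \<psi> x * h x) \<in> L2" by (rule w(1)[OF h])
    show "((\<lambda>i. sqnorm (\<lambda>x. \<psi> x * g i x - \<psi> x * h x)) \<longlongrightarrow> 0) F"
    proof (rule Lim_null_comparison[OF _ lim])
      show "\<forall>\<^sub>F i in F. norm (sqnorm (\<lambda>x. \<psi> x * g i x - \<psi> x * h x)) \<le> sqnorm (\<lambda>x. g i x - h x)"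
        using g
      proof eventually_elim
        case (elim i)
        show ?case using w(2)[OF L2_diff[OF elim h]] by (simp add: right_diff_distrib)
      qed
    qed
  qed
  thus ?thesis by (simp add: sqnorm_def power_mult_distrib)
qed

section \<open>Convolution with test functions\<close>

definition conv :: "(real \<Rightarrow> real) \<Rightarrow> (real \<Rightarrow> real) \<Rightarrow> real \<Rightarrow> real" where
  "conv g \<kappa> x = (\<integral>y. g y * \<kappa> (x - y) \<partial>lborel)"

lemma conv_integral:
  assumes "integrable lborel h" "integrable lborel K"
  shows "integrable lborel (conv h K)"
    and "(\<integral>x. conv h K x \<partial>lborel) = (\<integral>x. h x \<partial>lborel) * (\<integral>x. K x \<partial>lborel)"
proof -
  have [measurable]: "h \<in> borel_measurable borel" "K \<in> borel_measurable borel"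
    using assms[THEN borel_measurable_integrable] by simp_all
  have i: "integrable (lborel \<Otimes>\<^sub>M lborel) (\<lambda>(y, x). h y * K (x - y))"
  proof (rule lborel_pair.Fubini_integrable)
    show "(\<lambda>(y, x). h y * K (x - y)) \<in> borel_measurable (lborel \<Otimes>\<^sub>M lborel)"
      by (simp add: split_beta)
    have "(\<integral>x. norm (h y * K (x - y)) \<partial>lborel) = \<bar>h y\<bar> * (\<integral>x. \<bar>K x\<bar> \<partial>lborel)" for y
      using integral_reflect_shift(3)[of "\<lambda>x. \<bar>K x\<bar>" y] by (simp add: abs_mult)
    thus "integrable lborel (\<lambda>y. \<integral>x. norm (case (y, x) of (y, x) \<Rightarrow> h y * K (x - y)) \<partial>lborel)"
      using assms(1) by simp
    show "AE y in lborel. integrable lborel (\<lambda>x. case (y, x) of (y, x) \<Rightarrow> h y * K (x - y))"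
      using integral_reflect_shift(4)[of K] assms(2) by simp
  qed
  show "integrable lborel (conv h K)"
    using lborel_pair.integrable_snd[OF i] by (simp add: conv_def[abs_def])
  have "(\<integral>x. conv h K x \<partial>lborel) = (\<integral>y. \<integral>x. h y * K (x - y) \<partial>lborel \<partial>lborel)"
    using lborel_pair.Fubini_integral[OF i] by (simp add: conv_def)
  thus "(\<integral>x. conv h K x \<partial>lborel) = (\<integral>x. h x \<partial>lborel) * (\<integral>x. K x \<partial>lborel)"
    by (simp add: integral_reflect_shift)
qed

lemma test_function_L2: "test_function \<kappa> \<Longrightarrow> \<kappa> \<in> L2"
proof -
  assume t: "test_function \<kappa>"
  obtain r where r: "r > 0" "\<And>x. \<bar>x\<bar> \<ge> r \<Longrightarrow> \<kappa> x = 0" using test_function_support[OF t] by blast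
  have "integrable lborel (\<lambda>x. (\<kappa> x)\<^sup>2)"
    by (rule integrable_continuous_compact_support[of _ r])
       (intro continuous_on_power test_function_continuous t, use r in auto)
  thus ?thesis
    using test_function_continuous[OF t, of UNIV] by (simp add: L2_def borel_measurable_continuous_onI)
qed

lemma reflect_L2: "\<kappa> \<in> L2 \<Longrightarrow> (\<lambda>y. \<kappa> (x - y)) \<in> L2"
  and sqnorm_reflect: "sqnorm (\<lambda>y. \<kappa> (x - y)) = sqnorm \<kappa>"
  using integral_reflect_shift[of "\<lambda>x. (\<kappa> x)\<^sup>2" x] by (auto simp: L2_def sqnorm_def)

lemma conv_integrable:
  assumes "g \<in> L2" "test_function \<kappa>"
  shows "integrable lborel (\<lambda>y. g y * \<kappa> (x - y))"
  using L2_integrable_mult[OF assms(1) reflect_L2[OF test_function_L2[OF assms(2)]]] .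

lemma conv_bound:
  assumes "g \<in> L2" "test_function \<kappa>"
  shows "\<bar>conv g \<kappa> x\<bar> \<le> sqrt (sqnorm g) * sqrt (sqnorm \<kappa>)"
  using Cauchy_Schwarz(2)[OF assms(1) reflect_L2[OF test_function_L2[OF assms(2)]], of x]
  by (simp add: conv_def sqnorm_reflect)

lemma conv_diff:
  assumes "g \<in> L2" "h \<in> L2" "test_function \<kappa>"
  shows "conv (\<lambda>x. g x - h x) \<kappa> x = conv g \<kappa> x - conv h \<kappa> x"
  using conv_integrable[OF assms(1,3)] conv_integrable[OF assms(2,3)]
  by (simp add: conv_def left_diff_distrib)

text \<open>Differentiability of convolutions is obtained from this criterion because a quadratic error, unlike a
  limit, can be integrated against a square-integrable function without further argument.\<close>
lemma quadratic_error_imp_DERIV: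
  fixes F :: "real \<Rightarrow> real"
  assumes "\<And>s. \<bar>s\<bar> \<le> 1 \<Longrightarrow> \<bar>F (x + s) - F x - s * D\<bar> \<le> C * s\<^sup>2"
  shows "(F has_real_derivative D) (at x)"
proof -
  have "((\<lambda>s. (F (x + s) - F x) / s - D) \<longlongrightarrow> 0) (at 0)"
  proof (rule Lim_null_comparison)
    show "((\<lambda>s::real. \<bar>C\<bar> * \<bar>s\<bar>) \<longlongrightarrow> 0) (at 0)"
      by (auto intro!: tendsto_eq_intros)
    show "\<forall>\<^sub>F s in at 0. norm ((F (x + s) - F x) / s - D) \<le> \<bar>C\<bar> * \<bar>s\<bar>"
      unfolding eventually_at
    proof (intro exI[of _ 1] conjI ballI impI)
      fix s :: real assume s: "s \<noteq> 0 \<and> dist s 0 < 1"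
      have "\<bar>(F (x + s) - F x) / s - D\<bar> = \<bar>F (x + s) - F x - s * D\<bar> / \<bar>s\<bar>"
        using s by (simp add: field_simps flip: abs_divide)
      also have "\<dots> \<le> C * s\<^sup>2 / \<bar>s\<bar>" using assms[of s] s by (intro divide_right_mono) auto
      also have "\<dots> = C * \<bar>s\<bar>" using s by (simp add: power2_eq_square field_simps abs_if)
      also have "\<dots> \<le> \<bar>C\<bar> * \<bar>s\<bar>" by (intro mult_right_mono) auto
      finally show "norm ((F (x + s) - F x) / s - D) \<le> \<bar>C\<bar> * \<bar>s\<bar>" by simp
    qed simp
  qed
  hence "((\<lambda>s. (F (x + s) - F x) / s) \<longlongrightarrow> D) (at 0)" by (simp add: LIM_zero_iff)
  thus ?thesis by (simp add: DERIV_def)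
qed

lemma Lipschitz_on_interval:
  fixes f :: "real \<Rightarrow> real"
  assumes f: "\<And>s. (f has_real_derivative f' s) (at s)" and K: "\<And>s. \<bar>s\<bar> \<le> M \<Longrightarrow> \<bar>f' s\<bar> \<le> K"
    and "\<bar>x\<bar> \<le> M" "\<bar>y\<bar> \<le> M"
  shows "\<bar>f x - f y\<bar> \<le> K * \<bar>x - y\<bar>"
proof -
  have "norm (f x - f y) \<le> K * norm (x - y)"
  proof (rule field_differentiable_bound[where S="{-M..M}"])
    show "(f has_field_derivative f' z) (at z within {-M..M})" for z by (rule DERIV_subset[OF f]) simp
  qed (use assms in auto)
  thus ?thesis by simp
qed

text \<open>The constant is \<open>B\<close> instead of \<open>B / 2\<close>: two applications of the mean value theorem suffice.\<close>
lemma taylor2_bound: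
  fixes \<phi> :: "real \<Rightarrow> real"
  assumes "\<And>z. (\<phi> has_real_derivative \<phi>' z) (at z)" "\<And>z. (\<phi>' has_real_derivative \<phi>'' z) (at z)"
    and B: "\<And>z. z \<in> closed_segment a b \<Longrightarrow> \<bar>\<phi>'' z\<bar> \<le> B"
  shows "\<bar>\<phi> b - \<phi> a - (b - a) * \<phi>' a\<bar> \<le> B * (b - a)\<^sup>2"
proof (cases "a = b")
  case False
  have mvt: "\<exists>z\<in>closed_segment a c. \<psi> c - \<psi> a = (c - a) * \<psi>' z"
    if "\<And>z. (\<psi> has_real_derivative \<psi>' z) (at z)" "a \<noteq> c" for \<psi> \<psi>' :: "real \<Rightarrow> real" and c
  proof (cases "a < c")
    case True
    thus ?thesis using MVT2[of a c \<psi> \<psi>'] that(1) by (force simp: closed_segment_eq_real_ivl)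
  next
    case False
    hence "c < a" using that(2) by simp
    hence "\<exists>z>c. z < a \<and> \<psi> a - \<psi> c = (a - c) * \<psi>' z"
      by (rule MVT2) (rule that(1))
    then obtain z where "c < z" "z < a" "\<psi> a - \<psi> c = (a - c) * \<psi>' z" by auto
    thus ?thesis by (intro bexI[of _ z]) (auto simp: closed_segment_eq_real_ivl algebra_simps)
  qed
  obtain z where z: "z \<in> closed_segment a b" "\<phi> b - \<phi> a = (b - a) * \<phi>' z"
    using mvt[OF assms(1) False] by blast
  have "\<bar>\<phi>' z - \<phi>' a\<bar> \<le> B * \<bar>b - a\<bar>"
  proof (cases "a = z")
    case True
    have "B \<ge> 0" using B[of a] by auto
    thus ?thesis using True by simp
  next
    case False
    obtain y where y: "y \<in> closed_segment a z" "\<phi>' z - \<phi>' a = (z - a) * \<phi>'' y"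
      using mvt[OF assms(2) False] by blast
    have "\<bar>\<phi>'' y\<bar> \<le> B" using B y(1) z(1) subset_closed_segment by blast
    moreover have "\<bar>z - a\<bar> \<le> \<bar>b - a\<bar>" using z(1) by (auto simp: closed_segment_eq_real_ivl split: if_splits)
    ultimately show ?thesis
      unfolding y(2) abs_mult by (subst mult.commute) (intro mult_mono, auto)
  qed
  moreover have "\<phi> b - \<phi> a - (b - a) * \<phi>' a = (b - a) * (\<phi>' z - \<phi>' a)"
    using z(2) by (simp add: algebra_simps)
  ultimately have "\<bar>\<phi> b - \<phi> a - (b - a) * \<phi>' a\<bar> \<le> \<bar>b - a\<bar> * (B * \<bar>b - a\<bar>)"
    by (simp add: abs_mult mult_left_mono)
  thus ?thesis by (simp add: power2_eq_square algebra_simps)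
qed simp

text \<open>The kernel has a uniform second-order Taylor bound and compact support. For increments of size at most
  \<open>1\<close> its Taylor remainder is therefore dominated by a quadratic times the indicator of a fixed interval.\<close>
lemma DERIV_conv:
  assumes g: "g \<in> L2" and t: "test_function \<kappa>"
  shows "(conv g \<kappa> has_real_derivative conv g (deriv \<kappa>) x) (at x)"
proof -
  have t1: "test_function (deriv \<kappa>)" and t2: "test_function (deriv (deriv \<kappa>))"
    using t test_function_deriv by blast+
  obtain B where B: "B > 0" "\<And>x. \<bar>deriv (deriv \<kappa>) x\<bar> \<le> B" using test_function_bounded[OF t2] by blast
  obtain r where r: "r > 0" "\<And>x. \<bar>x\<bar> \<ge> r \<Longrightarrow> \<kappa> x = 0" using test_function_support[OF t] by blast
  obtain r' where r': "r' > 0" "\<And>x. \<bar>x\<bar> \<ge> r' \<Longrightarrow> deriv \<kappa> x = 0" using test_function_support[OF t1] by blast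
  define R where "R = r + r' + 1"
  define I where "I y = (indicator {x - R..x + R} y :: real)" for y
  have I: "I \<in> L2" unfolding I_def[abs_def] by (rule indicator_Icc_L2)
  have [measurable]: "g \<in> borel_measurable borel" using L2D[OF g] by simp
  have pw: "\<bar>\<kappa> (x + s - y) - \<kappa> (x - y) - s * deriv \<kappa> (x - y)\<bar> \<le> B * s\<^sup>2 * I y" if s: "\<bar>s\<bar> \<le> 1" for s y
  proof (cases "y \<in> {x - R..x + R}")
    case True
    have D: "(\<kappa> has_real_derivative deriv \<kappa> z) (at z)"
        "(deriv \<kappa> has_real_derivative deriv (deriv \<kappa>) z) (at z)" for z
      using t t1 by (auto simp: test_function_def intro: smooth_imp_DERIV)
    have "\<bar>\<kappa> (x + s - y) - \<kappa> (x - y) - (x + s - y - (x - y)) * deriv \<kappa> (x - y)\<bar> \<le> B * (x + s - y - (x - y))\<^sup>2"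
      by (rule taylor2_bound[OF D]) (rule B)
    thus ?thesis using True by (simp add: I_def)
  next
    case False
    hence "\<bar>x + s - y\<bar> \<ge> r" "\<bar>x - y\<bar> \<ge> r" "\<bar>x - y\<bar> \<ge> r'" using s r(1) r'(1) unfolding R_def by auto
    thus ?thesis using r r' B by (simp add: I_def)
  qed
  define C where "C = B * (\<integral>y. \<bar>g y\<bar> * I y \<partial>lborel)"
  show ?thesis
  proof (rule quadratic_error_imp_DERIV)
    fix s :: real assume s: "\<bar>s\<bar> \<le> 1"
    note ii = conv_integrable[OF g t, of "x + s"] conv_integrable[OF g t, of x] conv_integrable[OF g t1, of x]
    have "conv g \<kappa> (x + s) - conv g \<kappa> x - s * conv g (deriv \<kappa>) x
        = (\<integral>y. g y * (\<kappa> (x + s - y) - \<kappa> (x - y) - s * deriv \<kappa> (x - y)) \<partial>lborel)"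
      unfolding conv_def using ii by (simp add: right_diff_distrib mult.left_commute)
    also have "\<bar>\<dots>\<bar> \<le> (\<integral>y. B * s\<^sup>2 * (\<bar>g y\<bar> * I y) \<partial>lborel)"
    proof (rule integral_abs_bound[THEN order_trans], rule integral_mono)
      show "integrable lborel (\<lambda>y. B * s\<^sup>2 * (\<bar>g y\<bar> * I y))"
        using L2_integrable_mult[OF L2_abs[OF g] I] by simp
      show "integrable lborel (\<lambda>y. \<bar>g y * (\<kappa> (x + s - y) - \<kappa> (x - y) - s * deriv \<kappa> (x - y))\<bar>)"
        using ii by (intro integrable_abs) (simp add: right_diff_distrib mult.left_commute)
      show "\<bar>g y * (\<kappa> (x + s - y) - \<kappa> (x - y) - s * deriv \<kappa> (x - y))\<bar> \<le> B * s\<^sup>2 * (\<bar>g y\<bar> * I y)" for y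
        using mult_left_mono[OF pw[OF s, of y], of "\<bar>g y\<bar>"] unfolding abs_mult by (simp add: mult_ac)
    qed
    also have "\<dots> = C * s\<^sup>2" by (simp add: C_def)
    finally show "\<bar>conv g \<kappa> (x + s) - conv g \<kappa> x - s * conv g (deriv \<kappa>) x\<bar> \<le> C * s\<^sup>2" .
  qed
qed

lemma conv_continuous: "g \<in> L2 \<Longrightarrow> test_function \<kappa> \<Longrightarrow> continuous_on A (conv g \<kappa>)"
  by (rule DERIV_continuous_on[where D="conv g (deriv \<kappa>)"]) (rule DERIV_subset[OF DERIV_conv], auto)

text \<open>Young's inequality, from the Cauchy--Schwarz inequality with respect to the weight
  \<open>\<bar>\<kappa> (x - y)\<bar>\<close>.\<close>
lemma conv_L2:
  assumes g: "g \<in> L2" and t: "test_function \<kappa>"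
  shows "conv g \<kappa> \<in> L2" "sqnorm (conv g \<kappa>) \<le> (\<integral>x. \<bar>\<kappa> x\<bar> \<partial>lborel)\<^sup>2 * sqnorm g"
proof -
  have [measurable]: "g \<in> borel_measurable borel" "\<kappa> \<in> borel_measurable borel"
    using L2D[OF g] test_function_continuous[OF t] by (auto simp: borel_measurable_continuous_onI)
  have ik: "integrable lborel (\<lambda>x. \<bar>\<kappa> x\<bar>)" using test_function_integrable[OF t] by simp
  obtain B where B: "B > 0" "\<And>x. \<bar>\<kappa> x\<bar> \<le> B" using test_function_bounded[OF t] by blast
  define w where "w x = (\<integral>x. \<bar>\<kappa> x\<bar> \<partial>lborel) * conv (\<lambda>x. (g x)\<^sup>2) (\<lambda>x. \<bar>\<kappa> x\<bar>) x" for x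
  have w: "integrable lborel w" "(\<integral>x. w x \<partial>lborel) = (\<integral>x. \<bar>\<kappa> x\<bar> \<partial>lborel)\<^sup>2 * sqnorm g"
    unfolding w_def[abs_def] using conv_integral[OF L2D(2)[OF g] ik]
    by (auto simp: sqnorm_def power2_eq_square)
  have "(conv g \<kappa> x)\<^sup>2 \<le> w x" for x
  proof -
    have 1: "(\<lambda>y. \<bar>g y\<bar> * sqrt \<bar>\<kappa> (x - y)\<bar>) \<in> L2"
      by (rule L2_cmult_bound(1)[OF _ g, of _ "sqrt B"])
         (auto simp: abs_mult B(2) mult.commute[of "sqrt B"] intro!: mult_left_mono)
    have 2: "(\<lambda>y. sqrt \<bar>\<kappa> (x - y)\<bar>) \<in> L2"
      using ik integral_reflect_shift(2)[of "\<lambda>x. \<bar>\<kappa> x\<bar>" x] by (simp add: L2_def)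
    have s: "sqrt a * (sqrt a * b) = a * b" if "a \<ge> 0" for a b :: real
      using that by (simp flip: mult.assoc)
    have "\<bar>conv g \<kappa> x\<bar> \<le> (\<integral>y. \<bar>g y\<bar> * sqrt \<bar>\<kappa> (x - y)\<bar> * sqrt \<bar>\<kappa> (x - y)\<bar> \<partial>lborel)"
      unfolding conv_def by (rule order_trans[OF integral_abs_bound]) (simp add: abs_mult mult.assoc)
    hence "(conv g \<kappa> x)\<^sup>2 \<le> (\<integral>y. \<bar>g y\<bar> * sqrt \<bar>\<kappa> (x - y)\<bar> * sqrt \<bar>\<kappa> (x - y)\<bar> \<partial>lborel)\<^sup>2"
      by (metis abs_ge_zero power2_abs power_mono)
    also have "\<dots> \<le> sqnorm (\<lambda>y. \<bar>g y\<bar> * sqrt \<bar>\<kappa> (x - y)\<bar>) * sqnorm (\<lambda>y. sqrt \<bar>\<kappa> (x - y)\<bar>)"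
      by (rule Cauchy_Schwarz_sq[OF 1 2])
    also have "\<dots> = w x"
      using integral_reflect_shift(1)[of "\<lambda>x. \<bar>\<kappa> x\<bar>" x]
      by (simp add: w_def conv_def sqnorm_def power_mult_distrib)
    finally show ?thesis .
  qed
  hence le: "AE x in lborel. (conv g \<kappa> x)\<^sup>2 \<le> w x" by simp
  have m: "conv g \<kappa> \<in> borel_measurable borel"
    using conv_continuous[OF g t] by (simp add: borel_measurable_continuous_onI)
  show "conv g \<kappa> \<in> L2" by (rule L2_dominated(1)[OF m w(1) le])
  show "sqnorm (conv g \<kappa>) \<le> (\<integral>x. \<bar>\<kappa> x\<bar> \<partial>lborel)\<^sup>2 * sqnorm g"
    using L2_dominated(2)[OF m w(1) le] w(2) by simp
qed

section \<open>Approximate identities\<close>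

text \<open>Every Lebesgue measurable function is an almost everywhere limit of continuous functions. After the
  given function is truncated in height and in space, dominated convergence turns this into
  convergence in \<open>L\<^sup>2\<close>.\<close>
lemma L2_approx_continuous:
  assumes g: "g \<in> L2" and e: "e > 0"
  obtains c r where "continuous_on UNIV c" "\<And>x. \<bar>x\<bar> > r \<Longrightarrow> c x = 0" "r > 0" "sqnorm (\<lambda>x. g x - c x) < e"
proof -
  have [measurable]: "g \<in> borel_measurable borel" using L2D[OF g] by simp
  define t where "t m x = (if \<bar>x\<bar> \<le> real m then max (- real m) (min (real m) (g x)) else 0)" for m x
  have [measurable]: "t m \<in> borel_measurable borel" for m unfolding t_def by measurable
  have "(\<lambda>m. \<integral>x. (g x - t m x)\<^sup>2 \<partial>lborel) \<longlonglongrightarrow> (\<integral>x. 0 \<partial>(lborel :: real measure))"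
  proof (rule integral_dominated_convergence[where w="\<lambda>x. (g x)\<^sup>2"])
    show "AE x in lborel. (\<lambda>m. (g x - t m x)\<^sup>2) \<longlonglongrightarrow> 0"
    proof (rule AE_I2)
      fix x
      obtain N :: nat where N: "\<bar>x\<bar> + \<bar>g x\<bar> < N" using reals_Archimedean2 by blast
      have "\<forall>\<^sub>F m in sequentially. (g x - t m x)\<^sup>2 = 0"
        using eventually_ge_at_top[of N]
      proof eventually_elim
        case (elim m)
        hence "real N \<le> real m" by simp
        thus ?case using N unfolding t_def by (auto simp: min_def max_def)
      qed
      thus "(\<lambda>m. (g x - t m x)\<^sup>2) \<longlonglongrightarrow> 0" by (rule tendsto_eventually)
    qed
    fix m
    have "\<bar>g x - t m x\<bar> \<le> \<bar>g x\<bar>" for x unfolding t_def by (auto simp: min_def max_def)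
    thus "AE x in lborel. norm ((g x - t m x)\<^sup>2) \<le> (g x)\<^sup>2" by (auto simp: abs_le_square_iff)
  qed (use L2D[OF g] in auto)
  hence "(\<lambda>m. sqnorm (\<lambda>x. g x - t m x)) \<longlonglongrightarrow> 0" by (simp add: sqnorm_def)
  from order_tendstoD(2)[OF this, of "e / 4"] e
  obtain m where m: "sqnorm (\<lambda>x. g x - t m x) < e / 4"
    unfolding eventually_sequentially by auto
  have "t m \<in> borel_measurable lebesgue" by (intro measurable_completion) simp
  hence "t m measurable_on UNIV" by (rule lebesgue_measurable_imp_measurable_on_real) simp
  then obtain N u where N: "negligible N" and u: "\<And>n. continuous_on UNIV (u n)"
     and lim: "\<And>x. x \<notin> N \<Longrightarrow> (\<lambda>n. u n x) \<longlonglongrightarrow> t m x"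
    unfolding measurable_on_def by auto
  have aeN: "AE x in lborel. x \<notin> N"
    using N AE_not_in[of N lebesgue] by (simp add: negligible_iff_null_sets AE_completion_iff)
  \<comment> \<open>Truncating in height and in space keeps the approximants continuous and gives a common
     square-integrable bound.\<close>
  define c where "c n x = max (- real m) (min (real m) (u n x)) * max 0 (min 1 (real m + 1 - \<bar>x\<bar>))" for n x
  have cc: "continuous_on UNIV (c n)" for n unfolding c_def by (intro continuous_intros u)
  hence [measurable]: "c n \<in> borel_measurable borel" for n by (rule borel_measurable_continuous_onI)
  have "(\<lambda>n. \<integral>x. (t m x - c n x)\<^sup>2 \<partial>lborel) \<longlonglongrightarrow> (\<integral>x. 0 \<partial>(lborel :: real measure))"
  proof (rule integral_dominated_convergence[where w="\<lambda>x. (2 * real m)\<^sup>2 * indicator {-(real m + 1)..real m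
      + 1} x"])
    show "AE x in lborel. (\<lambda>n. (t m x - c n x)\<^sup>2) \<longlonglongrightarrow> 0"
      using aeN
    proof eventually_elim
      case (elim x)
      have "(\<lambda>n. c n x) \<longlonglongrightarrow> max (- real m) (min (real m) (t m x)) * max 0 (min 1 (real m + 1 - \<bar>x\<bar>))"
        unfolding c_def by (intro tendsto_intros lim elim)
      also have "max (- real m) (min (real m) (t m x)) * max 0 (min 1 (real m + 1 - \<bar>x\<bar>)) = t m x"
        unfolding t_def by (auto simp: min_def max_def)
      finally have "(\<lambda>n. (t m x - c n x)\<^sup>2) \<longlonglongrightarrow> (t m x - t m x)\<^sup>2" by (intro tendsto_intros)
      thus ?case by simp
    qed
    have i: "integrable lborel (indicator {-(real m + 1)..real m + 1} :: real \<Rightarrow> real)"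
      by (rule integrable_indicator_Icc)
    thus "integrable lborel (\<lambda>x. (2 * real m)\<^sup>2 * indicator {-(real m + 1)..real m + 1} x)"
      by (rule integrable_mult_right)
    fix n
    have "(t m x - c n x)\<^sup>2 \<le> (2 * real m)\<^sup>2 * indicator {-(real m + 1)..real m + 1} x" for x
    proof (cases "\<bar>x\<bar> \<le> real m + 1")
      case True
      have "\<bar>t m x\<bar> \<le> real m" unfolding t_def by (auto simp: min_def max_def)
      moreover have "\<bar>max (- real m) (min (real m) (u n x))\<bar> * \<bar>max 0 (min 1 (real m + 1 - \<bar>x\<bar>))\<bar> \<le> real m * 1"
        by (intro mult_mono) (auto simp: min_def max_def)
      hence "\<bar>c n x\<bar> \<le> real m" unfolding c_def abs_mult by simp
      ultimately have "\<bar>t m x - c n x\<bar> \<le> \<bar>2 * real m\<bar>" by linarith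
      moreover have "x \<in> {-(real m + 1)..real m + 1}" using True by auto
      ultimately show ?thesis unfolding abs_le_square_iff by simp
    next
      case False
      hence "t m x = 0" "c n x = 0" by (auto simp: t_def c_def)
      thus ?thesis by simp
    qed
    thus "AE x in lborel. norm ((t m x - c n x)\<^sup>2) \<le> (2 * real m)\<^sup>2 * indicator {-(real m + 1)..real m + 1} x"
      by simp
  qed auto
  hence "(\<lambda>n. sqnorm (\<lambda>x. t m x - c n x)) \<longlonglongrightarrow> 0" by (simp add: sqnorm_def)
  from order_tendstoD(2)[OF this, of "e / 4"] e
  obtain n where n: "sqnorm (\<lambda>x. t m x - c n x) < e / 4"
    unfolding eventually_sequentially by auto
  have tL: "t m \<in> L2"
    by (rule L2_cmult_bound(1)[OF _ g, of _ 1]) (auto simp: t_def min_def max_def)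
  have z: "c n x = 0" if "\<bar>x\<bar> > real m + 1" for x using that by (simp add: c_def)
  have cL: "c n \<in> L2"
    unfolding L2_def
    by (auto intro!: integrable_continuous_compact_support[of _ "real m + 1"] continuous_on_power cc simp: z)
  have "sqrt (sqnorm (\<lambda>x. g x - c n x)) \<le> sqrt (sqnorm (\<lambda>x. g x - t m x)) + sqrt (sqnorm (\<lambda>x. t m x - c n x))"
    using sqnorm_add_le[OF L2_diff[OF g tL] L2_diff[OF tL cL]] by simp
  also have "\<dots> < sqrt (e / 4) + sqrt (e / 4)"
    using m n by (intro add_strict_mono) auto
  also have "\<dots> = sqrt e" by (simp add: real_sqrt_divide)
  finally have "sqnorm (\<lambda>x. g x - c n x) < e" by simp
  thus ?thesis using that[OF cc z] by auto
qed

locale approximate_identity =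
  fixes k :: "real \<Rightarrow> real \<Rightarrow> real" and A B :: real
  assumes mollifiers: "mollifiers k A B"
begin

lemma A_pos: "A > 0" and B_pos: "B > 0"
  using mollifiers by (auto simp: mollifiers_def)

context fixes \<delta> :: real assumes \<delta>: "\<delta> > 0"
begin

lemma test_k: "test_function (k \<delta>)" and k_nonneg: "k \<delta> x \<ge> 0" and k_eq_0: "\<bar>x\<bar> > \<delta> \<Longrightarrow> k \<delta> x = 0"
  and integral_k: "(\<integral>x. k \<delta> x \<partial>lborel) = 1" and integral_deriv_k: "(\<integral>x. \<bar>deriv (k \<delta>) x\<bar> \<partial>lborel) \<le> A / \<delta>"
  and sqnorm_k: "sqnorm (k \<delta>) \<le> B / \<delta>"
  using mollifiers \<delta> by (auto simp: mollifiers_def sqnorm_def)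

lemma test_deriv_k: "test_function (deriv (k \<delta>))"
  by (rule test_function_deriv[OF test_k])

lemma integrable_k: "integrable lborel (\<lambda>y. k \<delta> (x - y))" "integrable lborel (\<lambda>y. deriv (k \<delta>) (x - y))"
  using test_function_integrable[OF test_k] test_function_integrable[OF test_deriv_k]
  by (simp_all add: integral_reflect_shift)

lemma deriv_k_eq_0: "\<bar>x\<bar> > \<delta> \<Longrightarrow> deriv (k \<delta>) x = 0"
proof (rule DERIV_imp_deriv)
  assume x: "\<bar>x\<bar> > \<delta>"
  have "open {x. \<bar>x\<bar> > \<delta>}" by (intro open_Collect_less continuous_intros)
  thus "(k \<delta> has_real_derivative 0) (at x)"
    using x k_eq_0 by (intro has_field_derivative_transform_within_open[OF DERIV_const, of "{x. \<bar>x\<bar> > \<delta>}"]) auto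
qed

lemma integral_deriv_k_eq_0: "(\<integral>y. deriv (k \<delta>) (x - y) \<partial>lborel) = 0"
proof -
  have s: "smooth (k \<delta>)" "smooth (deriv (k \<delta>))" using test_k test_deriv_k by (auto simp: test_function_def)
  have "(\<integral>y. deriv (k \<delta>) y * indicator {-\<delta> - 1..\<delta> + 1} y \<partial>lborel) = k \<delta> (\<delta> + 1) - k \<delta> (-\<delta> - 1)"
    using \<delta> smooth_continuous_on[OF s(2), of UNIV]
    by (intro integral_FTC_Icc_real smooth_imp_DERIV s) (auto simp: continuous_on_eq_continuous_at)
  also have "\<dots> = 0" using \<delta> by (simp add: k_eq_0)
  also have "(\<lambda>y. deriv (k \<delta>) y * indicator {-\<delta> - 1..\<delta> + 1} y) = deriv (k \<delta>)"
  proof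
    fix y show "deriv (k \<delta>) y * indicator {-\<delta> - 1..\<delta> + 1} y = deriv (k \<delta>) y"
      using deriv_k_eq_0[of y] by (cases "\<bar>y\<bar> > \<delta>") (auto simp: indicator_def)
  qed
  finally show ?thesis by (simp add: integral_reflect_shift)
qed

lemma conv_k_L2:
  assumes "g \<in> L2"
  shows "conv g (k \<delta>) \<in> L2" "sqnorm (conv g (k \<delta>)) \<le> sqnorm g"
  using conv_L2[OF assms test_k] integral_k by (auto simp: k_nonneg)

lemma conv_k_minus_const:
  assumes "integrable lborel (\<lambda>y. g y * k \<delta> (x - y))"
  shows "conv g (k \<delta>) x - c = (\<integral>y. (g y - c) * k \<delta> (x - y) \<partial>lborel)"
    and "integrable lborel (\<lambda>y. (g y - c) * k \<delta> (x - y))"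
  using assms integrable_k integral_k by (simp_all add: conv_def left_diff_distrib integral_reflect_shift)

text \<open>A mollified value is an average of values at distance at most \<open>\<delta>\<close>.\<close>
lemma conv_k_oscillation:
  assumes "integrable lborel (\<lambda>y. g y * k \<delta> (x - y))" "AE y in lborel. \<bar>x - y\<bar> \<le> \<delta> \<longrightarrow> \<bar>g y - c\<bar> \<le> e"
  shows "\<bar>conv g (k \<delta>) x - c\<bar> \<le> e"
proof -
  have "\<bar>\<integral>y. (g y - c) * k \<delta> (x - y) \<partial>lborel\<bar> \<le> (\<integral>y. e * k \<delta> (x - y) \<partial>lborel)"
  proof (rule integral_abs_bound[THEN order_trans], rule integral_mono_AE)
    show "integrable lborel (\<lambda>y. \<bar>(g y - c) * k \<delta> (x - y)\<bar>)"
      by (intro integrable_abs conv_k_minus_const assms)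
    show "AE y in lborel. \<bar>(g y - c) * k \<delta> (x - y)\<bar> \<le> e * k \<delta> (x - y)"
      using assms(2)
    proof eventually_elim
      case (elim y)
      show ?case
        using elim k_nonneg[of "x - y"] k_eq_0[of "x - y"]
        by (cases "\<bar>x - y\<bar> \<le> \<delta>") (auto simp: abs_mult intro!: mult_right_mono)
    qed
  qed (use integrable_k in auto)
  also have "\<dots> = e" using integral_k by (simp add: integral_reflect_shift)
  finally show ?thesis by (simp add: conv_k_minus_const assms)
qed

end

lemma conv_k_tendsto_continuous:
  assumes c: "continuous_on UNIV c" "\<And>x. \<bar>x\<bar> > r \<Longrightarrow> c x = 0" and r: "r > 0"
  shows "((\<lambda>\<delta>. sqnorm (\<lambda>x. conv c (k \<delta>) x - c x)) \<longlongrightarrow> 0) (at_right 0)"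
proof (rule tendstoI)
  fix e :: real assume e: "e > 0"
  define \<eta> where "\<eta> = sqrt (e / (2 * (2 * r + 2)))"
  have \<eta>: "\<eta> > 0" "\<eta>\<^sup>2 * (2 * r + 2) = e / 2" unfolding \<eta>_def using e r by (auto simp: field_simps)
  have cL: "c \<in> L2"
    unfolding L2_def
    by (auto intro!: integrable_continuous_compact_support[of _ r] continuous_on_power c
        borel_measurable_continuous_onI simp: c(2))
  have "uniformly_continuous_on {-(r+2)..r+2} c"
    by (intro compact_uniformly_continuous continuous_on_subset[OF c(1)]) auto
  then obtain d where d: "d > 0" "\<And>x y. \<bar>x\<bar> \<le> r + 2 \<Longrightarrow> \<bar>y\<bar> \<le> r + 2 \<Longrightarrow> \<bar>y - x\<bar> < d \<Longrightarrow> \<bar>c y - c x\<bar> < \<eta>"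
    using \<eta>(1) unfolding uniformly_continuous_on_def dist_real_def abs_le_iff
    by (auto simp: minus_le_iff)
  have "\<forall>\<^sub>F \<delta> in at_right 0. \<delta> < min d 1" "\<forall>\<^sub>F \<delta>::real in at_right 0. \<delta> > 0"
    using d(1) by (auto simp: eventually_at_right_field intro!: exI[of _ "min d 1"])
  thus "\<forall>\<^sub>F \<delta> in at_right 0. dist (sqnorm (\<lambda>x. conv c (k \<delta>) x - c x)) 0 < e"
  proof eventually_elim
    case (elim \<delta>)
    have \<delta>: "\<delta> > 0" using elim by simp
    have ic: "integrable lborel (\<lambda>y. c y * k \<delta> (x - y))" for x by (rule conv_integrable[OF cL test_k[OF \<delta>]])
    have pw: "\<bar>conv c (k \<delta>) x - c x\<bar> \<le> \<eta> * indicator {-(r+1)..r+1} x" for x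
    proof (rule conv_k_oscillation[OF \<delta> ic], rule AE_I2, rule impI)
      fix y assume y: "\<bar>x - y\<bar> \<le> \<delta>"
      show "\<bar>c y - c x\<bar> \<le> \<eta> * indicator {-(r+1)..r+1} x"
      proof (cases "\<bar>x\<bar> \<le> r + 1")
        case True
        moreover have "\<bar>y\<bar> \<le> r + 2" "\<bar>y - x\<bar> < d" using True y elim by linarith+
        ultimately show ?thesis using d(2)[of x y] by (auto simp: indicator_def)
      next
        case False
        hence "\<bar>x\<bar> > r" "\<bar>y\<bar> > r" using y elim by auto
        thus ?thesis using \<eta> by (auto simp: c indicator_def)
      qed
    qed
    have m: "(\<lambda>x. conv c (k \<delta>) x - c x) \<in> borel_measurable borel"
      using L2D(1)[OF L2_diff[OF conv_k_L2(1)[OF \<delta> cL] cL]] .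
    have i: "integrable lborel (\<lambda>x. \<eta>\<^sup>2 * indicator {-(r+1)..r+1} x)"
      by (intro integrable_mult_right integrable_indicator_Icc)
    have "(conv c (k \<delta>) x - c x)\<^sup>2 \<le> \<eta>\<^sup>2 * indicator {-(r+1)..r+1} x" for x
      using power_mono[OF pw[of x], of 2] by (cases "x \<in> {-(r+1)..r+1}") (auto simp: indicator_def)
    hence "sqnorm (\<lambda>x. conv c (k \<delta>) x - c x) \<le> (\<integral>x. \<eta>\<^sup>2 * indicator {-(r+1)..r+1} x \<partial>lborel)"
      using L2_dominated(2)[OF m i] by simp
    also have "\<dots> = \<eta>\<^sup>2 * (2 * r + 2)" using r by simp
    also have "\<dots> < e" using \<eta> e by simp
    finally show ?case by simp
  qed
qed

text \<open>Mollification is a contraction of \<open>L\<^sup>2\<close>, so it suffices to know its convergence on the dense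
  set of continuous functions of compact support.\<close>
lemma conv_k_tendsto:
  assumes g: "g \<in> L2"
  shows "((\<lambda>\<delta>. sqnorm (\<lambda>x. conv g (k \<delta>) x - g x)) \<longlongrightarrow> 0) (at_right 0)"
proof (rule tendstoI)
  fix e :: real assume e: "e > 0"
  obtain c r where c: "continuous_on UNIV c" "\<And>x. \<bar>x\<bar> > r \<Longrightarrow> c x = 0" "r > 0" "sqnorm (\<lambda>x. g x - c x) < e / 16"
    using L2_approx_continuous[OF g, of "e / 16"] e by auto
  have cL: "c \<in> L2"
    unfolding L2_def
    by (auto intro!: integrable_continuous_compact_support[of _ r] continuous_on_power c
        borel_measurable_continuous_onI simp: c(2))
  have "\<forall>\<^sub>F \<delta> in at_right 0. sqnorm (\<lambda>x. conv c (k \<delta>) x - c x) < e / 4"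
    using order_tendstoD(2)[OF conv_k_tendsto_continuous[OF c(1-3)], of "e / 4"] e by simp
  moreover have "\<forall>\<^sub>F \<delta>::real in at_right 0. \<delta> > 0" by (simp add: eventually_at_right_less)
  ultimately show "\<forall>\<^sub>F \<delta> in at_right 0. dist (sqnorm (\<lambda>x. conv g (k \<delta>) x - g x)) 0 < e"
  proof eventually_elim
    case (elim \<delta>)
    note \<delta> = elim(2)
    note L = conv_k_L2(1)[OF \<delta> g] conv_k_L2(1)[OF \<delta> cL] L2_diff[OF g cL] L2_diff[OF cL g]
    have "sqrt (sqnorm (\<lambda>x. conv g (k \<delta>) x - g x)) =
      sqrt (sqnorm (\<lambda>x. (conv (\<lambda>x. g x - c x) (k \<delta>) x + (conv c (k \<delta>) x - c x)) + (c x - g x)))"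
      by (simp add: conv_diff[OF g cL test_k[OF \<delta>]])
    also have "\<dots> \<le> sqrt (sqnorm (\<lambda>x. conv (\<lambda>x. g x - c x) (k \<delta>) x + (conv c (k \<delta>) x - c x)))
        + sqrt (sqnorm (\<lambda>x. c x - g x))"
      by (intro sqnorm_add_le L2_add L2_diff conv_k_L2 \<delta> cL g)
    also have "\<dots> \<le> (sqrt (sqnorm (conv (\<lambda>x. g x - c x) (k \<delta>))) + sqrt (sqnorm (\<lambda>x. conv c (k \<delta>) x - c x)))
        + sqrt (sqnorm (\<lambda>x. c x - g x))"
      by (intro add_right_mono sqnorm_add_le L2_add L2_diff conv_k_L2 \<delta> cL g)
    also have "\<dots> < (sqrt (e / 16) + sqrt (e / 4)) + sqrt (e / 16)"
      using conv_k_L2(2)[OF \<delta> L(3)] c(4) elim(1) sqnorm_diff_commute[of c g]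
      by (intro add_strict_mono) auto
    also have "\<dots> = sqrt e" by (simp add: real_sqrt_divide)
    finally show ?case by simp
  qed
qed

lemma inverse_Suc_at_right_0: "filterlim (\<lambda>n. 1 / real (Suc n)) (at_right 0) sequentially"
  using LIMSEQ_inverse_real_of_nat
  by (auto simp: filterlim_at inverse_eq_divide eventually_sequentially)

lemma conv_k_AE_subseq:
  assumes g: "g \<in> L2"
  obtains \<delta>s where "\<And>n. \<delta>s n > (0::real)" "filterlim \<delta>s (at_right 0) sequentially"
    "AE x in lborel. (\<lambda>n. conv g (k (\<delta>s n)) x) \<longlonglongrightarrow> g x"
proof -
  define u where "u n x = (conv g (k (1 / real (Suc n))) x - g x)\<^sup>2" for n x
  have "\<exists>r::nat\<Rightarrow>nat. strict_mono r \<and> (AE x in lborel. (\<lambda>n. u (r n) x) \<longlonglongrightarrow> 0)"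
  proof (rule tendsto_L1_AE_subseq)
    show "integrable lborel (u n)" for n
      unfolding u_def using L2D(2)[OF L2_diff[OF conv_k_L2(1)[OF _ g] g], of "1 / real (Suc n)"] by simp
    show "(\<lambda>n. \<integral>x. norm (u n x) \<partial>lborel) \<longlonglongrightarrow> 0"
      using filterlim_compose[OF conv_k_tendsto[OF g] inverse_Suc_at_right_0] by (simp add: u_def sqnorm_def)
  qed
  then obtain r where r: "strict_mono r" "AE x in lborel. (\<lambda>n. u (r n) x) \<longlonglongrightarrow> 0" by blast
  show ?thesis
  proof (rule that[of "\<lambda>n. 1 / real (Suc (r n))"])
    show "filterlim (\<lambda>n. 1 / real (Suc (r n))) (at_right 0) sequentially"
      by (rule filterlim_compose[OF inverse_Suc_at_right_0 filterlim_subseq[OF r(1)]])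
    show "AE x in lborel. (\<lambda>n. conv g (k (1 / real (Suc (r n)))) x) \<longlonglongrightarrow> g x"
      using r(2)
    proof eventually_elim
      case (elim x)
      hence "(\<lambda>n. sqrt (u (r n) x)) \<longlonglongrightarrow> sqrt 0" by (intro tendsto_intros)
      hence "(\<lambda>n. conv g (k (1 / real (Suc (r n)))) x - g x) \<longlonglongrightarrow> 0"
        unfolding u_def by (simp add: tendsto_rabs_zero_iff)
      thus ?case by (simp add: LIM_zero_iff)
    qed
  qed simp
qed

end

section \<open>Weak derivatives\<close>

lemma conv_weak_deriv:
  assumes "has_weak_deriv g h" "test_function \<kappa>"
  shows "conv g (deriv \<kappa>) x = conv h \<kappa> x"
proof -
  have "(\<integral>y. g y * deriv (\<lambda>y. \<kappa> (x - y)) y \<partial>lborel) = - (\<integral>y. h y * \<kappa> (x - y) \<partial>lborel)"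
    using assms test_function_reflect[OF assms(2)] unfolding has_weak_deriv_def by blast
  moreover have "deriv (\<lambda>y. \<kappa> (x - y)) = (\<lambda>y. - deriv \<kappa> (x - y))"
    using deriv_reflect[OF assms(2), of 1 x] by simp
  ultimately show ?thesis by (simp add: conv_def)
qed

lemma H1D:
  assumes "g \<in> H1" shows "g \<in> L2" "wderiv g \<in> L2" "has_weak_deriv g (wderiv g)"
  using someI_ex[of "\<lambda>h. h \<in> L2 \<and> has_weak_deriv g h"] assms by (auto simp: H1_def wderiv_def)

lemma sqnorm_eq_0_iff: "g \<in> L2 \<Longrightarrow> sqnorm g = 0 \<longleftrightarrow> (AE x in lborel. g x = 0)"
  unfolding sqnorm_def using L2D(2)[of g] by (subst integral_nonneg_eq_0_iff_AE) auto

lemma has_weak_deriv_diff: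
  assumes "has_weak_deriv g h" "has_weak_deriv g' h'" "g \<in> L2" "h \<in> L2" "g' \<in> L2" "h' \<in> L2"
  shows "has_weak_deriv (\<lambda>x. g x - g' x) (\<lambda>x. h x - h' x)"
  unfolding has_weak_deriv_def
proof (intro allI impI)
  fix \<phi> assume t: "test_function \<phi>"
  note L = test_function_L2[OF t] test_function_L2[OF test_function_deriv[OF t]]
  have "(\<integral>x. g x * deriv \<phi> x \<partial>lborel) = - (\<integral>x. h x * \<phi> x \<partial>lborel)"
       "(\<integral>x. g' x * deriv \<phi> x \<partial>lborel) = - (\<integral>x. h' x * \<phi> x \<partial>lborel)"
    using assms t unfolding has_weak_deriv_def by blast+
  thus "(\<integral>x. (g x - g' x) * deriv \<phi> x \<partial>lborel) = - (\<integral>x. (h x - h' x) * \<phi> x \<partial>lborel)"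
    using L2_integrable_mult[OF assms(3) L(2)] L2_integrable_mult[OF assms(4) L(1)]
      L2_integrable_mult[OF assms(5) L(2)] L2_integrable_mult[OF assms(6) L(1)]
    by (simp add: left_diff_distrib)
qed

context approximate_identity
begin

text \<open>The mollifications of a weak derivative are determined by the function, and they converge to it.\<close>
lemma weak_deriv_unique:
  assumes "has_weak_deriv g h" "has_weak_deriv g h'" "h \<in> L2" "h' \<in> L2"
  shows "AE x in lborel. h x = h' x"
proof -
  define d where "d x = h x - h' x" for x
  have dL: "d \<in> L2" unfolding d_def by (rule L2_diff[OF assms(3,4)])
  have "sqnorm (\<lambda>x. conv d (k \<delta>) x - d x) = sqnorm d" if "\<delta> > 0" for \<delta>
    using conv_weak_deriv[OF assms(1) test_k[OF that]] conv_weak_deriv[OF assms(2) test_k[OF that]]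
    unfolding d_def by (simp add: conv_diff[OF assms(3,4) test_k[OF that]] sqnorm_def power2_commute)
  hence "\<forall>\<^sub>F \<delta> in at_right 0. sqnorm (\<lambda>x. conv d (k \<delta>) x - d x) = sqnorm d"
    by (auto simp: eventually_at_right_field intro!: exI[of _ 1])
  hence "((\<lambda>\<delta>. sqnorm (\<lambda>x. conv d (k \<delta>) x - d x)) \<longlongrightarrow> sqnorm d) (at_right 0)"
    by (rule tendsto_eventually)
  hence "sqnorm d = 0"
    using tendsto_unique[OF _ _ conv_k_tendsto[OF dL]] by (simp add: trivial_limit_at_right_real)
  thus ?thesis using sqnorm_eq_0_iff[OF dL] by (simp add: d_def)
qed

lemma wderiv_diff:
  assumes "g \<in> H1" "g' \<in> H1"
  shows "(\<lambda>x. g x - g' x) \<in> H1"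
    and "sqnorm (wderiv (\<lambda>x. g x - g' x)) = sqnorm (\<lambda>x. wderiv g x - wderiv g' x)"
proof -
  note d = H1D[OF assms(1)] H1D[OF assms(2)]
  have w: "has_weak_deriv (\<lambda>x. g x - g' x) (\<lambda>x. wderiv g x - wderiv g' x)"
    by (rule has_weak_deriv_diff) (use d in auto)
  show H: "(\<lambda>x. g x - g' x) \<in> H1"
    unfolding H1_def using w L2_diff d by blast
  have "AE x in lborel. wderiv (\<lambda>x. g x - g' x) x = wderiv g x - wderiv g' x"
    by (rule weak_deriv_unique[OF H1D(3)[OF H] w H1D(2)[OF H] L2_diff[OF d(2,5)]])
  moreover have [measurable]: "wderiv g \<in> borel_measurable borel" "wderiv g' \<in> borel_measurable borel"
     "wderiv (\<lambda>x. g x - g' x) \<in> borel_measurable borel"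
    using d H1D(2)[OF H] L2D(1) by auto
  ultimately show "sqnorm (wderiv (\<lambda>x. g x - g' x)) = sqnorm (\<lambda>x. wderiv g x - wderiv g' x)"
    unfolding sqnorm_def by (intro integral_cong_AE) (auto elim: eventually_mono)
qed

end

lemma AE_lborel_imp_ex:
  assumes "AE x in lborel. P x" shows "\<exists>x::real. P x"
proof (rule ccontr)
  assume "\<not> ?thesis"
  hence "AE x::real in lborel. False" using assms by simp
  then obtain N :: "real set" where N: "N \<in> null_sets lborel" "UNIV \<subseteq> N"
    by (auto simp: eventually_ae_filter)
  hence "emeasure lborel (UNIV :: real set) = 0"
    by (metis null_setsD1 top.extremum_uniqueI)
  thus False by simp
qed

text \<open>The oscillation of \<open>v\<^sup>2\<close> is at most \<open>\<integral> \<bar>2 v v'\<bar>\<close>, hence at most the right-hand side. If \<open>v\<^sup>2\<close> exceeded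
  it at one point, \<open>v\<^sup>2\<close> would be bounded below by a positive constant everywhere and not be integrable.\<close>
lemma Sobolev_C1:
  fixes v v' :: "real \<Rightarrow> real"
  assumes D: "\<And>x. (v has_real_derivative v' x) (at x)" and c: "continuous_on UNIV v'"
    and L: "v \<in> L2" "v' \<in> L2"
  shows "(v x)\<^sup>2 \<le> sqnorm v + sqnorm v'"
proof (rule ccontr)
  define S where "S = sqnorm v + sqnorm v'"
  assume "\<not> ?thesis"
  hence pos: "(v x)\<^sup>2 - S > 0" by (simp add: S_def)
  have i: "integrable lborel (\<lambda>x. (v x)\<^sup>2 + (v' x)\<^sup>2)" using L2D(2)[OF L(1)] L2D(2)[OF L(2)] by simp
  have osc: "\<bar>(v b)\<^sup>2 - (v a)\<^sup>2\<bar> \<le> S" if "a \<le> b" for a b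
  proof -
    have cv: "continuous_on UNIV v" by (rule DERIV_continuous_on[where D=v']) (rule DERIV_subset[OF D], auto)
    have "(v b)\<^sup>2 - (v a)\<^sup>2 = (\<integral>x. (2 * v x * v' x) * indicator {a..b} x \<partial>lborel)"
      using cv c by (intro integral_FTC_Icc_real[symmetric] that)
        (auto intro!: derivative_eq_intros D continuous_intros simp: continuous_on_eq_continuous_at)
    also have "\<bar>\<integral>x. (2 * v x * v' x) * indicator {a..b} x \<partial>lborel\<bar> \<le> (\<integral>x. (v x)\<^sup>2 + (v' x)\<^sup>2 \<partial>lborel)"
    proof (rule integral_abs_bound[THEN order_trans], rule integral_mono)
      show "integrable lborel (\<lambda>x. \<bar>(2 * v x * v' x) * indicator {a..b} x\<bar>)"
        using L2_integrable_mult[OF L]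
        by (intro integrable_abs integrable_mult_indicator[where 'b=real, simplified mult.commute
            real_scaleR_def])
           (auto simp: mult.assoc)
      show "\<bar>(2 * v x * v' x) * indicator {a..b} x\<bar> \<le> (v x)\<^sup>2 + (v' x)\<^sup>2" for x
        using sum_squares_bound[of "\<bar>v x\<bar>" "\<bar>v' x\<bar>"] by (auto simp: abs_mult indicator_def)
    qed (rule i)
    also have "\<dots> = S" using L2D(2)[OF L(1)] L2D(2)[OF L(2)] by (simp add: S_def sqnorm_def)
    finally show ?thesis .
  qed
  have ge: "(v y)\<^sup>2 \<ge> (v x)\<^sup>2 - S" for y
    using osc[of x y] osc[of y x] by (cases "x \<le> y") auto
  obtain n :: nat where n: "sqnorm v / ((v x)\<^sup>2 - S) < n" using reals_Archimedean2 by blast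
  have "((v x)\<^sup>2 - S) * n = (\<integral>y. ((v x)\<^sup>2 - S) * indicator {0..real n} y \<partial>lborel)" by simp
  also have "\<dots> \<le> sqnorm v"
    unfolding sqnorm_def
  proof (rule integral_mono)
    show "integrable lborel (\<lambda>y. ((v x)\<^sup>2 - S) * indicator {0..real n} y)"
      by (intro integrable_mult_right integrable_indicator_Icc)
    show "((v x)\<^sup>2 - S) * indicator {0..real n} y \<le> (v y)\<^sup>2" for y
      using ge[of y] by (auto simp: indicator_def)
  qed (rule L2D(2)[OF L(1)])
  finally show False using n pos by (simp add: field_simps)
qed

context approximate_identity
begin

lemma conv_k_Sobolev:
  assumes "g \<in> L2" "h \<in> L2" "has_weak_deriv g h" "\<delta> > 0"
  shows "\<bar>conv g (k \<delta>) x\<bar> \<le> sqrt (sqnorm g + sqnorm h)"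
proof -
  note t = test_k[OF assms(4)]
  have e: "conv g (deriv (k \<delta>)) = conv h (k \<delta>)" using conv_weak_deriv[OF assms(3) t] by auto
  have "(conv g (k \<delta>) x)\<^sup>2 \<le> sqnorm (conv g (k \<delta>)) + sqnorm (conv h (k \<delta>))"
    using DERIV_conv[OF assms(1) t] unfolding e
    by (rule Sobolev_C1) (intro conv_continuous conv_k_L2 assms t)+
  also have "\<dots> \<le> sqnorm g + sqnorm h" by (intro add_mono conv_k_L2 assms)
  finally show ?thesis by (simp add: real_le_rsqrt)
qed

lemma H1_AE_bound:
  assumes "g \<in> L2" "h \<in> L2" "has_weak_deriv g h"
  shows "AE x in lborel. \<bar>g x\<bar> \<le> sqrt (sqnorm g + sqnorm h)"
proof -
  obtain \<delta>s where \<delta>s: "\<And>n. \<delta>s n > (0::real)" "AE x in lborel. (\<lambda>n. conv g (k (\<delta>s n)) x) \<longlonglongrightarrow> g x"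
    using conv_k_AE_subseq[OF assms(1)] by blast
  show ?thesis using \<delta>s(2)
  proof eventually_elim
    case (elim x)
    show ?case
      by (rule Lim_bounded[OF tendsto_rabs[OF elim], of 0]) (use conv_k_Sobolev[OF assms \<delta>s(1)] in auto)
  qed
qed

text \<open>The fundamental theorem of calculus for weak derivatives: pass to the limit in the classical one
  for the mollified function, anchored at a single point of convergence.\<close>
lemma weak_deriv_representative:
  assumes g: "g \<in> L2" and h: "h \<in> L2" and w: "has_weak_deriv g h"
  obtains G where "G \<in> borel_measurable borel" "AE x in lborel. g x = G x"
    "\<And>a b. a \<le> b \<Longrightarrow> G b - G a = (\<integral>x. h x * indicator {a..b} x \<partial>lborel)"
proof -
  obtain \<delta>s where \<delta>s: "\<And>n. \<delta>s n > (0::real)" "filterlim \<delta>s (at_right 0) sequentially"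
    "AE x in lborel. (\<lambda>n. conv g (k (\<delta>s n)) x) \<longlonglongrightarrow> g x"
    using conv_k_AE_subseq[OF g] by blast
  define v where "v n = conv g (k (\<delta>s n))" for n
  have hl: "(\<lambda>n. v n b - v n a) \<longlonglongrightarrow> (\<integral>x. h x * indicator {a..b} x \<partial>lborel)" if ab: "a \<le> b" for a b
  proof -
    have e: "v n b - v n a = (\<integral>x. conv h (k (\<delta>s n)) x * indicator {a..b} x \<partial>lborel)" for n
      using DERIV_conv[OF g test_k[OF \<delta>s(1)[of n]]] conv_weak_deriv[OF w test_k[OF \<delta>s(1)[of n]]]
        conv_continuous[OF h test_k[OF \<delta>s(1)[of n]], of UNIV] unfolding v_def
      by (intro integral_FTC_Icc_real[symmetric] ab) (auto simp: continuous_on_eq_continuous_at)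
    have z: "(\<lambda>n. sqrt (sqnorm (\<lambda>x. conv h (k (\<delta>s n)) x - h x)) * sqrt (sqnorm (indicator {a..b})))
        \<longlonglongrightarrow> sqrt 0 * sqrt (sqnorm (indicator {a..b}))"
      by (intro tendsto_intros filterlim_compose[OF conv_k_tendsto[OF h] \<delta>s(2)])
    have "(\<lambda>n. (v n b - v n a) - (\<integral>x. h x * indicator {a..b} x \<partial>lborel)) \<longlonglongrightarrow> 0"
    proof (rule Lim_null_comparison[OF always_eventually], rule allI)
      fix n
      have "(v n b - v n a) - (\<integral>x. h x * indicator {a..b} x \<partial>lborel)
         = (\<integral>x. (conv h (k (\<delta>s n)) x - h x) * indicator {a..b} x \<partial>lborel)"
        unfolding e left_diff_distrib
        by (subst Bochner_Integration.integral_diff)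
            (intro L2_integrable_mult conv_k_L2 \<delta>s h indicator_Icc_L2 refl)+
      thus "norm ((v n b - v n a) - (\<integral>x. h x * indicator {a..b} x \<partial>lborel)) \<le>
          sqrt (sqnorm (\<lambda>x. conv h (k (\<delta>s n)) x - h x)) * sqrt (sqnorm (indicator {a..b}))"
        using Cauchy_Schwarz(2)[OF L2_diff[OF conv_k_L2(1)[OF \<delta>s(1) h] h] indicator_Icc_L2, of n a b] by simp
    qed (use z in simp)
    thus ?thesis by (simp add: LIM_zero_iff)
  qed
  have "\<exists>x0. (\<lambda>n. v n x0) \<longlonglongrightarrow> g x0"
  proof (rule ccontr)
    assume "\<not> ?thesis"
    thus False using AE_lborel_imp_ex[OF \<delta>s(3)] by (auto simp: v_def)
  qed
  then obtain x0 where x0: "(\<lambda>n. v n x0) \<longlonglongrightarrow> g x0" by blast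
  have conv: "convergent (\<lambda>n. v n x)" for x
  proof (cases "x0 \<le> x")
    case True
    show ?thesis using tendsto_add[OF hl[OF True] x0] by (auto simp: convergent_def)
  next
    case False
    show ?thesis using tendsto_diff[OF x0 hl[of x x0]] False by (auto simp: convergent_def)
  qed
  define G where "G x = lim (\<lambda>n. v n x)" for x
  have Gl: "(\<lambda>n. v n x) \<longlonglongrightarrow> G x" for x using conv[of x] unfolding G_def by (simp add: convergent_LIMSEQ_iff)
  show ?thesis
  proof (rule that[of G])
    have "v n \<in> borel_measurable borel" for n
      unfolding v_def by (intro borel_measurable_continuous_onI conv_continuous g test_k \<delta>s)
    thus "G \<in> borel_measurable borel" using Gl by (rule borel_measurable_LIMSEQ_real[rotated])
    show "AE x in lborel. g x = G x"
      using \<delta>s(3) by eventually_elim (use Gl LIMSEQ_unique in \<open>auto simp: v_def\<close>)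
    show "G b - G a = (\<integral>x. h x * indicator {a..b} x \<partial>lborel)" if "a \<le> b" for a b
      using LIMSEQ_unique[OF tendsto_diff[OF Gl Gl] hl[OF that]] by simp
  qed
qed

section \<open>The commutator of mollification and the nonlinearity\<close>

text \<open>This is where the weak derivative enters the commutator estimate: for two points of the interval the
  difference of the values of \<open>g\<close> is an integral of \<open>h\<close> between them.\<close>
lemma local_oscillation:
  assumes g: "g \<in> L2" and h: "h \<in> L2" and w: "has_weak_deriv g h" and \<delta>: "\<delta> > 0"
  shows "AE y in lborel. \<bar>x - y\<bar> \<le> \<delta> \<longrightarrow> \<bar>g y - conv g (k \<delta>) x\<bar>
      \<le> (\<integral>y. \<bar>h y\<bar> * indicator {x - \<delta>..x + \<delta>} y \<partial>lborel)"
proof -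
  obtain G where G: "G \<in> borel_measurable borel" "AE x in lborel. g x = G x"
    "\<And>a b. a \<le> b \<Longrightarrow> G b - G a = (\<integral>x. h x * indicator {a..b} x \<partial>lborel)"
    using weak_deriv_representative[OF g h w] by blast
  define S where "S = (\<integral>y. \<bar>h y\<bar> * indicator {x - \<delta>..x + \<delta>} y \<partial>lborel)"
  have inc: "\<bar>G b - G a\<bar> \<le> S" if "a \<le> b" "x - \<delta> \<le> a" "b \<le> x + \<delta>" for a b
    unfolding G(3)[OF that(1)] S_def
  proof (rule integral_abs_bound[THEN order_trans], rule integral_mono)
    show "integrable lborel (\<lambda>x. \<bar>h x * indicator {a..b} x\<bar>)"
      by (intro integrable_abs L2_integrable_mult h indicator_Icc_L2)
    show "integrable lborel (\<lambda>y. \<bar>h y\<bar> * indicator {x - \<delta>..x + \<delta>} y)"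
      by (intro L2_integrable_mult L2_abs h indicator_Icc_L2)
    show "\<bar>h y * indicator {a..b} y\<bar> \<le> \<bar>h y\<bar> * indicator {x - \<delta>..x + \<delta>} y" for y
      using that by (auto simp: indicator_def)
  qed
  have osc: "\<bar>G z - G y\<bar> \<le> S" if "\<bar>x - y\<bar> \<le> \<delta>" "\<bar>x - z\<bar> \<le> \<delta>" for y z
    using inc[of y z] inc[of z y] that by (cases "y \<le> z") (auto simp: abs_le_iff abs_minus_commute)
  have "\<bar>conv g (k \<delta>) x - G y\<bar> \<le> S" if "\<bar>x - y\<bar> \<le> \<delta>" for y
  proof (rule conv_k_oscillation[OF \<delta> conv_integrable[OF g test_k[OF \<delta>]]])
    show "AE z in lborel. \<bar>x - z\<bar> \<le> \<delta> \<longrightarrow> \<bar>g z - G y\<bar> \<le> S"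
      using G(2) by eventually_elim (use osc[OF that] in auto)
  qed
  thus ?thesis using G(2) unfolding S_def[symmetric]
    by (auto elim!: eventually_mono simp: abs_minus_commute)
qed

text \<open>The first-order part of \<open>f\<close> at
  \<open>conv g (k \<delta>) x\<close> cancels because \<open>deriv (k \<delta>)\<close> has mean zero. The remainder is quadratic in
  the oscillation of \<open>g\<close> on an interval of length \<open>2 * \<delta>\<close>, whose square is controlled by \<open>\<delta>\<close>
  times the integral of \<open>h\<^sup>2\<close> over that interval; this beats the factor \<open>1 / \<delta>\<close> lost on \<open>deriv (k \<delta>)\<close>.\<close>
lemma commutator_pointwise:
  assumes g: "g \<in> L2" and h: "h \<in> L2" and w: "has_weak_deriv g h" and \<delta>: "\<delta> > 0"
    and fg: "(\<lambda>x. f (g x)) \<in> L2" and M: "AE x in lborel. \<bar>g x\<bar> \<le> M"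
    and f: "\<And>s. (f has_real_derivative f' s) (at s)" "\<And>s. (f' has_real_derivative f'' s) (at s)"
    and K: "\<And>s. \<bar>s\<bar> \<le> M \<Longrightarrow> \<bar>f'' s\<bar> \<le> K"
  shows "\<bar>f' (conv g (k \<delta>) x) * conv g (deriv (k \<delta>)) x - conv (\<lambda>x. f (g x)) (deriv (k \<delta>)) x\<bar>
     \<le> 2 * K * A * conv (\<lambda>y. (h y)\<^sup>2) (indicator {-\<delta>..\<delta>}) x"
proof -
  define v where "v = conv g (k \<delta>) x"
  define S where "S = (\<integral>y. \<bar>h y\<bar> * indicator {x - \<delta>..x + \<delta>} y \<partial>lborel)"
  note t = test_k[OF \<delta>] and td = test_deriv_k[OF \<delta>]
  note I = indicator_Icc_L2[of "x - \<delta>" "x + \<delta>"]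
  have "\<exists>x. \<bar>g x\<bar> \<le> M" by (rule AE_lborel_imp_ex[OF M])
  hence M0: "M \<ge> 0" by auto
  hence K0: "K \<ge> 0" using K[of 0] by auto
  have "\<bar>v - 0\<bar> \<le> M" unfolding v_def
    by (rule conv_k_oscillation[OF \<delta> conv_integrable[OF g t]]) (use M in \<open>auto elim: eventually_mono\<close>)
  hence vM: "\<bar>v\<bar> \<le> M" by simp
  have tay: "AE y in lborel. \<bar>(f (g y) - f v - (g y - v) * f' v) * deriv (k \<delta>) (x - y)\<bar>
      \<le> K * S\<^sup>2 * \<bar>deriv (k \<delta>) (x - y)\<bar>"
    using local_oscillation[OF g h w \<delta>, of x] M
  proof eventually_elim
    case (elim y)
    show ?case
    proof (cases "\<bar>x - y\<bar> \<le> \<delta>")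
      case True
      have gv: "\<bar>g y - v\<bar> \<le> S" using elim True by (simp add: v_def S_def)
      have "\<bar>f (g y) - f v - (g y - v) * f' v\<bar> \<le> K * (g y - v)\<^sup>2"
      proof (rule taylor2_bound[OF f])
        fix z assume "z \<in> closed_segment v (g y)"
        hence "\<bar>z\<bar> \<le> M" using vM elim(2) by (auto simp: closed_segment_eq_real_ivl split: if_splits)
        thus "\<bar>f'' z\<bar> \<le> K" by (rule K)
      qed
      also have "\<dots> \<le> K * S\<^sup>2" using gv K0 power_mono[OF gv, of 2] by (intro mult_left_mono) auto
      finally show ?thesis by (simp add: abs_mult mult_right_mono)
    next
      case False
      thus ?thesis using deriv_k_eq_0[OF \<delta>] by simp
    qed
  qed
  have i1: "integrable lborel (\<lambda>y. f (g y) * deriv (k \<delta>) (x - y))" by (rule conv_integrable[OF fg td])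
  have i2: "integrable lborel (\<lambda>y. g y * deriv (k \<delta>) (x - y))" by (rule conv_integrable[OF g td])
  have i3: "integrable lborel (\<lambda>y. deriv (k \<delta>) (x - y))" by (rule integrable_k(2)[OF \<delta>])
  have eq: "(\<lambda>y. (f (g y) - f v - (g y - v) * f' v) * deriv (k \<delta>) (x - y)) =
    (\<lambda>y. f (g y) * deriv (k \<delta>) (x - y) - f' v * (g y * deriv (k \<delta>) (x - y)) - (f v
        - v * f' v) * deriv (k \<delta>) (x - y))"
    by (auto simp: algebra_simps)
  have i0: "integrable lborel (\<lambda>y. (f (g y) - f v - (g y - v) * f' v) * deriv (k \<delta>) (x - y))"
    unfolding eq using i1 i2 i3 by simp
  have "f' v * conv g (deriv (k \<delta>)) x - conv (\<lambda>x. f (g x)) (deriv (k \<delta>)) x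
     = - (\<integral>y. (f (g y) - f v - (g y - v) * f' v) * deriv (k \<delta>) (x - y) \<partial>lborel)"
    unfolding eq conv_def using i1 i2 i3 integral_deriv_k_eq_0[OF \<delta>] by simp
  moreover have "\<bar>\<integral>y. (f (g y) - f v - (g y - v) * f' v) * deriv (k \<delta>) (x - y) \<partial>lborel\<bar>
     \<le> (\<integral>y. K * S\<^sup>2 * \<bar>deriv (k \<delta>) (x - y)\<bar> \<partial>lborel)"
    by (rule integral_abs_bound[THEN order_trans], rule integral_mono_AE[OF integrable_abs[OF i0] _ tay])
       (use i3 in auto)
  moreover have "(\<integral>y. K * S\<^sup>2 * \<bar>deriv (k \<delta>) (x - y)\<bar> \<partial>lborel) \<le> K * S\<^sup>2 * (A / \<delta>)"
    using mult_left_mono[OF integral_deriv_k[OF \<delta>], of "K * S\<^sup>2"] K0 integral_reflect_shift(1)[of "\<lambda>y.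
        \<bar>deriv (k \<delta>) y\<bar>" x]
    by simp
  moreover have "S\<^sup>2 \<le> 2 * \<delta> * conv (\<lambda>y. (h y)\<^sup>2) (indicator {-\<delta>..\<delta>}) x"
  proof -
    have "S\<^sup>2 = (\<integral>y. (\<bar>h y\<bar> * indicator {x - \<delta>..x + \<delta>} y) * indicator {x - \<delta>..x + \<delta>} y \<partial>lborel)\<^sup>2"
      unfolding S_def by (simp add: mult.assoc flip: indicator_inter_arith)
    also have "\<dots> \<le> sqnorm (\<lambda>y. \<bar>h y\<bar> * indicator {x - \<delta>..x + \<delta>} y) * sqnorm (indicator {x - \<delta>..x + \<delta>})"
      by (rule Cauchy_Schwarz_sq[OF L2_cmult_bound(1)[OF _ h, of _ 1] I])
         (use L2D(1)[OF h] in \<open>auto simp: indicator_def\<close>)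
    also have "sqnorm (indicator {x - \<delta>..x + \<delta>}) = 2 * \<delta>"
      using \<delta> by (simp add: sqnorm_def power2_eq_square flip: indicator_inter_arith)
    also have "sqnorm (\<lambda>y. \<bar>h y\<bar> * indicator {x - \<delta>..x + \<delta>} y) = conv (\<lambda>y. (h y)\<^sup>2) (indicator {-\<delta>..\<delta>}) x"
      unfolding sqnorm_def conv_def
      by (intro Bochner_Integration.integral_cong refl) (auto simp: indicator_def)
    finally show ?thesis by (simp add: mult.commute)
  qed
  hence "K * S\<^sup>2 * (A / \<delta>) \<le> K * (2 * \<delta> * conv (\<lambda>y. (h y)\<^sup>2) (indicator {-\<delta>..\<delta>}) x) * (A / \<delta>)"
    using K0 A_pos \<delta> by (intro mult_right_mono mult_left_mono) auto
  moreover have "K * (2 * \<delta> * conv (\<lambda>y. (h y)\<^sup>2) (indicator {-\<delta>..\<delta>}) x) * (A / \<delta>)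
    = 2 * K * A * conv (\<lambda>y. (h y)\<^sup>2) (indicator {-\<delta>..\<delta>}) x"
    using \<delta> by simp
  ultimately show ?thesis unfolding v_def by linarith
qed

text \<open>Up to a constant factor, the right-hand side of the commutator estimate is the convolution of two
    integrable functions.\<close>
lemma integral_commutator_bound:
  assumes h: "h \<in> L2" and \<delta>: "\<delta> > 0"
  shows "integrable lborel (conv (\<lambda>y. (h y)\<^sup>2) (indicator {-\<delta>..\<delta>}))"
    and "(\<integral>x. conv (\<lambda>y. (h y)\<^sup>2) (indicator {-\<delta>..\<delta>}) x \<partial>lborel) = 2 * \<delta> * sqnorm h"
proof -
  have i: "integrable lborel (indicator {-\<delta>..\<delta>} :: real \<Rightarrow> real)"
    by (rule integrable_indicator_Icc)
  show "integrable lborel (conv (\<lambda>y. (h y)\<^sup>2) (indicator {-\<delta>..\<delta>}))"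
    and "(\<integral>x. conv (\<lambda>y. (h y)\<^sup>2) (indicator {-\<delta>..\<delta>}) x \<partial>lborel) = 2 * \<delta> * sqnorm h"
    using conv_integral[OF L2D(2)[OF h] i] \<delta> by (simp_all add: sqnorm_def)
qed

end

lemma L2_compose:
  assumes g: "g \<in> L2" and M: "AE x in lborel. \<bar>g x\<bar> \<le> M"
    and f: "\<And>s. (f has_real_derivative f' s) (at s)" "f 0 = 0"
    and K: "\<And>s. \<bar>s\<bar> \<le> M \<Longrightarrow> \<bar>f' s\<bar> \<le> K"
  shows "(\<lambda>x. f (g x)) \<in> L2"
proof (rule L2_cmult_bound(1)[OF _ g])
  have "continuous_on UNIV f" by (rule DERIV_continuous_on[where D=f']) (rule DERIV_subset[OF f(1)], auto)
  hence "f \<in> borel_measurable borel" by (rule borel_measurable_continuous_onI)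
  thus "(\<lambda>x. f (g x)) \<in> borel_measurable borel" using L2D(1)[OF g] by simp
  show "AE x in lborel. \<bar>f (g x)\<bar> \<le> K * \<bar>g x\<bar>" using M
  proof eventually_elim
    case (elim x)
    have "\<bar>f (g x) - f 0\<bar> \<le> K * \<bar>g x - 0\<bar>"
      by (rule Lipschitz_on_interval[OF f(1) K]) (use elim in auto)
    thus ?case using f(2) by simp
  qed
qed

section \<open>Integrated conservation laws\<close>

text \<open>Functions on the slab \<open>{a..b} \<times> \<real>\<close> that are square-integrable and bounded in space, uniformly in
  time. The \<open>slab_L1\<close> functions, uniformly integrable in space, contain the products of two such
  functions. Joint continuity is included to have measurability on the plane.\<close>
definition slab_L2 :: "real \<Rightarrow> real \<Rightarrow> (real \<Rightarrow> real \<Rightarrow> real) \<Rightarrow> bool" where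
  "slab_L2 a b w \<longleftrightarrow> continuous_on UNIV (\<lambda>(t, x). w t x) \<and>
     (\<exists>C. \<forall>t\<in>{a..b}. (\<forall>x. \<bar>w t x\<bar> \<le> C) \<and> w t \<in> L2 \<and> sqnorm (w t) \<le> C)"

definition slab_L1 :: "real \<Rightarrow> real \<Rightarrow> (real \<Rightarrow> real \<Rightarrow> real) \<Rightarrow> bool" where
  "slab_L1 a b w \<longleftrightarrow> continuous_on UNIV (\<lambda>(t, x). w t x) \<and>
     (\<exists>C. \<forall>t\<in>{a..b}. integrable lborel (w t) \<and> (\<integral>x. \<bar>w t x\<bar> \<partial>lborel) \<le> C)"

lemma continuous_slice:
  assumes "continuous_on UNIV (\<lambda>(t, x). w t x :: real)"
  shows "continuous_on S (w t)" "continuous_on S (\<lambda>t. w t x)"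
proof -
  have "continuous_on S (\<lambda>x. (\<lambda>(t, x). w t x) (t, x))" "continuous_on S (\<lambda>t. (\<lambda>(t, x). w t x) (t, x))"
    by (rule continuous_on_compose2[OF assms]; auto intro!: continuous_intros)+
  thus "continuous_on S (w t)" "continuous_on S (\<lambda>t. w t x)" by simp_all
qed

lemma slab_L1_dominated:
  assumes z: "slab_L1 a b z" and c: "continuous_on UNIV (\<lambda>(t, x). w t x)"
    and le: "\<And>t x. t \<in> {a..b} \<Longrightarrow> \<bar>w t x\<bar> \<le> C * \<bar>z t x\<bar>"
  shows "slab_L1 a b w"
proof -
  obtain D where D: "\<And>t. t \<in> {a..b} \<Longrightarrow> integrable lborel (z t) \<and> (\<integral>x. \<bar>z t x\<bar> \<partial>lborel) \<le> D"
    using z unfolding slab_L1_def by blast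
  have "integrable lborel (w t) \<and> (\<integral>x. \<bar>w t x\<bar> \<partial>lborel) \<le> \<bar>C\<bar> * D" if t: "t \<in> {a..b}" for t
  proof -
    have i: "integrable lborel (\<lambda>x. \<bar>C\<bar> * \<bar>z t x\<bar>)" using D[OF t] by simp
    have le': "\<bar>w t x\<bar> \<le> \<bar>C\<bar> * \<bar>z t x\<bar>" for x
      by (rule order_trans[OF le[OF t] mult_right_mono]) auto
    have iw: "integrable lborel (w t)"
      by (rule Bochner_Integration.integrable_bound[OF i])
         (use le' continuous_slice(1)[OF c, of UNIV t] in \<open>auto simp: borel_measurable_continuous_onI abs_mult\<close>)
    have "(\<integral>x. \<bar>w t x\<bar> \<partial>lborel) \<le> (\<integral>x. \<bar>C\<bar> * \<bar>z t x\<bar> \<partial>lborel)"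
      by (rule integral_mono[OF integrable_abs[OF iw] i le'])
    also have "\<dots> \<le> \<bar>C\<bar> * D" using D[OF t] by (simp add: mult_left_mono)
    finally show ?thesis using iw by simp
  qed
  thus ?thesis using c unfolding slab_L1_def by blast
qed

lemma slab_L1_mult:
  assumes "slab_L2 a b w" "slab_L2 a b z"
  shows "slab_L1 a b (\<lambda>t x. w t x * z t x)"
proof -
  obtain C where C: "\<And>t. t \<in> {a..b} \<Longrightarrow> (\<forall>x. \<bar>w t x\<bar> \<le> C) \<and> w t \<in> L2 \<and> sqnorm (w t) \<le> C"
    using assms(1) unfolding slab_L2_def by blast
  obtain D where D: "\<And>t. t \<in> {a..b} \<Longrightarrow> (\<forall>x. \<bar>z t x\<bar> \<le> D) \<and> z t \<in> L2 \<and> sqnorm (z t) \<le> D"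
    using assms(2) unfolding slab_L2_def by blast
  have "continuous_on UNIV (\<lambda>p. (\<lambda>(t, x). w t x) p * (\<lambda>(t, x). z t x) p)"
    using assms unfolding slab_L2_def by (intro continuous_on_mult) auto
  moreover have "integrable lborel (\<lambda>x. w t x * z t x) \<and> (\<integral>x. \<bar>w t x * z t x\<bar> \<partial>lborel) \<le> sqrt C * sqrt D"
    if t: "t \<in> {a..b}" for t
  proof -
    have L: "w t \<in> L2" "z t \<in> L2" using C[OF t] D[OF t] by auto
    have "sqrt (sqnorm (w t)) * sqrt (sqnorm (z t)) \<le> sqrt C * sqrt D"
      using C[OF t] D[OF t] by (intro mult_mono) (auto intro: order_trans[OF sqnorm_nonneg])
    thus ?thesis using L2_integrable_mult[OF L] Cauchy_Schwarz(1)[OF L] by linarith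
  qed
  ultimately show ?thesis unfolding slab_L1_def case_prod_unfold by blast
qed

lemma slab_L1_add:
  assumes "slab_L1 a b w" "slab_L1 a b z"
  shows "slab_L1 a b (\<lambda>t x. w t x + z t x)"
proof -
  obtain C where C: "\<And>t. t \<in> {a..b} \<Longrightarrow> integrable lborel (w t) \<and> (\<integral>x. \<bar>w t x\<bar> \<partial>lborel) \<le> C"
    using assms(1) unfolding slab_L1_def by blast
  obtain D where D: "\<And>t. t \<in> {a..b} \<Longrightarrow> integrable lborel (z t) \<and> (\<integral>x. \<bar>z t x\<bar> \<partial>lborel) \<le> D"
    using assms(2) unfolding slab_L1_def by blast
  have "continuous_on UNIV (\<lambda>p. (\<lambda>(t, x). w t x) p + (\<lambda>(t, x). z t x) p)"
    using assms unfolding slab_L1_def by (intro continuous_on_add) auto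
  moreover have "integrable lborel (\<lambda>x. w t x + z t x) \<and> (\<integral>x. \<bar>w t x + z t x\<bar> \<partial>lborel) \<le> C + D"
    if t: "t \<in> {a..b}" for t
  proof -
    have i: "integrable lborel (w t)" "integrable lborel (z t)" using C[OF t] D[OF t] by auto
    have "(\<integral>x. \<bar>w t x + z t x\<bar> \<partial>lborel) \<le> (\<integral>x. \<bar>w t x\<bar> + \<bar>z t x\<bar> \<partial>lborel)"
      using i by (intro integral_mono) auto
    also have "\<dots> \<le> C + D" using i C[OF t] D[OF t] by simp
    finally show ?thesis using i by simp
  qed
  ultimately show ?thesis unfolding slab_L1_def case_prod_unfold by blast
qed

lemma slab_L1_weight:
  assumes "slab_L1 a b w" "continuous_on UNIV \<phi>" "\<And>x. \<bar>\<phi> x\<bar> \<le> C"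
  shows "slab_L1 a b (\<lambda>t x. \<phi> x * w t x)"
proof (rule slab_L1_dominated[OF assms(1), of _ C])
  have "continuous_on UNIV (\<lambda>p. \<phi> (snd p) * (\<lambda>(t, x). w t x) p)"
    using assms(1) unfolding slab_L1_def
    by (intro continuous_on_mult continuous_on_compose2[OF assms(2)] continuous_intros) auto
  thus "continuous_on UNIV (\<lambda>(t, x). \<phi> x * w t x)" by (simp add: split_beta)
  show "\<bar>\<phi> x * w t x\<bar> \<le> C * \<bar>w t x\<bar>" for t x
    using assms(3)[of x] by (simp add: abs_mult mult_right_mono)
qed

lemma slab_L1_cmult: "slab_L1 a b w \<Longrightarrow> slab_L1 a b (\<lambda>t x. c * w t x)"
  using slab_L1_weight[of a b w "\<lambda>_. c" "\<bar>c\<bar>"] by simp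

lemma slab_L1_diff: "slab_L1 a b w \<Longrightarrow> slab_L1 a b z \<Longrightarrow> slab_L1 a b (\<lambda>t x. w t x - z t x)"
  using slab_L1_add[of a b w "\<lambda>t x. (-1) * z t x"] slab_L1_cmult[of a b z "-1"] by simp

lemma slab_continuous_compose:
  assumes "continuous_on UNIV (\<lambda>(t, x). w t x)" "continuous_on UNIV (f :: real \<Rightarrow> real)"
  shows "continuous_on UNIV (\<lambda>(t, x). f (w t x))"
  using continuous_on_compose2[OF assms(2,1)] by (simp add: split_beta)

lemma slab_L1_compose_quadratic:
  assumes w: "slab_L2 a b w" and F: "continuous_on UNIV F"
    and le: "\<And>t x. t \<in> {a..b} \<Longrightarrow> \<bar>F (w t x)\<bar> \<le> C * (w t x)\<^sup>2"
  shows "slab_L1 a b (\<lambda>t x. F (w t x))"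
proof (rule slab_L1_dominated[OF slab_L1_mult[OF w w]])
  have "continuous_on UNIV (\<lambda>(t, x). w t x)" using w unfolding slab_L2_def by blast
  thus "continuous_on UNIV (\<lambda>(t, x). F (w t x))" by (rule slab_continuous_compose[OF _ F])
  show "\<bar>F (w t x)\<bar> \<le> C * \<bar>w t x * w t x\<bar>" if "t \<in> {a..b}" for t x
    using le[OF that, of x] by (simp add: power2_eq_square)
qed

lemma slab_L2_compose:
  assumes w: "slab_L2 a b w" and F: "continuous_on UNIV F"
    and le: "\<And>t x. t \<in> {a..b} \<Longrightarrow> \<bar>F (w t x)\<bar> \<le> K * \<bar>w t x\<bar>"
  shows "slab_L2 a b (\<lambda>t x. F (w t x))"
proof -
  obtain C where C: "\<And>t. t \<in> {a..b} \<Longrightarrow> (\<forall>x. \<bar>w t x\<bar> \<le> C) \<and> w t \<in> L2 \<and> sqnorm (w t) \<le> C"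
    using w unfolding slab_L2_def by blast
  have "continuous_on UNIV (\<lambda>(t, x). w t x)" using w unfolding slab_L2_def by blast
  hence c: "continuous_on UNIV (\<lambda>(t, x). F (w t x))" by (rule slab_continuous_compose[OF _ F])
  have "(\<forall>x. \<bar>F (w t x)\<bar> \<le> max (\<bar>K\<bar> * C) (K\<^sup>2 * C)) \<and> (\<lambda>x. F (w t x)) \<in> L2 \<and> sqnorm (\<lambda>x. F (w t x))
      \<le> max (\<bar>K\<bar> * C) (K\<^sup>2 * C)"
    if t: "t \<in> {a..b}" for t
  proof (intro conjI allI)
    have m: "(\<lambda>x. F (w t x)) \<in> borel_measurable borel"
      by (rule borel_measurable_continuous_onI) (rule continuous_slice(1)[OF c])
    have le': "AE x in lborel. \<bar>F (w t x)\<bar> \<le> K * \<bar>w t x\<bar>" using le[OF t] by simp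
    have wL: "w t \<in> L2" using C[OF t] by simp
    show "(\<lambda>x. F (w t x)) \<in> L2" by (rule L2_cmult_bound(1)[OF m wL le'])
    have "sqnorm (\<lambda>x. F (w t x)) \<le> K\<^sup>2 * sqnorm (w t)" by (rule L2_cmult_bound(2)[OF m wL le'])
    also have "\<dots> \<le> K\<^sup>2 * C" using C[OF t] by (intro mult_left_mono) auto
    finally show "sqnorm (\<lambda>x. F (w t x)) \<le> max (\<bar>K\<bar> * C) (K\<^sup>2 * C)" by simp
    fix x
    have "\<bar>F (w t x)\<bar> \<le> K * \<bar>w t x\<bar>" by (rule le[OF t])
    also have "\<dots> \<le> \<bar>K\<bar> * C" using C[OF t] by (intro mult_mono) auto
    finally show "\<bar>F (w t x)\<bar> \<le> max (\<bar>K\<bar> * C) (K\<^sup>2 * C)" by simp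
  qed
  thus ?thesis using c unfolding slab_L2_def by blast
qed

definition L2_continuous :: "(real \<Rightarrow> real \<Rightarrow> real) \<Rightarrow> bool" where
  "L2_continuous g \<longleftrightarrow> (\<forall>t. g t \<in> L2) \<and> (\<forall>s. ((\<lambda>t. sqnorm (\<lambda>x. g t x - g s x)) \<longlongrightarrow> 0) (at s))"

lemma L2_continuous_sqnorm:
  assumes "L2_continuous g" shows "continuous_on S (\<lambda>t. sqnorm (g t))"
proof -
  have "isCont (\<lambda>t. sqnorm (g t)) s" for s
    unfolding isCont_def by (rule tendsto_sqnorm) (use assms in \<open>auto simp: L2_continuous_def\<close>)
  thus ?thesis by (simp add: continuous_at_imp_continuous_on)
qed

lemma slab_L2_conv:
  assumes g: "L2_continuous g" and t: "test_function \<kappa>"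
  shows "slab_L2 a b (\<lambda>t. conv (g t) \<kappa>)"
proof -
  have gL: "g s \<in> L2" for s using g by (simp add: L2_continuous_def)
  have cont: "isCont (\<lambda>(t, x). conv (g t) \<kappa> x) (s, y)" for s y
  proof -
    have lim: "((\<lambda>p. sqrt (sqnorm (\<lambda>x. g (fst p) x - g s x)) * sqrt (sqnorm \<kappa>))
        \<longlongrightarrow> sqrt 0 * sqrt (sqnorm \<kappa>)) (at (s, y))"
    proof (intro tendsto_intros)
      have "isCont (\<lambda>t. sqnorm (\<lambda>x. g t x - g s x)) s"
        using g by (auto simp: L2_continuous_def isCont_def sqnorm_def)
      hence "isCont (\<lambda>p. sqnorm (\<lambda>x. g (fst p) x - g s x)) (s, y)"
        using isCont_o2[of "(s, y)" fst "\<lambda>t. sqnorm (\<lambda>x. g t x - g s x)"] by (auto intro: continuous_intros)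
      thus "((\<lambda>p. sqnorm (\<lambda>x. g (fst p) x - g s x)) \<longlongrightarrow> 0) (at (s, y))"
        by (simp add: isCont_def sqnorm_def)
    qed
    have 1: "((\<lambda>p. conv (g (fst p)) \<kappa> (snd p) - conv (g s) \<kappa> (snd p)) \<longlongrightarrow> 0) (at (s, y))"
    proof (rule Lim_null_comparison[OF always_eventually], rule allI)
      fix p :: "real \<times> real"
      show "norm (conv (g (fst p)) \<kappa> (snd p) - conv (g s) \<kappa> (snd p))
          \<le> sqrt (sqnorm (\<lambda>x. g (fst p) x - g s x)) * sqrt (sqnorm \<kappa>)"
        using conv_bound[OF L2_diff[OF gL gL] t, of "fst p" s "snd p"] by (simp add: conv_diff[OF gL gL t])
    qed (use lim in simp)
    have "isCont (conv (g s) \<kappa>) y" by (rule DERIV_isCont[OF DERIV_conv[OF gL t]])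
    hence "isCont (\<lambda>p. conv (g s) \<kappa> (snd p)) (s, y)"
      using isCont_o2[of "(s, y)" snd "conv (g s) \<kappa>"] by (auto intro: continuous_intros)
    hence 2: "((\<lambda>p. conv (g s) \<kappa> (snd p)) \<longlongrightarrow> conv (g s) \<kappa> y) (at (s, y))" by (simp add: isCont_def)
    show ?thesis using tendsto_add[OF 1 2] by (simp add: isCont_def case_prod_unfold)
  qed
  have "compact ((\<lambda>t. sqnorm (g t)) ` {a..b})"
    by (intro compact_continuous_image L2_continuous_sqnorm g) simp
  hence "bounded ((\<lambda>t. sqnorm (g t)) ` {a..b})" by (rule compact_imp_bounded)
  then obtain D where D: "\<forall>y\<in>(\<lambda>t. sqnorm (g t)) ` {a..b}. norm y \<le> D"
    unfolding bounded_iff by (rule exE)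
  define E where "E = (\<integral>x. \<bar>\<kappa> x\<bar> \<partial>lborel)\<^sup>2"
  define C where "C = max (sqrt \<bar>D\<bar> * sqrt (sqnorm \<kappa>)) (E * \<bar>D\<bar>)"
  have "(\<forall>x. \<bar>conv (g t) \<kappa> x\<bar> \<le> C) \<and> conv (g t) \<kappa> \<in> L2 \<and> sqnorm (conv (g t) \<kappa>) \<le> C" if "t \<in> {a..b}" for t
  proof (intro conjI allI)
    have D': "sqnorm (g t) \<le> \<bar>D\<bar>" using D that by force
    show "conv (g t) \<kappa> \<in> L2" by (rule conv_L2(1)[OF gL \<open>test_function \<kappa>\<close>])
    have "sqnorm (conv (g t) \<kappa>) \<le> E * sqnorm (g t)"
      unfolding E_def by (rule conv_L2(2)[OF gL \<open>test_function \<kappa>\<close>])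
    also have "\<dots> \<le> E * \<bar>D\<bar>" using D' by (intro mult_left_mono) (auto simp: E_def)
    finally show "sqnorm (conv (g t) \<kappa>) \<le> C" by (simp add: C_def)
    fix x
    have "\<bar>conv (g t) \<kappa> x\<bar> \<le> sqrt (sqnorm (g t)) * sqrt (sqnorm \<kappa>)"
      by (rule conv_bound[OF gL \<open>test_function \<kappa>\<close>])
    also have "\<dots> \<le> sqrt \<bar>D\<bar> * sqrt (sqnorm \<kappa>)" using D' by (intro mult_right_mono) auto
    finally show "\<bar>conv (g t) \<kappa> x\<bar> \<le> C" by (simp add: C_def)
  qed
  moreover have "continuous_on UNIV (\<lambda>(t, x). conv (g t) \<kappa> x)"
    using cont by (intro continuous_at_imp_continuous_on) auto
  ultimately show ?thesis unfolding slab_L2_def by blast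
qed

text \<open>The integral is the limit of \<open>G r - G (- r)\<close> as \<open>r\<close> tends to infinity. A nonzero limit would contradict
  the integrability of this difference.\<close>
lemma integral_derivative_eq_0:
  fixes G :: "real \<Rightarrow> real"
  assumes D: "\<And>x. (G has_real_derivative G' x) (at x)" and c: "continuous_on UNIV G'"
    and i: "integrable lborel G" "integrable lborel G'"
  shows "(\<integral>x. G' x \<partial>lborel) = 0"
proof (rule ccontr)
  define c where "c = \<bar>\<integral>x. G' x \<partial>lborel\<bar> / 2"
  assume "\<not> ?thesis"
  hence cpos: "c > 0" by (simp add: c_def)
  have [measurable]: "G' \<in> borel_measurable borel" using i(2) by auto
  have "((\<lambda>r. \<integral>x. G' x * indicator {-r..r} x \<partial>lborel) \<longlongrightarrow> (\<integral>x. G' x \<partial>lborel)) at_top"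
  proof (rule integral_dominated_convergence_at_top[where w="\<lambda>x. \<bar>G' x\<bar>"])
    show "AE x in lborel. ((\<lambda>r. G' x * indicator {-r..r} x) \<longlongrightarrow> G' x) at_top"
    proof (rule AE_I2)
      fix x
      have "\<forall>\<^sub>F r in at_top. G' x * indicator {-r..r} x = G' x"
        using eventually_ge_at_top[of "\<bar>x\<bar>"] by eventually_elim (auto simp: indicator_def)
      thus "((\<lambda>r. G' x * indicator {-r..r} x) \<longlongrightarrow> G' x) at_top" by (rule tendsto_eventually)
    qed
    show "\<forall>\<^sub>F r in at_top. AE x in lborel. norm (G' x * indicator {-r..r} x) \<le> \<bar>G' x\<bar>"
      by (auto simp: indicator_def)
  qed (use i in auto)
  hence lim: "((\<lambda>r. \<bar>\<integral>x. G' x * indicator {-r..r} x \<partial>lborel\<bar>) \<longlongrightarrow> 2 * c) at_top"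
    unfolding c_def using tendsto_rabs by fastforce
  have "\<forall>\<^sub>F r in at_top. \<bar>\<integral>x. G' x * indicator {-r..r} x \<partial>lborel\<bar> > c"
    using order_tendstoD(1)[OF lim, of c] cpos by simp
  moreover have "\<forall>\<^sub>F r in at_top. (\<integral>x. G' x * indicator {-r..r} x \<partial>lborel) = G r - G (- r)"
    using eventually_ge_at_top[of 0]
  proof eventually_elim
    case (elim r)
    show ?case by (rule integral_FTC_Icc_real[OF _ D])
        (use elim c in \<open>auto simp: continuous_on_eq_continuous_at\<close>)
  qed
  ultimately have "\<forall>\<^sub>F r in at_top. \<bar>G r - G (- r)\<bar> > c" by eventually_elim simp
  then obtain X where X: "\<And>r. r \<ge> X \<Longrightarrow> \<bar>G r - G (- r)\<bar> > c" unfolding eventually_at_top_linorder by blast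
  have iH: "integrable lborel (\<lambda>r. \<bar>G r - G (- r)\<bar>)"
    using i(1) integral_reflect_shift(2)[of G 0] by auto
  obtain n :: nat where n: "(\<integral>r. \<bar>G r - G (- r)\<bar> \<partial>lborel) / c < n" using reals_Archimedean2 by blast
  have "c * n = (\<integral>r. c * indicator {X..X + n} r \<partial>lborel)" by simp
  also have "\<dots> \<le> (\<integral>r. \<bar>G r - G (- r)\<bar> \<partial>lborel)"
  proof (rule integral_mono[OF _ iH])
    show "integrable lborel (\<lambda>r. c * indicator {X..X + real n} r)"
      by (intro integrable_mult_right integrable_indicator_Icc)
    show "c * indicator {X..X + real n} r \<le> \<bar>G r - G (- r)\<bar>" for r
      using X[of r] by (auto simp: indicator_def)
  qed
  finally show False using n cpos by (simp add: field_simps)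
qed

text \<open>For a density \<open>A\<close> with flux \<open>Q\<close> and source \<open>R\<close>, integrate in time at each fixed \<open>x\<close>, exchange the order
  of integration, and use that the integral over space of the derivative of the flux vanishes.\<close>
lemma integrated_conservation_law:
  assumes ab: "a \<le> b"
    and dA: "\<And>t x. t \<in> {a..b} \<Longrightarrow> ((\<lambda>t. A t x) has_real_derivative DQ t x + R t x) (at t)"
    and dQ: "\<And>t x. t \<in> {a..b} \<Longrightarrow> (Q t has_real_derivative DQ t x) (at x)"
    and s: "slab_L1 a b A" "slab_L1 a b Q" "slab_L1 a b DQ" "slab_L1 a b R"
  shows "integrable lborel (\<lambda>t. (\<integral>x. R t x \<partial>lborel) * indicator {a..b} t)"
    and "(\<integral>x. A b x \<partial>lborel) - (\<integral>x. A a x \<partial>lborel) = (\<integral>t. (\<integral>x. R t x \<partial>lborel) * indicator {a..b} t \<partial>lborel)"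
proof -
  define P where "P t x = (DQ t x + R t x) * indicator {a..b} t" for t x
  have cc: "continuous_on UNIV (\<lambda>(t, x). DQ t x)" "continuous_on UNIV (\<lambda>(t, x). R t x)"
    using s by (auto simp: slab_L1_def)
  have [measurable]: "(\<lambda>(t, x). DQ t x) \<in> borel_measurable (borel \<Otimes>\<^sub>M borel)"
      "(\<lambda>(t, x). R t x) \<in> borel_measurable (borel \<Otimes>\<^sub>M borel)"
    using cc by (simp_all add: borel_prod borel_measurable_continuous_onI)
  obtain C where C: "\<And>t. t \<in> {a..b}
      \<Longrightarrow> integrable lborel (\<lambda>x. DQ t x + R t x) \<and> (\<integral>x. \<bar>DQ t x + R t x\<bar> \<partial>lborel) \<le> C"
    using slab_L1_add[OF s(3,4)] unfolding slab_L1_def by blast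
  have [measurable]: "case_prod P \<in> borel_measurable (lborel \<Otimes>\<^sub>M lborel)"
    unfolding P_def by (simp add: split_beta)
  have iP: "integrable (lborel \<Otimes>\<^sub>M lborel) (\<lambda>(t, x). P t x)"
  proof (rule lborel_pair.Fubini_integrable)
    show "integrable lborel (\<lambda>t. \<integral>x. norm (case (t, x) of (t, x) \<Rightarrow> P t x) \<partial>lborel)"
    proof (rule Bochner_Integration.integrable_bound)
      show "integrable lborel (\<lambda>t. C * indicator {a..b} t)"
        by (intro integrable_mult_right integrable_indicator_Icc)
      have "(\<integral>x. \<bar>P t x\<bar> \<partial>lborel) \<le> \<bar>C * indicator {a..b} t\<bar>" for t
        using C[of t] by (auto simp: P_def indicator_def)
      thus "AE t in lborel. norm (\<integral>x. norm (case (t, x) of (t, x) \<Rightarrow> P t x) \<partial>lborel)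
          \<le> norm (C * indicator {a..b} t)"
        by simp
    qed simp
    show "AE t in lborel. integrable lborel (\<lambda>x. case (t, x) of (t, x) \<Rightarrow> P t x)"
      using C by (auto simp: P_def indicator_def)
  qed simp
  have inner: "(\<integral>x. P t x \<partial>lborel) = (\<integral>x. R t x \<partial>lborel) * indicator {a..b} t" for t
  proof (cases "t \<in> {a..b}")
    case True
    have i: "integrable lborel (Q t)" "integrable lborel (DQ t)" "integrable lborel (R t)"
      using True s unfolding slab_L1_def by auto
    have "(\<integral>x. DQ t x \<partial>lborel) = 0"
      by (rule integral_derivative_eq_0[OF dQ[OF True] continuous_slice(1)[OF cc(1)] i(1,2)])
    thus ?thesis using True i by (simp add: P_def)
  qed (simp add: P_def)
  show "integrable lborel (\<lambda>t. (\<integral>x. R t x \<partial>lborel) * indicator {a..b} t)"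
    using lborel_pair.integrable_fst[OF iP] by (simp add: inner)
  have "(\<integral>x. \<integral>t. P t x \<partial>lborel \<partial>lborel) = (\<integral>t. (\<integral>x. R t x \<partial>lborel) * indicator {a..b} t \<partial>lborel)"
    using lborel_pair.Fubini_integral[OF iP] by (simp add: inner)
  moreover have "(\<integral>t. P t x \<partial>lborel) = A b x - A a x" for x
    unfolding P_def
  proof (rule integral_FTC_Icc_real[OF ab])
    show "((\<lambda>t. A t x) has_real_derivative DQ t x + R t x) (at t)" if "a \<le> t" "t \<le> b" for t
      using dA that by simp
    show "isCont (\<lambda>t. DQ t x + R t x) t" for t
      using continuous_slice(2)[OF cc(1), of UNIV x] continuous_slice(2)[OF cc(2), of UNIV x]
      by (intro continuous_intros) (auto simp: continuous_on_eq_continuous_at)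
  qed
  moreover have "integrable lborel (A b)" "integrable lborel (A a)" using s(1) ab unfolding slab_L1_def by auto
  ultimately show "(\<integral>x. A b x \<partial>lborel) - (\<integral>x. A a x \<partial>lborel)
      = (\<integral>t. (\<integral>x. R t x \<partial>lborel) * indicator {a..b} t \<partial>lborel)"
    by simp
qed

lemma slab_L1_integrable_time:
  assumes z: "slab_L1 a b z"
  shows "integrable lborel (\<lambda>t. (\<integral>x. z t x \<partial>lborel) * indicator {a..b} t)"
proof -
  have c: "continuous_on UNIV (\<lambda>(t, x). z t x)" using z unfolding slab_L1_def by blast
  have [measurable]: "(\<lambda>(t, x). z t x) \<in> borel_measurable (borel \<Otimes>\<^sub>M borel)"
    using c by (simp add: borel_prod borel_measurable_continuous_onI)
  obtain C where C: "\<And>t. t \<in> {a..b} \<Longrightarrow> (\<integral>x. \<bar>z t x\<bar> \<partial>lborel) \<le> C"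
    using z unfolding slab_L1_def by blast
  show ?thesis
  proof (rule Bochner_Integration.integrable_bound)
    show "integrable lborel (\<lambda>t. C * indicator {a..b} t)"
      by (intro integrable_mult_right integrable_indicator_Icc)
    have "\<bar>(\<integral>x. z t x \<partial>lborel) * indicator {a..b} t\<bar> \<le> \<bar>C * indicator {a..b} t\<bar>" for t
    proof (cases "t \<in> {a..b}")
      case True
      have "\<bar>\<integral>x. z t x \<partial>lborel\<bar> \<le> C" by (rule order_trans[OF integral_abs_bound C[OF True]])
      thus ?thesis using True by simp
    qed simp
    thus "AE t in lborel. norm ((\<integral>x. z t x \<partial>lborel) * indicator {a..b} t) \<le> norm (C * indicator {a..b} t)"
      by simp
  qed simp
qed

section \<open>Energy and virial inequalities for the regularised system\<close>

text \<open>In the application \<open>v0, \<dots>, v3\<close> and \<open>w0, w1, w2\<close> are the mollifications of \<open>u\<^sub>1\<close> and \<open>u\<^sub>2\<close> and their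
  derivatives in \<open>x\<close>, and \<open>N1\<close> is the derivative in \<open>x\<close> of the mollification of \<open>f u\<^sub>1\<close>. The bound \<open>1 / 16\<close>
  on \<open>f'\<close> is small enough for the nonlinear terms to be absorbed in both inequalities below.\<close>
locale regularised_system =
  fixes v0 v1 v2 v3 w0 w1 w2 N1 :: "real \<Rightarrow> real \<Rightarrow> real" and f f' F :: "real \<Rightarrow> real" and a b s0 :: real
  assumes dx: "\<And>t x. (v0 t has_real_derivative v1 t x) (at x)" "\<And>t x. (v1 t has_real_derivative v2 t x) (at x)"
      "\<And>t x. (v2 t has_real_derivative v3 t x) (at x)" "\<And>t x. (w0 t has_real_derivative w1 t x) (at x)"
      "\<And>t x. (w1 t has_real_derivative w2 t x) (at x)"
    and dt: "\<And>t x. ((\<lambda>t. v0 t x) has_real_derivative w1 t x) (at t)"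
        "\<And>t x. ((\<lambda>t. v1 t x) has_real_derivative w2 t x) (at t)"
      "\<And>t x. ((\<lambda>t. w0 t x) has_real_derivative v1 t x - v3 t x - N1 t x) (at t)"
    and slab: "slab_L2 a b v0" "slab_L2 a b v1" "slab_L2 a b v2" "slab_L2 a b v3"
      "slab_L2 a b w0" "slab_L2 a b w1" "slab_L2 a b w2" "slab_L2 a b N1"
    and df: "\<And>s. (f has_real_derivative f' s) (at s)" "\<And>s. (F has_real_derivative f s) (at s)"
        "continuous_on UNIV f'"
    and f0: "f 0 = 0" "F 0 = 0"
    and small: "\<And>s. \<bar>s\<bar> \<le> s0 \<Longrightarrow> \<bar>f' s\<bar> \<le> 1 / 16" "\<And>t x. t \<in> {a..b} \<Longrightarrow> \<bar>v0 t x\<bar> \<le> s0"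
    and ab: "a \<le> b"
begin

lemma f_bound: "\<bar>s\<bar> \<le> s0 \<Longrightarrow> \<bar>f s\<bar> \<le> 1 / 16 * \<bar>s\<bar>"
  and F_bound: "\<bar>s\<bar> \<le> s0 \<Longrightarrow> \<bar>F s\<bar> \<le> 1 / 16 * s\<^sup>2"
proof -
  have *: "\<bar>f s\<bar> \<le> 1 / 16 * \<bar>s\<bar>" if s: "\<bar>s\<bar> \<le> s0" for s
  proof -
    have "\<bar>f s - f 0\<bar> \<le> 1 / 16 * \<bar>s - 0\<bar>"
      by (rule Lipschitz_on_interval[OF df(1) small(1)]) (use s in auto)
    thus ?thesis using f0 by simp
  qed
  show "\<bar>f s\<bar> \<le> 1 / 16 * \<bar>s\<bar>" if "\<bar>s\<bar> \<le> s0" by (rule *[OF that])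
  show "\<bar>F s\<bar> \<le> 1 / 16 * s\<^sup>2" if s: "\<bar>s\<bar> \<le> s0"
  proof -
    have "\<bar>F s - F 0\<bar> \<le> 1 / 16 * \<bar>s\<bar> * \<bar>s - 0\<bar>"
    proof (rule Lipschitz_on_interval[OF df(2)])
      fix z assume z: "\<bar>z\<bar> \<le> \<bar>s\<bar>"
      hence "\<bar>z\<bar> \<le> s0" using s by simp
      from *[OF this] z show "\<bar>f z\<bar> \<le> 1 / 16 * \<bar>s\<bar>" by simp
    qed auto
    thus ?thesis using f0 by (simp add: power2_eq_square flip: abs_mult)
  qed
qed

definition residual :: "real \<Rightarrow> real \<Rightarrow> real" where
  "residual t x = f' (v0 t x) * v1 t x - N1 t x"

lemma f_continuous: "continuous_on S f" and F_continuous: "continuous_on S F"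
  by (rule DERIV_continuous_on[where D=f']; rule DERIV_subset[OF df(1)]; simp)
     (rule DERIV_continuous_on[where D=f]; rule DERIV_subset[OF df(2)]; simp)

lemma slab_f: "slab_L2 a b (\<lambda>t x. f (v0 t x))"
  by (rule slab_L2_compose[OF slab(1) f_continuous, of "1 / 16"]) (rule f_bound[OF small(2)])

lemma slab_F: "slab_L1 a b (\<lambda>t x. F (v0 t x))"
  by (rule slab_L1_compose_quadratic[OF slab(1) F_continuous, of "1 / 16"]) (rule F_bound[OF small(2)])

lemma slab_f':
  assumes "slab_L1 a b z" shows "slab_L1 a b (\<lambda>t x. f' (v0 t x) * z t x)"
proof (rule slab_L1_dominated[OF assms, of _ "1 / 16"])
  have "continuous_on UNIV (\<lambda>(t, x). v0 t x)" "continuous_on UNIV (\<lambda>(t, x). z t x)"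
    using slab(1) assms unfolding slab_L2_def slab_L1_def by blast+
  from continuous_on_mult[OF slab_continuous_compose[OF this(1) df(3)] this(2)]
  show "continuous_on UNIV (\<lambda>(t, x). f' (v0 t x) * z t x)" by (simp add: case_prod_unfold)
  show "\<bar>f' (v0 t x) * z t x\<bar> \<le> 1 / 16 * \<bar>z t x\<bar>" if "t \<in> {a..b}" for t x
    unfolding abs_mult by (rule mult_right_mono[OF small(1)[OF small(2)[OF that]]]) simp
qed

lemmas slab_intros = slab_L1_add slab_L1_diff slab_L1_cmult slab_L1_mult slab slab_f slab_F slab_f'

definition total :: "real \<Rightarrow> real" where
  "total t = sqnorm (v0 t) + sqnorm (v1 t) + sqnorm (w0 t)"

lemma slice_L2:
  assumes "t \<in> {a..b}" shows "v0 t \<in> L2" "v1 t \<in> L2" "w0 t \<in> L2"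
  using assms slab(1,2,5) unfolding slab_L2_def by auto

text \<open>The only source term in the balance law of the energy density is \<open>w0\<close> times the residual, that is, the
  failure of mollification to commute with the nonlinearity. The coefficients are \<open>1/2 - 1/16\<close> and
  \<open>1/2 + 1/16\<close>, where \<open>1/16\<close> bounds the part of \<open>F\<close>.\<close>
lemma energy_inequality:
  assumes c: "\<And>t. t \<in> {a..b} \<Longrightarrow> (\<integral>x. \<bar>w0 t x * residual t x\<bar> \<partial>lborel) \<le> c"
  shows "7 / 16 * total b \<le> 9 / 16 * total a + c * (b - a)"
proof -
  define E where "E t x = 1/2 * (w0 t x * w0 t x) + 1/2 * (v1 t x * v1 t x) + 1/2 * (v0 t x * v0 t x)
      - F (v0 t x)" for t x
  define Q where "Q t x = v0 t x * w0 t x - w0 t x * v2 t x + v1 t x * w1 t x - w0 t x * f (v0 t x)" for t x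
  define DQ where "DQ t x = v1 t x * w0 t x + v0 t x * w1 t x - w0 t x * v3 t x + v1 t x * w2 t x
       - w1 t x * f (v0 t x) - f' (v0 t x) * (w0 t x * v1 t x)" for t x
  define R where "R t x = f' (v0 t x) * (w0 t x * v1 t x) - w0 t x * N1 t x" for t x
  have R_eq: "R t x = w0 t x * residual t x" for t x by (simp add: R_def residual_def algebra_simps)
  have cons: "integrable lborel (\<lambda>t. (\<integral>x. R t x \<partial>lborel) * indicator {a..b} t)"
    "(\<integral>x. E b x \<partial>lborel) - (\<integral>x. E a x \<partial>lborel) = (\<integral>t. (\<integral>x. R t x \<partial>lborel) * indicator {a..b} t \<partial>lborel)"
  proof -
    have 1: "((\<lambda>t. E t x) has_real_derivative DQ t x + R t x) (at t)" for t x
      unfolding E_def DQ_def R_def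
      by (rule derivative_eq_intros dt DERIV_chain2[OF df(2)] refl)+ (simp add: algebra_simps)
    have 2: "(Q t has_real_derivative DQ t x) (at x)" for t x
      unfolding Q_def[abs_def] DQ_def
      by (rule derivative_eq_intros dx DERIV_chain2[OF df(1)] refl)+ (simp add: algebra_simps)
    have 3: "slab_L1 a b E" unfolding E_def[abs_def] by (intro slab_intros)
    have 4: "slab_L1 a b Q" unfolding Q_def[abs_def] by (intro slab_intros)
    have 5: "slab_L1 a b DQ" unfolding DQ_def[abs_def] by (intro slab_intros)
    have 6: "slab_L1 a b R" unfolding R_def[abs_def] by (intro slab_intros)
    show "integrable lborel (\<lambda>t. (\<integral>x. R t x \<partial>lborel) * indicator {a..b} t)"
      "(\<integral>x. E b x \<partial>lborel) - (\<integral>x. E a x \<partial>lborel) = (\<integral>t. (\<integral>x. R t x \<partial>lborel) * indicator {a..b} t \<partial>lborel)"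
      using integrated_conservation_law[OF ab 1 2 3 4 5 6] by blast+
  qed
  have "(\<integral>t. (\<integral>x. R t x \<partial>lborel) * indicator {a..b} t \<partial>lborel) \<le> (\<integral>t. c * indicator {a..b} t \<partial>lborel)"
  proof (rule integral_mono[OF cons(1)])
    show "integrable lborel (\<lambda>t. c * indicator {a..b} t)"
      by (intro integrable_mult_right integrable_indicator_Icc)
    show "(\<integral>x. R t x \<partial>lborel) * indicator {a..b} t \<le> c * indicator {a..b} t" for t
    proof (cases "t \<in> {a..b}")
      case True
      have "\<bar>\<integral>x. R t x \<partial>lborel\<bar> \<le> c"
        unfolding R_eq by (rule order_trans[OF integral_abs_bound c[OF True]])
      thus ?thesis using True by simp
    qed simp
  qed
  also have "\<dots> = c * (b - a)" using ab by simp
  finally have main: "(\<integral>x. E b x \<partial>lborel) \<le> (\<integral>x. E a x \<partial>lborel) + c * (b - a)" using cons(2) by simp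
  have split: "(\<integral>x. E t x \<partial>lborel) = 1/2 * total t - (\<integral>x. F (v0 t x) \<partial>lborel)"
    and Fle: "\<bar>\<integral>x. F (v0 t x) \<partial>lborel\<bar> \<le> 1 / 16 * total t" if t: "t \<in> {a..b}" for t
  proof -
    note L = slice_L2[OF t, THEN L2D(2)]
    have iF: "integrable lborel (\<lambda>x. F (v0 t x))" using slab_F t unfolding slab_L1_def by auto
    show "(\<integral>x. E t x \<partial>lborel) = 1/2 * total t - (\<integral>x. F (v0 t x) \<partial>lborel)"
      unfolding E_def total_def sqnorm_def using L iF by (simp add: power2_eq_square)
    have "\<bar>\<integral>x. F (v0 t x) \<partial>lborel\<bar> \<le> (\<integral>x. 1 / 16 * (v0 t x)\<^sup>2 \<partial>lborel)"
      by (rule integral_abs_bound[THEN order_trans], rule integral_mono)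
         (use iF L F_bound[OF small(2)[OF t]] in auto)
    also have "\<dots> = 1 / 16 * sqnorm (v0 t)" by (simp add: sqnorm_def)
    also have "\<dots> \<le> 1 / 16 * total t" by (simp add: total_def)
    finally show "\<bar>\<integral>x. F (v0 t x) \<partial>lborel\<bar> \<le> 1 / 16 * total t" .
  qed
  have "a \<in> {a..b}" "b \<in> {a..b}" using ab by auto
  from split[OF this(1)] split[OF this(2)] Fle[OF this(1)] Fle[OF this(2)] main
  show ?thesis by linarith
qed

definition sech2_energy :: "real \<Rightarrow> real \<Rightarrow> real" where
  "sech2_energy lam t = (\<integral>x. (1 - (tanh (x / lam))\<^sup>2) * (v0 t x * v0 t x + v1 t x * v1 t x
      + w0 t x * w0 t x) \<partial>lborel)"

text \<open>This is the virial identity for the weight \<open>\<phi> x = lam * tanh (x / lam)\<close>, whose derivative is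
  \<open>sech\<^sup>2 (x / lam)\<close>. Dispersion and transport contribute with a definite sign; the third derivative of
  \<open>\<phi>\<close> is \<open>O(lam\<^sup>-\<^sup>2)\<close> times the first, and the nonlinear term is quadratic with a small constant, so
  both are absorbed.\<close>
lemma virial_inequality:
  assumes lam: "lam \<ge> 4"
    and c: "\<And>t. t \<in> {a..b} \<Longrightarrow> integrable lborel (residual t)"
      "\<And>t. t \<in> {a..b} \<Longrightarrow> (\<integral>x. \<bar>residual t x\<bar> \<partial>lborel) \<le> c"
  shows "integrable lborel (\<lambda>t. sech2_energy lam t * indicator {a..b} t)"
    and "(\<integral>t. sech2_energy lam t * indicator {a..b} t \<partial>lborel)
        \<le> 2 * lam * (total a + total b) + 4 * lam * s0 * c * (b - a)"
proof -
  define T where "T x = tanh (x / lam)" for x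
  define p0 where "p0 x = lam * T x" for x
  define p1 where "p1 x = 1 - (T x)\<^sup>2" for x
  define p2 where "p2 x = - 2 / lam * T x * (1 - (T x)\<^sup>2)" for x
  define p3 where "p3 x = (1 - (T x)\<^sup>2) * (6 * (T x)\<^sup>2 - 2) / lam\<^sup>2" for x
  define G where "G s = s * f s - F s" for s
  have T1: "\<bar>T x\<bar> \<le> 1" for x unfolding T_def using tanh_real_bounds[of "x / lam"] by auto
  have T2: "0 \<le> (T x)\<^sup>2" "(T x)\<^sup>2 \<le> 1" for x using T1[of x] by (auto simp: abs_square_le_1)
  have dT: "(T has_real_derivative (1 - (T x)\<^sup>2) / lam) (at x)" for x
    unfolding T_def[abs_def] using lam
    by (auto intro!: derivative_eq_intros simp: field_simps)
  have dp: "(p0 has_real_derivative p1 x) (at x)" "(p1 has_real_derivative p2 x) (at x)"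
      "(p2 has_real_derivative p3 x) (at x)" for x
    unfolding p0_def[abs_def] p1_def[abs_def] p2_def[abs_def] p3_def
    by (rule derivative_eq_intros dT refl | use lam in \<open>simp add: field_simps power2_eq_square\<close>)+
  have dG: "(G has_real_derivative s * f' s) (at s)" for s
    unfolding G_def[abs_def] by (rule derivative_eq_intros df refl)+ simp
  have cT: "continuous_on UNIV T" by (rule DERIV_continuous_on) (rule DERIV_subset[OF dT], simp)
  have cp: "continuous_on UNIV p0" "continuous_on UNIV p1" "continuous_on UNIV p2" "continuous_on UNIV p3"
    unfolding p0_def p1_def p2_def p3_def using lam by (intro continuous_intros cT; simp)+
  have b1: "0 \<le> p1 x" "p1 x \<le> 1" for x using T2[of x] by (auto simp: p1_def)
  have b0: "\<bar>p0 x\<bar> \<le> lam" for x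
    using mult_left_mono[OF T1[of x], of lam] lam by (simp add: p0_def abs_mult)
  have b2: "\<bar>p2 x\<bar> \<le> 2" for x
  proof -
    have "\<bar>T x\<bar> * \<bar>1 - (T x)\<^sup>2\<bar> \<le> 1 * 1" using T1[of x] T2[of x] by (intro mult_mono) auto
    hence "2 / lam * (\<bar>T x\<bar> * \<bar>1 - (T x)\<^sup>2\<bar>) \<le> 2 * 1" using lam by (intro mult_mono) (auto simp: field_simps)
    thus ?thesis using lam by (simp add: p2_def abs_mult mult.assoc)
  qed
  have b3': "\<bar>p3 x\<bar> \<le> 1 / 4 * p1 x" for x
  proof -
    have l2: "16 \<le> lam\<^sup>2" using power_mono[OF lam, of 2] by simp
    have "\<bar>6 * (T x)\<^sup>2 - 2\<bar> \<le> 4" using T2[of x] unfolding abs_le_iff by linarith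
    hence "\<bar>6 * (T x)\<^sup>2 - 2\<bar> / lam\<^sup>2 \<le> 4 / 16"
      using l2 by (intro frac_le) auto
    hence "p1 x * (\<bar>6 * (T x)\<^sup>2 - 2\<bar> / lam\<^sup>2) \<le> p1 x * (4 / 16)"
      using b1(1) by (rule mult_left_mono)
    moreover have "\<bar>p3 x\<bar> = p1 x * (\<bar>6 * (T x)\<^sup>2 - 2\<bar> / lam\<^sup>2)"
      using b1(1)[of x] by (simp add: p3_def p1_def abs_mult)
    ultimately show ?thesis by simp
  qed
  have b3: "\<bar>p3 x\<bar> \<le> 1" for x using b3'[of x] b1[of x] by linarith
  have b1': "\<bar>p1 x\<bar> \<le> 1" for x using b1[of x] by simp
  have Gb: "\<bar>G s\<bar> \<le> 1 / 8 * s\<^sup>2" if "\<bar>s\<bar> \<le> s0" for s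
  proof -
    have "\<bar>s * f s\<bar> \<le> \<bar>s\<bar> * (1 / 16 * \<bar>s\<bar>)"
      unfolding abs_mult by (intro mult_left_mono f_bound that) simp
    also have "\<dots> = 1 / 16 * s\<^sup>2" by (simp add: power2_eq_square flip: abs_mult)
    finally show ?thesis
      using F_bound[OF that] abs_triangle_ineq4[of "s * f s" "F s"] unfolding G_def by linarith
  qed
  have cG: "continuous_on UNIV G" by (rule DERIV_continuous_on) (rule DERIV_subset[OF dG], simp)
  have slab_G: "slab_L1 a b (\<lambda>t x. G (v0 t x))"
    by (rule slab_L1_compose_quadratic[OF slab(1) cG, of "1 / 8"]) (rule Gb[OF small(2)])
  note w0 = slab_L1_weight[OF _ cp(1) b0] and w1 = slab_L1_weight[OF _ cp(2) b1']
    and w2 = slab_L1_weight[OF _ cp(3) b2] and w3 = slab_L1_weight[OF _ cp(4) b3]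
  define I where "I t x = p0 x * (v0 t x * w0 t x)" for t x
  \<comment> \<open>\<open>R\<close> is what remains of the time derivative of \<open>I\<close> after all integrations
    by parts; \<open>Q\<close> collects their boundary terms.\<close>
  define Q where "Q t x = 1/2 * (p0 x * (w0 t x * w0 t x)) + 1/2 * (p0 x * (v0 t x * v0 t x))
      - p0 x * (v0 t x * v2 t x)
      + 1/2 * (p0 x * (v1 t x * v1 t x)) + p1 x * (v0 t x * v1 t x) - 1/2 * (p2 x * (v0 t x * v0 t x))
          - p0 x * G (v0 t x)" for t x
  define DQ where "DQ t x = 1/2 * (p1 x * (w0 t x * w0 t x)) + p0 x * (w0 t x * w1 t x)
      + 1/2 * (p1 x * (v0 t x * v0 t x))
      + p0 x * (v0 t x * v1 t x) - p0 x * (v0 t x * v3 t x) + 3/2 * (p1 x * (v1 t x * v1 t x))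
          - 1/2 * (p3 x * (v0 t x * v0 t x))
      - p1 x * G (v0 t x) - p0 x * (f' (v0 t x) * (v0 t x * v1 t x))" for t x
  define R where "R t x = 1/2 * (p3 x * (v0 t x * v0 t x)) - 1/2 * (p1 x * (w0 t x * w0 t x))
      - 1/2 * (p1 x * (v0 t x * v0 t x))
      - 3/2 * (p1 x * (v1 t x * v1 t x)) + p1 x * G (v0 t x) + p0 x * (f' (v0 t x) * (v0 t x * v1 t x))
          - p0 x * (v0 t x * N1 t x)" for t x
  define Y where "Y t x = p1 x * (v0 t x * v0 t x + v1 t x * v1 t x + w0 t x * w0 t x)" for t x
  have sech2: "sech2_energy lam t = (\<integral>x. Y t x \<partial>lborel)" for t
    by (simp add: sech2_energy_def Y_def p1_def T_def)
  have slab_Y: "slab_L1 a b Y" unfolding Y_def[abs_def] by (intro w1 slab_intros)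
  have cons: "integrable lborel (\<lambda>t. (\<integral>x. R t x \<partial>lborel) * indicator {a..b} t)"
    "(\<integral>x. I b x \<partial>lborel) - (\<integral>x. I a x \<partial>lborel) = (\<integral>t. (\<integral>x. R t x \<partial>lborel) * indicator {a..b} t \<partial>lborel)"
    and slab_I: "slab_L1 a b I" and slab_R: "slab_L1 a b R"
  proof -
    have 1: "((\<lambda>t. I t x) has_real_derivative DQ t x + R t x) (at t)" for t x
      unfolding I_def DQ_def R_def
      by (rule derivative_eq_intros dt refl)+ (simp add: algebra_simps)
    have 2: "(Q t has_real_derivative DQ t x) (at x)" for t x
      unfolding Q_def[abs_def] DQ_def
      by (rule derivative_eq_intros dx dp DERIV_chain2[OF dG] refl)+ (simp add: algebra_simps)
    show 3: "slab_L1 a b I" unfolding I_def[abs_def] by (intro w0 slab_intros)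
    have 4: "slab_L1 a b Q" unfolding Q_def[abs_def]
      by (intro slab_L1_add slab_L1_diff slab_L1_cmult w0 w1 w2 slab_G slab_L1_mult slab)
    have 5: "slab_L1 a b DQ" unfolding DQ_def[abs_def]
      by (intro slab_L1_add slab_L1_diff slab_L1_cmult w0 w1 w3 slab_G slab_f' slab_L1_mult slab)
    show 6: "slab_L1 a b R" unfolding R_def[abs_def]
      by (intro slab_L1_add slab_L1_diff slab_L1_cmult w0 w1 w3 slab_G slab_f' slab_L1_mult slab)
    show "integrable lborel (\<lambda>t. (\<integral>x. R t x \<partial>lborel) * indicator {a..b} t)"
      "(\<integral>x. I b x \<partial>lborel) - (\<integral>x. I a x \<partial>lborel) = (\<integral>t. (\<integral>x. R t x \<partial>lborel) * indicator {a..b} t \<partial>lborel)"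
      using integrated_conservation_law[OF ab 1 2 3 4 5 6] by blast+
  qed
  show iY: "integrable lborel (\<lambda>t. sech2_energy lam t * indicator {a..b} t)"
    unfolding sech2 by (rule slab_L1_integrable_time[OF slab_Y])
  \<comment> \<open>Of the coefficient \<open>1/2\<close> in front of \<open>v0\<^sup>2\<close>, \<open>1/8\<close> is spent on \<open>p3\<close> and \<open>1/8\<close> on \<open>G\<close>.\<close>
  have pw: "R t x \<le> - (1 / 4) * Y t x + lam * s0 * \<bar>residual t x\<bar>" if t: "t \<in> {a..b}" for t x
  proof -
    have v: "\<bar>v0 t x\<bar> \<le> s0" by (rule small(2)[OF t])
    have "\<bar>p0 x * v0 t x\<bar> \<le> lam * s0"
      unfolding abs_mult using b0 v lam by (intro mult_mono) auto
    hence "\<bar>p0 x * v0 t x\<bar> * \<bar>residual t x\<bar> \<le> lam * s0 * \<bar>residual t x\<bar>" by (rule mult_right_mono) simp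
    hence "p0 x * v0 t x * residual t x \<le> lam * s0 * \<bar>residual t x\<bar>"
      unfolding abs_mult[symmetric] by linarith
    moreover have "p1 x * G (v0 t x) \<le> p1 x * (1 / 8 * (v0 t x * v0 t x))"
      using Gb[OF v] b1(1)[of x] by (intro mult_left_mono) (auto simp: power2_eq_square)
    moreover have "p3 x * (v0 t x * v0 t x) \<le> 1 / 4 * p1 x * (v0 t x * v0 t x)"
      using b3'[of x] by (intro mult_right_mono) auto
    moreover have "0 \<le> p1 x * (v1 t x * v1 t x)" "0 \<le> p1 x * (w0 t x * w0 t x)" "0 \<le> p1 x * (v0 t x * v0 t x)"
      using b1(1)[of x] by auto
    moreover have "R t x = 1/2 * (p3 x * (v0 t x * v0 t x)) - 1/2 * (p1 x * (w0 t x * w0 t x))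
        - 1/2 * (p1 x * (v0 t x * v0 t x))
      - 3/2 * (p1 x * (v1 t x * v1 t x)) + p1 x * G (v0 t x) + p0 x * v0 t x * residual t x"
      by (simp add: R_def residual_def algebra_simps)
    moreover have "Y t x = p1 x * (v0 t x * v0 t x) + p1 x * (v1 t x * v1 t x) + p1 x * (w0 t x * w0 t x)"
      by (simp add: Y_def algebra_simps)
    ultimately show ?thesis by (simp add: algebra_simps)
  qed
  have s0: "s0 \<ge> 0" using small(2)[of a 0] ab by auto
  have tm: "(\<integral>x. R t x \<partial>lborel) \<le> - (1 / 4) * sech2_energy lam t + lam * s0 * c" if t: "t \<in> {a..b}" for t
  proof -
    have iY': "integrable lborel (Y t)" and iR: "integrable lborel (R t)"
      using slab_Y slab_R t unfolding slab_L1_def by auto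
    have "(\<integral>x. R t x \<partial>lborel) \<le> (\<integral>x. - (1 / 4) * Y t x + lam * s0 * \<bar>residual t x\<bar> \<partial>lborel)"
      using iY' c(1)[OF t] by (intro integral_mono[OF iR] pw[OF t]) auto
    also have "\<dots> = - (1 / 4) * sech2_energy lam t + lam * s0 * (\<integral>x. \<bar>residual t x\<bar> \<partial>lborel)"
      using iY' c(1)[OF t] by (simp add: sech2)
    also have "\<dots> \<le> - (1 / 4) * sech2_energy lam t + lam * s0 * c"
      using c(2)[OF t] s0 lam by (intro add_left_mono mult_left_mono) auto
    finally show ?thesis .
  qed
  have ic: "integrable lborel (\<lambda>t. lam * s0 * c * indicator {a..b} t)"
    by (intro integrable_mult_right integrable_indicator_Icc)
  have "(\<integral>t. (\<integral>x. R t x \<partial>lborel) * indicator {a..b} t \<partial>lborel)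
      \<le> (\<integral>t. - (1 / 4) * (sech2_energy lam t * indicator {a..b} t) + lam * s0 * c * indicator {a..b} t \<partial>lborel)"
    using iY ic by (intro integral_mono[OF cons(1)]) (use tm in \<open>auto simp: indicator_def\<close>)
  also have "\<dots> = - (1 / 4) * (\<integral>t. sech2_energy lam t * indicator {a..b} t \<partial>lborel) + lam * s0 * c * (b - a)"
    using iY ic ab by simp
  finally have main: "1 / 4 * (\<integral>t. sech2_energy lam t * indicator {a..b} t \<partial>lborel)
      \<le> (\<integral>x. I a x \<partial>lborel) - (\<integral>x. I b x \<partial>lborel) + lam * s0 * c * (b - a)"
    using cons(2) by simp
  have Ib: "\<bar>\<integral>x. I t x \<partial>lborel\<bar> \<le> lam / 2 * total t" if t: "t \<in> {a..b}" for t
  proof -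
    note L = slice_L2[OF t, THEN L2D(2)]
    have iI: "integrable lborel (I t)" using slab_I t unfolding slab_L1_def by auto
    have "\<bar>I t x\<bar> \<le> lam / 2 * ((v0 t x)\<^sup>2 + (w0 t x)\<^sup>2)" for x
    proof -
      have "\<bar>I t x\<bar> \<le> lam * (\<bar>v0 t x\<bar> * \<bar>w0 t x\<bar>)"
        unfolding I_def abs_mult by (intro mult_right_mono b0) auto
      also have "\<dots> \<le> lam * (((v0 t x)\<^sup>2 + (w0 t x)\<^sup>2) / 2)"
        using sum_squares_bound[of "\<bar>v0 t x\<bar>" "\<bar>w0 t x\<bar>"] lam by (intro mult_left_mono) auto
      finally show ?thesis by simp
    qed
    hence "\<bar>\<integral>x. I t x \<partial>lborel\<bar> \<le> (\<integral>x. lam / 2 * ((v0 t x)\<^sup>2 + (w0 t x)\<^sup>2) \<partial>lborel)"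
      using iI L by (intro integral_abs_bound[THEN order_trans] integral_mono) auto
    also have "\<dots> = lam / 2 * (sqnorm (v0 t) + sqnorm (w0 t))" using L by (simp add: sqnorm_def)
    also have "\<dots> \<le> lam / 2 * total t" using lam by (intro mult_left_mono) (auto simp: total_def)
    finally show ?thesis .
  qed
  have ab': "a \<in> {a..b}" "b \<in> {a..b}" using ab by auto
  have "(\<integral>x. I a x \<partial>lborel) - (\<integral>x. I b x \<partial>lborel) \<le> lam / 2 * total a + lam / 2 * total b"
    using Ib[OF ab'(1)] Ib[OF ab'(2)] by linarith
  with main show "(\<integral>t. sech2_energy lam t * indicator {a..b} t \<partial>lborel)
      \<le> 2 * lam * (total a + total b) + 4 * lam * s0 * c * (b - a)"
    by (simp add: algebra_simps)
qed

end

section \<open>Small solutions\<close>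

locale boussinesq_solution = approximate_identity k A B for k A B +
  fixes f :: "real \<Rightarrow> real" and u1 u2 :: "real \<Rightarrow> real \<Rightarrow> real"
  assumes sf: "smooth f" and f0: "f 0 = 0" and sol: "energy_solution f u1 u2"
begin

definition ux :: "real \<Rightarrow> real \<Rightarrow> real" where "ux t = wderiv (u1 t)"

definition norm_sq :: "real \<Rightarrow> real" where
  "norm_sq t = sqnorm (u1 t) + sqnorm (ux t) + sqnorm (u2 t)"

lemma energy_norm_eq: "energy_norm (u1 t) (u2 t) = sqrt (norm_sq t)"
  by (simp add: energy_norm_def norm_sq_def ux_def sqnorm_def)

lemma norm_sq_nonneg: "norm_sq t \<ge> 0"
  by (simp add: norm_sq_def)

lemma in_spaces: "u1 t \<in> H1" "u1 t \<in> L2" "ux t \<in> L2" "u2 t \<in> L2" "has_weak_deriv (u1 t) (ux t)"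
proof -
  show u: "u1 t \<in> H1" "u2 t \<in> L2"
    using sol by (auto simp: energy_solution_def energy_continuous_def)
  show "u1 t \<in> L2" "ux t \<in> L2" "has_weak_deriv (u1 t) (ux t)"
    using H1D[OF u(1)] by (auto simp: ux_def)
qed

lemma L2_continuous_solution: "L2_continuous u1" "L2_continuous ux" "L2_continuous u2"
proof -
  define d where "d s t = energy_norm (\<lambda>x. u1 t x - u1 s x) (\<lambda>x. u2 t x - u2 s x)" for s t
  have d0: "((\<lambda>t. (d s t)\<^sup>2) \<longlongrightarrow> 0) (at s)" for s
  proof -
    have "(d s \<longlongrightarrow> 0) (at s)"
      using sol unfolding d_def energy_solution_def energy_continuous_def by blast
    from tendsto_power[OF this, of 2] show ?thesis by simp
  qed
  have eq: "(d s t)\<^sup>2 = sqnorm (\<lambda>x. u1 t x - u1 s x) + sqnorm (\<lambda>x. ux t x - ux s x) + sqnorm (\<lambda>x. u2 t x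
      - u2 s x)" for s t
    using wderiv_diff(2)[OF in_spaces(1) in_spaces(1), of t s]
    by (simp add: d_def energy_norm_def ux_def sqnorm_def)
  have sq: "((\<lambda>t. z s t) \<longlongrightarrow> 0) (at s)" if "\<And>t. 0 \<le> z s t" "\<And>t. z s t \<le> (d s t)\<^sup>2"
      for z :: "real \<Rightarrow> real \<Rightarrow> real" and s
    by (rule Lim_null_comparison[OF always_eventually d0]) (use that in auto)
  show "L2_continuous u1" "L2_continuous ux" "L2_continuous u2"
    unfolding L2_continuous_def
    using sq[of "\<lambda>s t. sqnorm (\<lambda>x. u1 t x - u1 s x)"] sq[of "\<lambda>s t. sqnorm (\<lambda>x. ux t x - ux s x)"]
      sq[of "\<lambda>s t. sqnorm (\<lambda>x. u2 t x - u2 s x)"] in_spaces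
    by (auto simp: eq)
qed

lemma norm_sq_continuous: "continuous_on S norm_sq"
  unfolding norm_sq_def[abs_def]
  by (intro continuous_intros L2_continuous_sqnorm L2_continuous_solution)

lemma u1_AE_bound: "norm_sq t \<le> M\<^sup>2 \<Longrightarrow> M \<ge> 0 \<Longrightarrow> AE x in lborel. \<bar>u1 t x\<bar> \<le> M"
proof -
  assume M: "norm_sq t \<le> M\<^sup>2" "M \<ge> 0"
  have "sqrt (sqnorm (u1 t) + sqnorm (ux t)) \<le> M"
    using M sqnorm_nonneg[of "u2 t"] unfolding norm_sq_def by (intro real_le_lsqrt) linarith+
  thus ?thesis using H1_AE_bound[OF in_spaces(2,3,5), of t] by (auto elim!: eventually_mono)
qed

lemma df: "(f has_real_derivative deriv f s) (at s)" "(deriv f has_real_derivative deriv (deriv f) s) (at s)"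
  using smooth_imp_DERIV[OF sf] smooth_imp_DERIV[OF smooth_deriv[OF sf]] .

text \<open>For times near \<open>s\<close> the solution takes almost all its values in a fixed bounded interval, and there
  \<open>f\<close> is Lipschitz.\<close>
lemma L2_continuous_nonlinearity: "L2_continuous (\<lambda>t x. f (u1 t x))"
proof -
  have fm: "f \<in> borel_measurable borel"
    by (rule borel_measurable_continuous_onI[OF smooth_continuous_on[OF sf]])
  have L: "(\<lambda>x. f (u1 t x)) \<in> L2" for t
  proof -
    obtain K where K: "\<And>s. \<bar>s\<bar> \<le> sqrt (norm_sq t) \<Longrightarrow> \<bar>deriv f s\<bar> \<le> K"
      using continuous_bounded_on_interval[OF smooth_continuous_on[OF smooth_deriv[OF sf]]] by blast
    have "AE x in lborel. \<bar>u1 t x\<bar> \<le> sqrt (norm_sq t)" by (rule u1_AE_bound) (use norm_sq_nonneg in auto)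
    from L2_compose[OF in_spaces(2) this df(1) f0 K] show ?thesis by simp
  qed
  moreover have "((\<lambda>t. sqnorm (\<lambda>x. f (u1 t x) - f (u1 s x))) \<longlongrightarrow> 0) (at s)" for s
  proof -
    define M where "M = sqrt (norm_sq s + 1)"
    have M: "M \<ge> 0" "M\<^sup>2 = norm_sq s + 1" using norm_sq_nonneg[of s] by (auto simp: M_def)
    obtain K where K: "\<And>s. \<bar>s\<bar> \<le> M \<Longrightarrow> \<bar>deriv f s\<bar> \<le> K"
      using continuous_bounded_on_interval[OF smooth_continuous_on[OF smooth_deriv[OF sf]]] by blast
    have "isCont norm_sq s" using norm_sq_continuous[of UNIV] by (simp add: continuous_on_eq_continuous_at)
    hence "(norm_sq \<longlongrightarrow> norm_sq s) (at s)" by (simp add: isCont_def)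
    hence ev: "\<forall>\<^sub>F t in at s. norm_sq t < norm_sq s + 1" by (rule order_tendstoD) simp
    have lim: "((\<lambda>t. K\<^sup>2 * sqnorm (\<lambda>x. u1 t x - u1 s x)) \<longlongrightarrow> K\<^sup>2 * 0) (at s)"
      using L2_continuous_solution(1) by (intro tendsto_intros) (simp add: L2_continuous_def)
    show ?thesis
    proof (rule Lim_null_comparison)
      show "((\<lambda>t. K\<^sup>2 * sqnorm (\<lambda>x. u1 t x - u1 s x)) \<longlongrightarrow> 0) (at s)" using lim by simp
      show "\<forall>\<^sub>F t in at s. norm (sqnorm (\<lambda>x. f (u1 t x) - f (u1 s x))) \<le> K\<^sup>2 * sqnorm (\<lambda>x. u1 t x - u1 s x)"
        using ev
      proof eventually_elim
        case (elim t)
        have ae: "AE x in lborel. \<bar>u1 t x\<bar> \<le> M" "AE x in lborel. \<bar>u1 s x\<bar> \<le> M"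
          by (rule u1_AE_bound; use M elim in simp)+
        hence "AE x in lborel. \<bar>f (u1 t x) - f (u1 s x)\<bar> \<le> K * \<bar>u1 t x - u1 s x\<bar>"
          by eventually_elim (rule Lipschitz_on_interval[OF df(1) K])
        from L2_cmult_bound(2)[OF L2D(1)[OF L2_diff[OF L L]] L2_diff[OF in_spaces(2) in_spaces(2)] this]
        show ?case by simp
      qed
    qed
  qed
  ultimately show ?thesis by (simp add: L2_continuous_def)
qed

lemma dt_conv_u1:
  assumes t: "test_function \<kappa>"
  shows "((\<lambda>t. conv (u1 t) \<kappa> x) has_real_derivative conv (u2 t) (deriv \<kappa>) x) (at t)"
proof -
  have "((\<lambda>\<tau>. \<integral>y. u1 \<tau> y * \<kappa> (x - y) \<partial>lborel) has_real_derivative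
           - (\<integral>y. u2 t y * deriv (\<lambda>y. \<kappa> (x - y)) y \<partial>lborel)) (at t)"
    using sol test_function_reflect[OF t, of x] unfolding energy_solution_def by blast
  thus ?thesis using deriv_reflect[OF t, of 1 x] by (simp add: conv_def[abs_def])
qed

lemma dt_conv_u2:
  assumes t: "test_function \<kappa>"
  shows "((\<lambda>t. conv (u2 t) \<kappa> x) has_real_derivative
     conv (u1 t) (deriv \<kappa>) x - conv (u1 t) ((deriv ^^ 3) \<kappa>) x - conv (\<lambda>x. f (u1 t x)) (deriv \<kappa>) x) (at t)"
proof -
  have fL: "(\<lambda>x. f (u1 t x)) \<in> L2" using L2_continuous_nonlinearity by (simp add: L2_continuous_def)
  have "((\<lambda>\<tau>. \<integral>y. u2 \<tau> y * \<kappa> (x - y) \<partial>lborel) has_real_derivative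
           - ((\<integral>y. (u1 t y - f (u1 t y)) * deriv (\<lambda>y. \<kappa> (x - y)) y \<partial>lborel)
              - (\<integral>y. u1 t y * (deriv ^^ 3) (\<lambda>y. \<kappa> (x - y)) y \<partial>lborel))) (at t)"
    using sol test_function_reflect[OF t, of x] unfolding energy_solution_def by blast
  moreover have "deriv (\<lambda>y. \<kappa> (x - y)) = (\<lambda>y. - deriv \<kappa> (x - y))"
    using deriv_reflect[OF t, of 1 x] by simp
  moreover have "(deriv ^^ 3) (\<lambda>y. \<kappa> (x - y)) = (\<lambda>y. - (deriv ^^ 3) \<kappa> (x - y))"
    using deriv_reflect[OF t, of 3 x] by simp
  moreover have "(\<integral>y. (u1 t y - f (u1 t y)) * deriv \<kappa> (x - y) \<partial>lborel)
      = conv (u1 t) (deriv \<kappa>) x - conv (\<lambda>x. f (u1 t x)) (deriv \<kappa>) x"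
    using conv_diff[OF in_spaces(2) fL test_function_deriv[OF t], of t x] by (simp add: conv_def)
  ultimately have "((\<lambda>t. conv (u2 t) \<kappa> x) has_real_derivative
     conv (u1 t) (deriv \<kappa>) x - conv (\<lambda>x. f (u1 t x)) (deriv \<kappa>) x - conv (u1 t) ((deriv ^^ 3) \<kappa>) x) (at t)"
    by (simp add: conv_def[abs_def])
  thus ?thesis by (rule DERIV_cong) simp
qed

abbreviation V :: "real \<Rightarrow> nat \<Rightarrow> real \<Rightarrow> real \<Rightarrow> real" where
  "V \<delta> n t \<equiv> conv (u1 t) ((deriv ^^ n) (k \<delta>))"

abbreviation W :: "real \<Rightarrow> nat \<Rightarrow> real \<Rightarrow> real \<Rightarrow> real" where
  "W \<delta> n t \<equiv> conv (u2 t) ((deriv ^^ n) (k \<delta>))"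

abbreviation NL :: "real \<Rightarrow> real \<Rightarrow> real \<Rightarrow> real" where
  "NL \<delta> t \<equiv> conv (\<lambda>x. f (u1 t x)) (deriv (k \<delta>))"

lemma V1_eq: "\<delta> > 0 \<Longrightarrow> V \<delta> 1 t = conv (ux t) (k \<delta>)"
  using conv_weak_deriv[OF in_spaces(5) test_k] by auto

end

locale small_boussinesq = boussinesq_solution k A B f u1 u2 for k A B f u1 u2 +
  fixes F :: "real \<Rightarrow> real" and s0 K :: real
  assumes F: "\<And>s. (F has_real_derivative f s) (at s)" "F 0 = 0"
    and s0: "s0 > 0" and f'_small: "\<And>s. \<bar>s\<bar> \<le> s0 \<Longrightarrow> \<bar>deriv f s\<bar> \<le> 1 / 16"
    and f''_bound: "\<And>s. \<bar>s\<bar> \<le> s0 \<Longrightarrow> \<bar>deriv (deriv f) s\<bar> \<le> K"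
begin

lemma K_nonneg: "K \<ge> 0" using f''_bound[of 0] s0 by auto

context
  fixes a b :: real
  assumes ab: "a \<le> b" and norm_sq_small: "\<And>t. t \<in> {a..b} \<Longrightarrow> norm_sq t \<le> s0\<^sup>2"
begin

lemma regularised:
  assumes \<delta>: "\<delta> > 0"
  shows "regularised_system (V \<delta> 0) (V \<delta> 1) (V \<delta> 2) (V \<delta> 3) (W \<delta> 0) (W \<delta> 1) (W \<delta> 2) (NL \<delta>) f (deriv f) F a b s0"
proof -
  have tk: "test_function ((deriv ^^ n) (k \<delta>))" for n by (rule test_function_deriv_funpow[OF test_k[OF \<delta>]])
  have dV: "(V \<delta> n t has_real_derivative V \<delta> (Suc n) t x) (at x)"
    and dW: "(W \<delta> n t has_real_derivative W \<delta> (Suc n) t x) (at x)" for n t x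
    using DERIV_conv[OF in_spaces(2) tk] DERIV_conv[OF in_spaces(4) tk] by simp_all
  have tV: "((\<lambda>t. V \<delta> n t x) has_real_derivative W \<delta> (Suc n) t x) (at t)" for n t x
    using dt_conv_u1[OF tk] by simp
  have tW: "((\<lambda>t. W \<delta> 0 t x) has_real_derivative V \<delta> 1 t x - V \<delta> 3 t x - NL \<delta> t x) (at t)" for t x
    using dt_conv_u2[OF test_k[OF \<delta>]] by simp
  have sV: "slab_L2 a b (V \<delta> n)" and sW: "slab_L2 a b (W \<delta> n)" for n
    by (rule slab_L2_conv[OF L2_continuous_solution(1) tk]) (rule slab_L2_conv[OF L2_continuous_solution(3) tk])
  have sN: "slab_L2 a b (NL \<delta>)"
    by (rule slab_L2_conv[OF L2_continuous_nonlinearity test_deriv_k[OF \<delta>]])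
  have small: "\<bar>V \<delta> 0 t x\<bar> \<le> s0" if t: "t \<in> {a..b}" for t x
  proof -
    have "\<bar>V \<delta> 0 t x\<bar> \<le> sqrt (sqnorm (u1 t) + sqnorm (ux t))"
      using conv_k_Sobolev[OF in_spaces(2,3,5) \<delta>] by simp
    also have "\<dots> \<le> sqrt (s0\<^sup>2)"
      using norm_sq_small[OF t] sqnorm_nonneg[of "u2 t"] unfolding norm_sq_def
          by (intro real_sqrt_le_mono) linarith
    finally show ?thesis using s0 by simp
  qed
  note n = numeral_2_eq_2 numeral_3_eq_3 One_nat_def
  show ?thesis
  proof
    show "(V \<delta> 0 t has_real_derivative V \<delta> 1 t x) (at x)" "(V \<delta> 1 t has_real_derivative V \<delta> 2 t x) (at x)"
      "(V \<delta> 2 t has_real_derivative V \<delta> 3 t x) (at x)" "(W \<delta> 0 t has_real_derivative W \<delta> 1 t x) (at x)"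
      "(W \<delta> 1 t has_real_derivative W \<delta> 2 t x) (at x)" for t x
      unfolding n by (rule dV dW)+
    show "((\<lambda>t. V \<delta> 0 t x) has_real_derivative W \<delta> 1 t x) (at t)"
        "((\<lambda>t. V \<delta> 1 t x) has_real_derivative W \<delta> 2 t x) (at t)" for t x
      unfolding n by (rule tV)+
  qed (rule tW sV sW sN df F f0 f'_small small smooth_continuous_on smooth_deriv sf ab; assumption?)+
qed

text \<open>The source terms of the two balance laws tend to zero with the width of the mollifier, uniformly in time.
  The factor \<open>sqrt (B / \<delta>)\<close>, a bound for the \<open>L\<^sup>2\<close> norm of \<open>k \<delta>\<close>, is the pointwise cost of mollifying
  the merely square-integrable \<open>u2\<close>.\<close>
lemma residual_bounds:
  assumes \<delta>: "\<delta> > 0" and t: "t \<in> {a..b}"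
  defines "r \<equiv> regularised_system.residual (V \<delta> 0) (V \<delta> 1) (NL \<delta>) (deriv f) t"
  shows "integrable lborel r" "(\<integral>x. \<bar>r x\<bar> \<partial>lborel) \<le> 4 * K * A * s0\<^sup>2 * \<delta>"
    "(\<integral>x. \<bar>W \<delta> 0 t x * r x\<bar> \<partial>lborel) \<le> 4 * K * A * s0 ^ 3 * sqrt B * sqrt \<delta>"
proof -
  interpret R: regularised_system "V \<delta> 0" "V \<delta> 1" "V \<delta> 2" "V \<delta> 3" "W \<delta> 0" "W \<delta> 1" "W \<delta> 2"
      "NL \<delta>" f "deriv f" F a b s0
    by (rule regularised[OF \<delta>])
  have r: "r x = deriv f (conv (u1 t) (k \<delta>) x) * conv (u1 t) (deriv (k \<delta>)) x - NL \<delta> t x" for x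
    unfolding r_def R.residual_def by simp
  define m where "m = conv (\<lambda>y. (ux t y)\<^sup>2) (indicator {-\<delta>..\<delta>})"
  have m: "integrable lborel m" "(\<integral>x. m x \<partial>lborel) = 2 * \<delta> * sqnorm (ux t)"
    unfolding m_def using integral_commutator_bound[OF in_spaces(3) \<delta>] by auto
  have fL: "(\<lambda>x. f (u1 t x)) \<in> L2" using L2_continuous_nonlinearity by (simp add: L2_continuous_def)
  have ub: "AE x in lborel. \<bar>u1 t x\<bar> \<le> s0" using u1_AE_bound[OF norm_sq_small[OF t]] s0 by simp
  have pw: "\<bar>r x\<bar> \<le> 2 * K * A * m x" for x
    unfolding r m_def
    by (rule commutator_pointwise[where f''="deriv (deriv f)", OF in_spaces(2,3,5) \<delta> fL ub df f''_bound])
  have [measurable]: "r \<in> borel_measurable borel"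
  proof (rule borel_measurable_continuous_onI)
    have "continuous_on UNIV (\<lambda>x. deriv f (conv (u1 t) (k \<delta>) x))"
      by (rule continuous_on_compose2[OF smooth_continuous_on[OF smooth_deriv[OF sf], of UNIV]])
         (auto intro!: conv_continuous in_spaces test_k \<delta>)
    thus "continuous_on UNIV r" unfolding r[abs_def]
      by (intro continuous_on_diff continuous_on_mult conv_continuous in_spaces fL test_deriv_k \<delta>)
  qed
  have mi: "integrable lborel (\<lambda>x. 2 * K * A * m x)" using m by simp
  show i: "integrable lborel r"
    by (rule Bochner_Integration.integrable_bound[OF mi]) (auto intro!: AE_I2 order_trans[OF pw])
  have "(\<integral>x. \<bar>r x\<bar> \<partial>lborel) \<le> (\<integral>x. 2 * K * A * m x \<partial>lborel)"
    by (rule integral_mono[OF integrable_abs[OF i] mi pw])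
  also have "\<dots> = 4 * K * A * \<delta> * sqnorm (ux t)" by (simp add: m)
  also have "\<dots> \<le> 4 * K * A * \<delta> * s0\<^sup>2"
  proof (rule mult_left_mono)
    show "sqnorm (ux t) \<le> s0\<^sup>2"
      using norm_sq_small[OF t] sqnorm_nonneg[of "u2 t"] sqnorm_nonneg[of "u1 t"] unfolding norm_sq_def
          by linarith
  qed (use K_nonneg A_pos \<delta> in auto)
  finally show ri: "(\<integral>x. \<bar>r x\<bar> \<partial>lborel) \<le> 4 * K * A * s0\<^sup>2 * \<delta>" by (simp add: mult_ac)
  have wb: "\<bar>W \<delta> 0 t x\<bar> \<le> s0 * sqrt (B / \<delta>)" for x
  proof -
    have "\<bar>W \<delta> 0 t x\<bar> \<le> sqrt (sqnorm (u2 t)) * sqrt (sqnorm (k \<delta>))"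
      using conv_bound[OF in_spaces(4) test_k[OF \<delta>]] by simp
    also have "\<dots> \<le> s0 * sqrt (B / \<delta>)"
    proof (rule mult_mono)
      show "sqrt (sqnorm (u2 t)) \<le> s0"
        using norm_sq_small[OF t] sqnorm_nonneg[of "ux t"] sqnorm_nonneg[of "u1 t"] s0
        unfolding norm_sq_def by (intro real_le_lsqrt) linarith+
    qed (use sqnorm_k[OF \<delta>] s0 in auto)
    finally show ?thesis .
  qed
  have Wm[measurable]: "W \<delta> 0 t \<in> borel_measurable borel"
    using conv_continuous[OF in_spaces(4) test_k[OF \<delta>]] by (simp add: borel_measurable_continuous_onI)
  have pw2: "\<bar>W \<delta> 0 t x * r x\<bar> \<le> s0 * sqrt (B / \<delta>) * \<bar>r x\<bar>" for x
    unfolding abs_mult by (rule mult_right_mono[OF wb]) simp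
  have ri': "integrable lborel (\<lambda>x. s0 * sqrt (B / \<delta>) * \<bar>r x\<bar>)" using i by simp
  have i2: "integrable lborel (\<lambda>x. \<bar>W \<delta> 0 t x * r x\<bar>)"
  proof (rule Bochner_Integration.integrable_bound[OF ri'])
    show "(\<lambda>x. \<bar>W \<delta> 0 t x * r x\<bar>) \<in> borel_measurable lborel" using Wm by measurable
    show "AE x in lborel. norm \<bar>W \<delta> 0 t x * r x\<bar> \<le> norm (s0 * sqrt (B / \<delta>) * \<bar>r x\<bar>)"
      by (rule AE_I2, unfold real_norm_def abs_idempotent, rule order_trans[OF pw2 abs_ge_self])
  qed
  have "(\<integral>x. \<bar>W \<delta> 0 t x * r x\<bar> \<partial>lborel) \<le> (\<integral>x. s0 * sqrt (B / \<delta>) * \<bar>r x\<bar> \<partial>lborel)"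
    by (rule integral_mono[OF i2 ri' pw2])
  also have "\<dots> \<le> s0 * sqrt (B / \<delta>) * (4 * K * A * s0\<^sup>2 * \<delta>)"
    unfolding integral_mult_right_zero
    by (rule mult_left_mono[OF ri]) (use s0 B_pos \<delta> in auto)
  also have "\<dots> = 4 * K * A * s0 ^ 3 * sqrt B * (\<delta> / sqrt \<delta>)"
    by (simp add: real_sqrt_divide power2_eq_square power3_eq_cube)
  also have "\<delta> / sqrt \<delta> = sqrt \<delta>" using \<delta> by (simp add: real_div_sqrt)
  finally show "(\<integral>x. \<bar>W \<delta> 0 t x * r x\<bar> \<partial>lborel) \<le> 4 * K * A * s0 ^ 3 * sqrt B * sqrt \<delta>" .
qed

end

definition total :: "real \<Rightarrow> real \<Rightarrow> real" where
  "total \<delta> t = sqnorm (V \<delta> 0 t) + sqnorm (V \<delta> 1 t) + sqnorm (W \<delta> 0 t)"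

lemma total_le: "\<delta> > 0 \<Longrightarrow> total \<delta> t \<le> norm_sq t"
  using conv_k_L2(2)[of \<delta>] in_spaces
  unfolding total_def norm_sq_def V1_eq by (intro add_mono) auto

lemma total_tendsto: "((\<lambda>\<delta>. total \<delta> t) \<longlongrightarrow> norm_sq t) (at_right 0)"
proof -
  have ev: "\<forall>\<^sub>F \<delta>::real in at_right 0. \<delta> > 0" by (simp add: eventually_at_right_less)
  have lim: "((\<lambda>\<delta>. sqnorm (conv g (k \<delta>))) \<longlongrightarrow> sqnorm g) (at_right 0)" if "g \<in> L2" for g
    by (rule tendsto_sqnorm[OF _ that conv_k_tendsto[OF that]])
       (use ev in eventually_elim, rule conv_k_L2(1)[OF _ that])
  have "((\<lambda>\<delta>. sqnorm (conv (u1 t) (k \<delta>)) + sqnorm (conv (ux t) (k \<delta>)) + sqnorm (conv (u2 t) (k \<delta>)))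
      \<longlongrightarrow> norm_sq t) (at_right 0)"
    unfolding norm_sq_def by (intro tendsto_intros lim in_spaces)
  thus ?thesis
    by (rule Lim_transform_eventually) (use ev in eventually_elim, simp add: total_def V1_eq del: One_nat_def)
qed

text \<open>The limit of \<open>energy_inequality\<close> as the width of the mollifier tends to zero.\<close>
lemma energy_almost_monotone:
  assumes "a \<le> b" "\<And>t. t \<in> {a..b} \<Longrightarrow> norm_sq t \<le> s0\<^sup>2"
  shows "7 * norm_sq b \<le> 9 * norm_sq a"
proof -
  define c where "c = 4 * K * A * s0 ^ 3 * sqrt B"
  have "7 / 16 * norm_sq b \<le> 9 / 16 * norm_sq a + c * sqrt 0 * (b - a)"
  proof (rule tendsto_le)
    show "((\<lambda>\<delta>. 7 / 16 * total \<delta> b) \<longlongrightarrow> 7 / 16 * norm_sq b) (at_right 0)"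
      "((\<lambda>\<delta>. 9 / 16 * total \<delta> a + c * sqrt \<delta> * (b - a))
          \<longlongrightarrow> 9 / 16 * norm_sq a + c * sqrt 0 * (b - a)) (at_right 0)"
      by (intro tendsto_intros total_tendsto)+
    have "\<forall>\<^sub>F \<delta>::real in at_right 0. \<delta> > 0" by (simp add: eventually_at_right_less)
    thus "\<forall>\<^sub>F \<delta> in at_right 0. 7 / 16 * total \<delta> b \<le> 9 / 16 * total \<delta> a + c * sqrt \<delta> * (b - a)"
    proof eventually_elim
      case (elim \<delta>)
      interpret R: regularised_system "V \<delta> 0" "V \<delta> 1" "V \<delta> 2" "V \<delta> 3" "W \<delta> 0" "W \<delta> 1" "W \<delta> 2"
          "NL \<delta>" f "deriv f" F a b s0
        by (rule regularised[OF assms elim])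
      have "7 / 16 * R.total b \<le> 9 / 16 * R.total a + c * sqrt \<delta> * (b - a)"
        by (rule R.energy_inequality) (unfold c_def, rule residual_bounds(3)[OF assms elim])
      thus ?case by (simp only: total_def R.total_def)
    qed
  qed simp
  thus ?thesis by simp
qed

text \<open>A solution cannot leave the small ball: at a first exit time the energy inequality, valid up to
  that time, contradicts the exit because \<open>9 / 7 < 2\<close>.\<close>
lemma stays_small:
  assumes X0: "norm_sq 0 < \<epsilon>\<^sup>2" and \<epsilon>: "2 * \<epsilon>\<^sup>2 \<le> s0\<^sup>2" and t: "t \<ge> 0"
  shows "norm_sq t \<le> 2 * \<epsilon>\<^sup>2"
proof (rule ccontr)
  assume "\<not> ?thesis"
  hence exit: "norm_sq t > 2 * \<epsilon>\<^sup>2" by simp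
  define S where "S = {s\<in>{0..t}. 2 * \<epsilon>\<^sup>2 \<le> norm_sq s}"
  have "closed S" unfolding S_def
    using continuous_closed_preimage[OF norm_sq_continuous[of "{0..t}"], of "{2 * \<epsilon>\<^sup>2..}"]
    by (simp add: vimage_def Int_def)
  moreover have "bounded S" unfolding S_def by (rule bounded_subset[OF bounded_closed_interval[of 0 t]]) auto
  ultimately have "compact S" by (simp add: compact_eq_bounded_closed)
  moreover have "t \<in> S" using t exit by (simp add: S_def)
  ultimately obtain T where T: "T \<in> S" "\<And>s. s \<in> S \<Longrightarrow> T \<le> s" using compact_attains_inf[of S] by blast
  have T0: "0 \<le> T" "T \<le> t" "2 * \<epsilon>\<^sup>2 \<le> norm_sq T" using T(1) by (auto simp: S_def)
  have before: "norm_sq s \<le> 2 * \<epsilon>\<^sup>2" if s: "0 \<le> s" "s < T" for s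
    using T(2)[of s] s T0 by (force simp: S_def)
  have XT: "norm_sq T \<le> 2 * \<epsilon>\<^sup>2"
  proof (cases "T = 0")
    case True
    have "norm_sq 0 \<le> 2 * \<epsilon>\<^sup>2" using X0 zero_le_power2[of \<epsilon>] by linarith
    thus ?thesis using True by simp
  next
    case False
    hence "T > 0" using T0 by simp
    have "(norm_sq \<longlongrightarrow> norm_sq T) (at_left T)"
      using norm_sq_continuous[of UNIV]
          by (simp add: continuous_on_eq_continuous_at isCont_def filterlim_at_split)
    moreover have "\<forall>\<^sub>F s in at_left T. norm_sq s \<le> 2 * \<epsilon>\<^sup>2"
      using eventually_at_left_real[OF \<open>T > 0\<close>] by eventually_elim (use before in auto)
    ultimately show ?thesis by (rule tendsto_upperbound) simp
  qed
  have "7 * norm_sq T \<le> 9 * norm_sq 0"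
  proof (rule energy_almost_monotone[OF T0(1)])
    fix s assume "s \<in> {0..T}"
    hence "norm_sq s \<le> 2 * \<epsilon>\<^sup>2" using before[of s] XT by (cases "s = T") auto
    thus "norm_sq s \<le> s0\<^sup>2" using \<epsilon> by simp
  qed
  moreover have "\<epsilon>\<^sup>2 \<ge> 0" by simp
  ultimately show False using T0(3) X0 by linarith
qed

lemma sech_sq: "(sech x)\<^sup>2 = 1 - (tanh x)\<^sup>2"
proof -
  have "cosh x \<noteq> 0" by (simp add: cosh_real_nonzero)
  moreover have "1 / (cosh x)\<^sup>2 = ((cosh x)\<^sup>2 - (sinh x)\<^sup>2) / (cosh x)\<^sup>2"
    by (simp only: hyperbolic_pythagoras)
  ultimately show ?thesis by (simp add: sech_def tanh_def power_divide diff_divide_distrib)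
qed

definition weighted_energy :: "real \<Rightarrow> real \<Rightarrow> real" where
  "weighted_energy lam t = (\<integral>x. (sech (x / lam))\<^sup>2 * ((u1 t x)\<^sup>2 + (ux t x)\<^sup>2 + (u2 t x)\<^sup>2) \<partial>lborel)"

lemma sech_weight:
  assumes "lam > 0"
  shows "continuous_on UNIV (\<lambda>x. sech (x / lam))" "\<bar>sech (x / lam)\<bar> \<le> 1"
    "g \<in> L2 \<Longrightarrow> integrable lborel (\<lambda>x. (sech (x / lam))\<^sup>2 * (g x)\<^sup>2)"
proof -
  show c: "continuous_on UNIV (\<lambda>x. sech (x / lam))"
    unfolding sech_def using assms by (intro continuous_intros) (auto simp: cosh_real_nonzero)
  show b: "\<bar>sech (x / lam)\<bar> \<le> 1" for x
    unfolding sech_def using cosh_real_ge_1[of "x / lam"] by simp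
  show "integrable lborel (\<lambda>x. (sech (x / lam))\<^sup>2 * (g x)\<^sup>2)" if g: "g \<in> L2"
  proof (rule Bochner_Integration.integrable_bound[OF L2D(2)[OF g]])
    show "(\<lambda>x. (sech (x / lam))\<^sup>2 * (g x)\<^sup>2) \<in> borel_measurable lborel"
      using L2D(1)[OF g] borel_measurable_continuous_onI[OF c] by simp
    have "(sech (x / lam))\<^sup>2 \<le> 1" for x using b[of x] by (simp add: abs_square_le_1)
    thus "AE x in lborel. norm ((sech (x / lam))\<^sup>2 * (g x)\<^sup>2) \<le> norm ((g x)\<^sup>2)"
      by (auto intro!: AE_I2 mult_left_le_one_le simp: abs_mult)
  qed
qed

lemma weighted_energy_eq:
  assumes "lam > 0"
  shows "local_energy lam (u1 t) (u2 t) = ennreal (weighted_energy lam t)"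
    "weighted_energy lam t = (\<integral>x. (sech (x / lam))\<^sup>2 * (u1 t x)\<^sup>2 \<partial>lborel)
        + (\<integral>x. (sech (x / lam))\<^sup>2 * (ux t x)\<^sup>2 \<partial>lborel) + (\<integral>x. (sech (x / lam))\<^sup>2 * (u2 t x)\<^sup>2 \<partial>lborel)"
proof -
  note i = sech_weight(3)[OF assms in_spaces(2), of t] sech_weight(3)[OF assms in_spaces(3), of t]
    sech_weight(3)[OF assms in_spaces(4), of t]
  have "integrable lborel (\<lambda>x. (sech (x / lam))\<^sup>2 * ((u1 t x)\<^sup>2 + (ux t x)\<^sup>2 + (u2 t x)\<^sup>2))"
    using i by (simp add: distrib_left)
  thus "local_energy lam (u1 t) (u2 t) = ennreal (weighted_energy lam t)"
    unfolding local_energy_def weighted_energy_def ux_def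
        by (rule nn_integral_eq_integral) (simp add: add_nonneg_nonneg)
  show "weighted_energy lam t = (\<integral>x. (sech (x / lam))\<^sup>2 * (u1 t x)\<^sup>2 \<partial>lborel)
      + (\<integral>x. (sech (x / lam))\<^sup>2 * (ux t x)\<^sup>2 \<partial>lborel) + (\<integral>x. (sech (x / lam))\<^sup>2 * (u2 t x)\<^sup>2 \<partial>lborel)"
    using i unfolding weighted_energy_def by (simp add: distrib_left)
qed

lemma weighted_energy_tendsto:
  assumes lam: "lam > 0" and Xt: "norm_sq t \<le> s0\<^sup>2"
  shows "((\<lambda>\<delta>. regularised_system.sech2_energy (V \<delta> 0) (V \<delta> 1) (W \<delta> 0) lam t)
      \<longlongrightarrow> weighted_energy lam t) (at_right 0)"
proof -
  have ev: "\<forall>\<^sub>F \<delta>::real in at_right 0. \<delta> > 0" by (simp add: eventually_at_right_less)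
  have lim: "((\<lambda>\<delta>. \<integral>x. (sech (x / lam))\<^sup>2 * (conv g (k \<delta>) x)\<^sup>2 \<partial>lborel)
      \<longlongrightarrow> (\<integral>x. (sech (x / lam))\<^sup>2 * (g x)\<^sup>2 \<partial>lborel)) (at_right 0)" if "g \<in> L2" for g
    by (rule tendsto_weighted_sqnorm[OF _ that conv_k_tendsto[OF that] sech_weight(1,2)[OF lam]])
       (use ev in eventually_elim, rule conv_k_L2(1)[OF _ that])
  have "((\<lambda>\<delta>. (\<integral>x. (sech (x / lam))\<^sup>2 * (conv (u1 t) (k \<delta>) x)\<^sup>2 \<partial>lborel)
      + (\<integral>x. (sech (x / lam))\<^sup>2 * (conv (ux t) (k \<delta>) x)\<^sup>2 \<partial>lborel)
     + (\<integral>x. (sech (x / lam))\<^sup>2 * (conv (u2 t) (k \<delta>) x)\<^sup>2 \<partial>lborel)) \<longlongrightarrow> weighted_energy lam t) (at_right 0)"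
    unfolding weighted_energy_eq(2)[OF lam] by (intro tendsto_intros lim in_spaces)
  thus ?thesis
  proof (rule Lim_transform_eventually)
    show "\<forall>\<^sub>F \<delta> in at_right 0. (\<integral>x. (sech (x / lam))\<^sup>2 * (conv (u1 t) (k \<delta>) x)\<^sup>2 \<partial>lborel)
        + (\<integral>x. (sech (x / lam))\<^sup>2 * (conv (ux t) (k \<delta>) x)\<^sup>2 \<partial>lborel)
     + (\<integral>x. (sech (x / lam))\<^sup>2 * (conv (u2 t) (k \<delta>) x)\<^sup>2 \<partial>lborel)
         = regularised_system.sech2_energy (V \<delta> 0) (V \<delta> 1) (W \<delta> 0) lam t"
      using ev
    proof eventually_elim
      case (elim \<delta>)
      interpret R: regularised_system "V \<delta> 0" "V \<delta> 1" "V \<delta> 2" "V \<delta> 3" "W \<delta> 0" "W \<delta> 1" "W \<delta> 2"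
          "NL \<delta>" f "deriv f" F t t s0
        by (rule regularised[OF _ _ elim]) (use Xt in auto)
      note i = sech_weight(3)[OF lam conv_k_L2(1)[OF elim in_spaces(2)], of t] sech_weight(3)[OF lam
          conv_k_L2(1)[OF elim in_spaces(3)], of t]
         sech_weight(3)[OF lam conv_k_L2(1)[OF elim in_spaces(4)], of t]
      have "R.sech2_energy lam t = (\<integral>x. (sech (x / lam))\<^sup>2 * (conv (u1 t) (k \<delta>) x)\<^sup>2
          + (sech (x / lam))\<^sup>2 * (conv (ux t) (k \<delta>) x)\<^sup>2
          + (sech (x / lam))\<^sup>2 * (conv (u2 t) (k \<delta>) x)\<^sup>2 \<partial>lborel)"
        unfolding R.sech2_energy_def unfolding V1_eq[OF elim] sech_sq funpow_0
            by (simp add: distrib_left power2_eq_square)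
      also have "\<dots> = (\<integral>x. (sech (x / lam))\<^sup>2 * (conv (u1 t) (k \<delta>) x)\<^sup>2 \<partial>lborel)
          + (\<integral>x. (sech (x / lam))\<^sup>2 * (conv (ux t) (k \<delta>) x)\<^sup>2 \<partial>lborel)
          + (\<integral>x. (sech (x / lam))\<^sup>2 * (conv (u2 t) (k \<delta>) x)\<^sup>2 \<partial>lborel)"
        using i by simp
      finally show ?case by (rule sym)
    qed
  qed
qed

end

section \<open>The space-time bound\<close>

context small_boussinesq
begin

text \<open>The mollified weighted energies converge at each fixed time. Without uniformity in time, Fatou's
  lemma passes the bound on their time integrals to the limit.\<close>
lemma virial_bound_finite:
  assumes lam: "lam \<ge> 4" and ab: "a \<le> b" and small: "\<And>t. t \<in> {a..b} \<Longrightarrow> norm_sq t \<le> s0\<^sup>2"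
  shows "(\<lambda>t. local_energy lam (u1 t) (u2 t) * indicator {a..b} t) \<in> borel_measurable lborel"
    and "(\<integral>\<^sup>+t\<in>{a..b}. local_energy lam (u1 t) (u2 t) \<partial>lborel) \<le> ennreal (2 * lam * (norm_sq a + norm_sq b))"
proof -
  have lam0: "lam > 0" using lam by simp
  define d where "d n = 1 / real (Suc n)" for n
  have d: "d n > 0" for n by (simp add: d_def)
  have d0: "filterlim d (at_right 0) sequentially" unfolding d_def by (rule inverse_Suc_at_right_0)
  define y where "y n t = regularised_system.sech2_energy (V (d n) 0) (V (d n) 1) (W
      (d n) 0) lam t * indicator {a..b} t" for n t
  define c where "c n = 4 * K * A * s0\<^sup>2 * d n" for n
  have y: "integrable lborel (y n)"
      "(\<integral>t. y n t \<partial>lborel) \<le> 2 * lam * (norm_sq a + norm_sq b) + 4 * lam * s0 * c n * (b - a)"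
    and y0: "y n t \<ge> 0" for n t
  proof -
    interpret R: regularised_system "V (d n) 0" "V (d n) 1" "V (d n) 2" "V (d n) 3" "W (d n) 0" "W (d n) 1"
        "W (d n) 2" "NL (d n)" f "deriv f" F a b s0
      by (rule regularised[OF ab small d])
    have c: "(\<integral>x. \<bar>R.residual t x\<bar> \<partial>lborel) \<le> c n" if "t \<in> {a..b}" for t
      unfolding c_def by (rule residual_bounds(2)[OF ab small d that])
    note v = R.virial_inequality[OF lam residual_bounds(1)[OF ab small d] c]
    show "integrable lborel (y n)" unfolding y_def[abs_def] by (rule v(1))
    have "R.total t \<le> norm_sq t" for t
      using total_le[OF d[of n], of t] unfolding total_def R.total_def .
    hence "2 * lam * (R.total a + R.total b) \<le> 2 * lam * (norm_sq a + norm_sq b)"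
      using lam by (intro mult_left_mono add_mono) auto
    moreover have "(\<integral>t. y n t \<partial>lborel) \<le> 2 * lam * (R.total a + R.total b) + 4 * lam * s0 * c n * (b - a)"
      unfolding y_def by (rule v(2))
    ultimately show "(\<integral>t. y n t \<partial>lborel) \<le> 2 * lam * (norm_sq a + norm_sq b) + 4 * lam * s0 * c n * (b - a)"
      by linarith
    have "0 \<le> R.sech2_energy lam t"
      unfolding R.sech2_energy_def sech_sq[symmetric]
      by (rule integral_nonneg_AE, rule AE_I2, rule mult_nonneg_nonneg) (auto intro!: add_nonneg_nonneg)
    thus "y n t \<ge> 0" unfolding y_def by (rule mult_nonneg_nonneg) simp
  qed
  have lim: "(\<lambda>n. y n t) \<longlonglongrightarrow> weighted_energy lam t * indicator {a..b} t" for t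
  proof (cases "t \<in> {a..b}")
    case True
    from filterlim_compose[OF weighted_energy_tendsto[OF lam0 small[OF True]] d0]
    show ?thesis using True by (simp add: y_def)
  qed (simp add: y_def)
  have [measurable]: "y n \<in> borel_measurable lborel" for n using y(1) by auto
  have eq: "local_energy lam (u1 t) (u2 t) * indicator {a..b} t
      = ennreal (weighted_energy lam t * indicator {a..b} t)" for t
    by (simp add: weighted_energy_eq(1)[OF lam0] indicator_def)
  have "(\<lambda>t. weighted_energy lam t * indicator {a..b} t) \<in> borel_measurable lborel"
    by (rule borel_measurable_LIMSEQ_real[OF lim]) simp
  thus "(\<lambda>t. local_energy lam (u1 t) (u2 t) * indicator {a..b} t) \<in> borel_measurable lborel"
    unfolding eq by simp
  have "(\<integral>\<^sup>+t. ennreal (weighted_energy lam t * indicator {a..b} t) \<partial>lborel)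
      = (\<integral>\<^sup>+t. liminf (\<lambda>n. ennreal (y n t)) \<partial>lborel)"
    by (intro nn_integral_cong lim_imp_Liminf[symmetric] tendsto_ennrealI lim) simp
  also have "\<dots> \<le> liminf (\<lambda>n. \<integral>\<^sup>+t. ennreal (y n t) \<partial>lborel)"
    by (rule nn_integral_liminf) simp
  also have "\<dots> \<le> liminf (\<lambda>n. ennreal (2 * lam * (norm_sq a + norm_sq b) + 4 * lam * s0 * c n * (b - a)))"
    by (intro Liminf_mono always_eventually allI)
       (simp add: nn_integral_eq_integral[OF y(1)] y0 ennreal_leI[OF y(2)])
  also have "\<dots> = ennreal (2 * lam * (norm_sq a + norm_sq b))"
  proof (rule lim_imp_Liminf)
    have "(\<lambda>n. d n) \<longlonglongrightarrow> 0" unfolding d_def using LIMSEQ_inverse_real_of_nat by (simp add: inverse_eq_divide)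
    hence "(\<lambda>n. 2 * lam * (norm_sq a + norm_sq b) + 4 * lam * s0 * c n * (b - a))
        \<longlonglongrightarrow> 2 * lam * (norm_sq a + norm_sq b) + 4 * lam * s0 * (4 * K * A * s0\<^sup>2 * 0) * (b - a)"
      unfolding c_def by (intro tendsto_intros)
    thus "(\<lambda>n. ennreal (2 * lam * (norm_sq a + norm_sq b) + 4 * lam * s0 * c n * (b - a)))
        \<longlonglongrightarrow> ennreal (2 * lam * (norm_sq a + norm_sq b))"
      by (intro tendsto_ennrealI) simp
  qed simp
  finally show "(\<integral>\<^sup>+t\<in>{a..b}. local_energy lam (u1 t) (u2 t) \<partial>lborel)
      \<le> ennreal (2 * lam * (norm_sq a + norm_sq b))"
    unfolding eq .
qed

lemma virial_bound:
  assumes lam: "lam \<ge> 4" and X0: "norm_sq 0 < \<epsilon>\<^sup>2" and \<epsilon>: "2 * \<epsilon>\<^sup>2 \<le> s0\<^sup>2"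
  shows "(\<integral>\<^sup>+t\<in>{2..}. local_energy lam (u1 t) (u2 t) \<partial>lborel) \<le> ennreal (8 * lam * \<epsilon>\<^sup>2)"
proof -
  have norm_sq: "norm_sq t \<le> 2 * \<epsilon>\<^sup>2" if "t \<ge> 0" for t by (rule stays_small[OF X0 \<epsilon> that])
  hence Xs: "norm_sq t \<le> s0\<^sup>2" if "t \<in> {2..2 + real n}" for t n using that \<epsilon>
    by (intro order_trans[OF norm_sq]) auto
  have fin: "(\<integral>\<^sup>+t\<in>{2..2 + real n}. local_energy lam (u1 t) (u2 t) \<partial>lborel) \<le> ennreal (8 * lam * \<epsilon>\<^sup>2)" for n
  proof -
    have "2 * lam * (norm_sq 2 + norm_sq (2 + real n)) \<le> 2 * lam * (2 * \<epsilon>\<^sup>2 + 2 * \<epsilon>\<^sup>2)"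
      using lam by (intro mult_left_mono add_mono norm_sq) auto
    also have "\<dots> = 8 * lam * \<epsilon>\<^sup>2" by simp
    finally show ?thesis
      using virial_bound_finite(2)[OF lam, of 2 "2 + real n"] Xs
      by (intro order_trans[OF virial_bound_finite(2)[OF lam _ Xs] ennreal_leI]) auto
  qed
  have "(\<integral>\<^sup>+t\<in>{2..}. local_energy lam (u1 t) (u2 t) \<partial>lborel)
      = (\<integral>\<^sup>+t. liminf (\<lambda>n. local_energy lam (u1 t) (u2 t) * indicator {2..2 + real n} t) \<partial>lborel)"
  proof (intro nn_integral_cong lim_imp_Liminf[symmetric])
    fix t :: real
    obtain N :: nat where N: "t < N" using reals_Archimedean2 by blast
    have "\<forall>\<^sub>F n in sequentially. local_energy lam (u1 t) (u2 t) * indicator {2..2 + real n} t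
        = local_energy lam (u1 t) (u2 t) * indicator {2..} t"
      using eventually_ge_at_top[of N] by eventually_elim (use N in \<open>auto simp: indicator_def\<close>)
    thus "(\<lambda>n. local_energy lam (u1 t) (u2 t) * indicator {2..2 + real n} t)
        \<longlonglongrightarrow> local_energy lam (u1 t) (u2 t) * indicator {2..} t"
      by (rule tendsto_eventually)
  qed simp
  also have "\<dots> \<le> liminf (\<lambda>n. \<integral>\<^sup>+t\<in>{2..2 + real n}. local_energy lam (u1 t) (u2 t) \<partial>lborel)"
    by (rule nn_integral_liminf) (rule virial_bound_finite(1)[OF lam _ Xs], auto)
  also have "\<dots> \<le> liminf (\<lambda>n::nat. ennreal (8 * lam * \<epsilon>\<^sup>2))"
    by (intro Liminf_mono always_eventually allI fin)
  also have "\<dots> = ennreal (8 * lam * \<epsilon>\<^sup>2)" by (simp add: Liminf_const)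
  finally show ?thesis .
qed

end

text \<open>If \<open>g\<close> were bounded below by a positive constant on some half-line, its integral would be infinite.\<close>
lemma finite_integral_imp_null_sequence:
  fixes g :: "real \<Rightarrow> ennreal"
  assumes "(\<integral>\<^sup>+t\<in>{a..}. g t \<partial>lborel) < \<infinity>"
  obtains t :: "nat \<Rightarrow> real" where "strict_mono t" "filterlim t at_top sequentially" "(\<lambda>n. g (t n)) \<longlonglongrightarrow> 0"
proof -
  have ex: "\<exists>s>T. g s < ennreal e" if e: "e > 0" for T e :: real
  proof (rule ccontr)
    assume "\<not> ?thesis"
    hence ge: "ennreal e \<le> g s" if "s > T" for s using that by (meson not_less)
    define M where "M = max a T"
    have "ennreal e * emeasure lborel {M<..} = (\<integral>\<^sup>+t. ennreal e * indicator {M<..} t \<partial>lborel)"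
      by (rule nn_integral_cmult_indicator[symmetric]) simp
    also have "\<dots> \<le> (\<integral>\<^sup>+t\<in>{a..}. g t \<partial>lborel)"
      by (intro nn_integral_mono) (use ge in \<open>auto simp: M_def indicator_def\<close>)
    finally have "ennreal e * emeasure lborel {M<..} < \<infinity>" using assms by simp
    moreover have "emeasure lborel {M<..} = \<infinity>"
    proof (rule ccontr)
      assume "\<not> ?thesis"
      then obtain r where r: "r \<ge> 0" "emeasure lborel {M<..} = ennreal r"
        by (cases "emeasure lborel {M<..}") (auto simp: top_ennreal_def[symmetric] infinity_ennreal_def)
      have "ennreal (r + 1) = emeasure lborel {M<..<M + (r + 1)}" using r(1) by simp
      also have "\<dots> \<le> emeasure lborel {M<..}" by (rule emeasure_mono) auto
      finally show False using r by (simp add: ennreal_le_iff)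
    qed
    ultimately show False using e by (simp add: ennreal_mult_top)
  qed
  have "\<exists>t. \<forall>n. (g (t n) < ennreal (1 / real (Suc n)) \<and> t n > real n) \<and> t n < t (Suc n)"
  proof (rule dependent_nat_choice)
    show "\<exists>x. g x < ennreal (1 / real (Suc 0)) \<and> x > real 0" using ex[of 1 0] by auto
    fix x n
    show "\<exists>y. (g y < ennreal (1 / real (Suc (Suc n))) \<and> y > real (Suc n)) \<and> x < y"
      using ex[of "1 / real (Suc (Suc n))" "max x (real (Suc n))"] by auto
  qed
  then obtain t where t: "\<And>n. g (t n) < ennreal (1 / real (Suc n))" "\<And>n. t n > real n" "\<And>n. t n < t (Suc n)"
    by blast
  show ?thesis
  proof (rule that[of t])
    show "strict_mono t" using t(3) by (auto intro: strict_monoI_Suc)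
    show "filterlim t at_top sequentially"
      by (rule filterlim_at_top_mono[OF filterlim_real_sequentially])
          (rule always_eventually, rule allI, rule less_imp_le, rule t(2))
    have "(\<lambda>n. ennreal (1 / real (Suc n))) \<longlonglongrightarrow> ennreal 0"
      using LIMSEQ_inverse_real_of_nat by (intro tendsto_ennrealI) (simp add: inverse_eq_divide)
    hence l: "(\<lambda>n. ennreal (1 / real (Suc n))) \<longlonglongrightarrow> 0" by simp
    show "(\<lambda>n. g (t n)) \<longlonglongrightarrow> 0"
      by (rule tendsto_sandwich[OF _ _ tendsto_const l])
          (auto intro!: always_eventually less_imp_le[OF t(1)] simp del: of_nat_Suc)
  qed
qed

theorem lemma3p2:
  fixes p :: real and f :: "real \<Rightarrow> real"
  assumes "p > 1"
    and "smooth f"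
    and "f 0 = 0"
    and "\<exists>K. \<forall>s. \<bar>s\<bar> < 1 \<longrightarrow> \<bar>deriv f s\<bar> \<le> K * \<bar>s\<bar> powr (p - 1)"
  shows "\<exists>\<epsilon>\<^sub>0>0. \<exists>\<Lambda>>0. \<exists>C::real. \<forall>\<epsilon>::real. 0 < \<epsilon> \<and> \<epsilon> \<le> \<epsilon>\<^sub>0 \<longrightarrow>
    (\<forall>u\<^sub>1 u\<^sub>2 :: real \<Rightarrow> real \<Rightarrow> real.
       energy_solution f u\<^sub>1 u\<^sub>2 \<and> energy_norm (u\<^sub>1 0) (u\<^sub>2 0) < \<epsilon> \<longrightarrow>
       (\<forall>lam\<^sub>0\<ge>\<Lambda>.
          (\<exists>t :: nat \<Rightarrow> real. strict_mono t \<and> filterlim t at_top sequentially \<and>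
             (\<lambda>n. local_energy lam\<^sub>0 (u\<^sub>1 (t n)) (u\<^sub>2 (t n))) \<longlonglongrightarrow> 0) \<and>
          (\<integral>\<^sup>+t\<in>{2..}. local_energy lam\<^sub>0 (u\<^sub>1 t) (u\<^sub>2 t) \<partial>lborel) \<le> ennreal (C * lam\<^sub>0 * \<epsilon>\<^sup>2)))"
proof -
  note smooth = smooth_deriv[OF \<open>smooth f\<close>]
  have f'0: "deriv f 0 = 0"
  proof -
    obtain K where "\<forall>s. \<bar>s\<bar> < 1 \<longrightarrow> \<bar>deriv f s\<bar> \<le> K * \<bar>s\<bar> powr (p - 1)" using assms(4) by blast
    from this[rule_format, of 0] show ?thesis by simp
  qed
  have "isCont (deriv f) 0"
    using smooth_continuous_on[OF smooth, of UNIV] by (simp add: continuous_on_eq_continuous_at)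
  then obtain d where d: "d > 0" "\<And>s. \<bar>s\<bar> < d \<Longrightarrow> \<bar>deriv f s\<bar> < 1 / 16"
    unfolding continuous_at_eps_delta dist_real_def f'0
        by (metis diff_zero zero_less_divide_1_iff zero_less_numeral)
  define s0 where "s0 = d / 2"
  have s0: "s0 > 0" "\<And>s. \<bar>s\<bar> \<le> s0 \<Longrightarrow> \<bar>deriv f s\<bar> \<le> 1 / 16"
    using d by (force simp: s0_def intro: less_imp_le)+
  obtain K where K: "\<And>s. \<bar>s\<bar> \<le> s0 \<Longrightarrow> \<bar>deriv (deriv f) s\<bar> \<le> K"
    using continuous_bounded_on_interval[OF smooth_continuous_on[OF smooth_deriv[OF smooth]]] by blast
  have "\<exists>F. \<forall>s. - \<infinity> < ereal s \<longrightarrow> ereal s < \<infinity> \<longrightarrow> (F has_vector_derivative f s) (at s)"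
    using smooth_continuous_on[OF \<open>smooth f\<close>, of UNIV]
    by (intro einterval_antiderivative) (auto simp: continuous_on_eq_continuous_at)
  then obtain F1 where F1: "\<And>s. (F1 has_real_derivative f s) (at s)"
    by (auto simp: has_real_derivative_iff_has_vector_derivative)
  define F where "F s = F1 s - F1 0" for s
  have F: "(F has_real_derivative f s) (at s)" "F 0 = 0" for s
    unfolding F_def by (auto intro!: derivative_eq_intros F1)
  obtain k A B where kAB: "mollifiers k A B" using mollifiers_exist by blast
  show ?thesis
  \<comment> \<open>The choice \<open>s0 / 2\<close> ensures \<open>2 * \<epsilon>\<^sup>2 \<le> s0\<^sup>2\<close>, as needed to stay in the range where \<open>f'\<close> is small.\<close>
  proof (rule exI[of _ "s0 / 2"], rule conjI, use s0 in simp, rule exI[of _ 4], rule conjI, simp,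
      rule exI[of _ 8], intro allI impI conjI)
    fix \<epsilon> lam :: real and u1 u2 :: "real \<Rightarrow> real \<Rightarrow> real"
    assume \<epsilon>: "0 < \<epsilon> \<and> \<epsilon> \<le> s0 / 2"
      and u: "energy_solution f u1 u2 \<and> energy_norm (u1 0) (u2 0) < \<epsilon>" and lam: "4 \<le> lam"
    interpret small_boussinesq k A B f u1 u2 F s0 K
      by unfold_locales (use kAB assms u F s0 K in auto)
    have X0: "norm_sq 0 < \<epsilon>\<^sup>2"
      using power_strict_mono[of "sqrt (norm_sq 0)" \<epsilon> 2] u norm_sq_nonneg[of 0] by (simp add: energy_norm_eq)
    have "\<epsilon>\<^sup>2 \<le> (s0 / 2)\<^sup>2" using \<epsilon> by (intro power_mono) auto
    hence "4 * \<epsilon>\<^sup>2 \<le> s0\<^sup>2" by (simp add: power_divide)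
    hence \<epsilon>s: "2 * \<epsilon>\<^sup>2 \<le> s0\<^sup>2" using zero_le_power2[of \<epsilon>] by linarith
    show b: "(\<integral>\<^sup>+t\<in>{2..}. local_energy lam (u1 t) (u2 t) \<partial>lborel) \<le> ennreal (8 * lam * \<epsilon>\<^sup>2)"
      by (rule virial_bound[OF lam X0 \<epsilon>s])
    hence "(\<integral>\<^sup>+t\<in>{2..}. local_energy lam (u1 t) (u2 t) \<partial>lborel) < \<infinity>"
      by (rule le_less_trans) simp
    from finite_integral_imp_null_sequence[OF this]
    show "\<exists>t :: nat \<Rightarrow> real. strict_mono t \<and> filterlim t at_top sequentially \<and>
             (\<lambda>n. local_energy lam (u1 (t n)) (u2 (t n))) \<longlonglongrightarrow> 0" by blast
  qed
qed

end
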